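(* Fix an integer $d\ge 3$ and $\lambda\in\mathbb{R}$, and consider $G(n,d,p)$ with $p=\frac{1+\lambda n^{-1/3}}{d-1}$. Let $\mathcal{C}_1$ be the largest connected component of $G(n,d,p)$. Then there exist constants $c(\lambda,d)>0$ and $C(\lambda,d)<\infty$ such that for any $A>0$ and all $n$, $$\mathbb{P}\big(|\mathcal{C}_1|\ge An^{2/3}\big)\le\frac{C(\lambda,d)\,e^{-c(\lambda,d)A^3}}{A}.$$ Furthermore, there exists a constant $D=D(\lambda,d)$ such that for all sufficiently small $\delta>0$ and all $n$, $$\mathbb{P}\big(|\mathcal{C}_1|<\lceil\delta n^{2/3}\rceil\big)\le D(\lambda,d)\,\delta^{1/2}.$$
   Context: For $d\ge 3$ fixed, $n$ with $dn$ even and $p\in(0,1)$, $G(n,d,p)$ is the random graph on $n$ vertices obtained by first drawing a uniformly random simple $d$-regular graph on $n$ vertices and then independently retaining each edge with probability $p$ and deleting it with probability $1-p$. Only those $n$ for which the model is defined ($dn$ even, a simple $d$-regular graph on $n$ vertices exists, $p\in(0,1)$) are considered. $|\mathcal{C}|$ is the number of vertices of $\mathcal{C}$. *)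

theory Defs
  imports "HOL-Probability.Probability"
begin

text \<open>
  A simple graph on the vertex set \<open>{..<n}\<close> is represented by its edge set, a set of
  two-element subsets of \<open>{..<n}\<close>.
\<close>

definition simple_graphs :: "nat \<Rightarrow> nat set set set" where
  "simple_graphs n = Pow {e. e \<subseteq> {..<n} \<and> card e = 2}"

definition degree :: "nat set set \<Rightarrow> nat \<Rightarrow> nat" where
  "degree E v = card {e \<in> E. v \<in> e}"

definition regular_graphs :: "nat \<Rightarrow> nat \<Rightarrow> nat set set set" where
  "regular_graphs n d = {E \<in> simple_graphs n. \<forall>v<n. degree E v = d}"

definition component :: "nat set set \<Rightarrow> nat \<Rightarrow> nat set" where
  "component E v = {w. (v, w) \<in> {(x, y). {x, y} \<in> E}\<^sup>*}"

definition components :: "nat \<Rightarrow> nat set set \<Rightarrow> nat set set" where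
  "components n E = component E ` {..<n}"

text \<open>
  All largest components have the same number of vertices, so no tie-breaking rule is needed.
  The maximum is over a nonempty set as soon as \<open>n > 0\<close>.
\<close>

definition largest_component_size :: "nat \<Rightarrow> nat set set \<Rightarrow> nat" where
  "largest_component_size n E = Max (card ` components n E)"

definition percolation :: "real \<Rightarrow> nat set set \<Rightarrow> nat set set pmf" where
  "percolation p E =
     map_pmf (\<lambda>keep. {e \<in> E. keep e}) (Pi_pmf E False (\<lambda>_. bernoulli_pmf p))"

lemma finite_simple_graphs: "finite (simple_graphs n)"
  unfolding simple_graphs_def by (auto intro: finite_subset [of _ "Pow {..<n}"])

lemma finite_regular_graphs: "finite (regular_graphs n d)"
  unfolding regular_graphs_def using finite_simple_graphs by simp

text \<open>
  Since \<open>pmf_of_set\<close> is unspecified on the empty set and \<open>bernoulli_pmf\<close> clips its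
  parameter to \<open>[0, 1]\<close>, \<open>Gndp_defined\<close> collects the conditions under which the model is
  considered. The condition \<open>n > 0\<close> excludes the graph without vertices, which is vacuously
  \<open>d\<close>-regular for every \<open>d\<close>.
\<close>

definition Gndp :: "nat \<Rightarrow> nat \<Rightarrow> real \<Rightarrow> nat set set pmf" where
  "Gndp n d p = bind_pmf (pmf_of_set (regular_graphs n d)) (percolation p)"

definition Gndp_defined :: "nat \<Rightarrow> nat \<Rightarrow> real \<Rightarrow> bool" where
  "Gndp_defined n d p \<longleftrightarrow>
     n > 0 \<and> even (d * n) \<and> regular_graphs n d \<noteq> {} \<and> 0 < p \<and> p < 1"

definition critical_p :: "nat \<Rightarrow> real \<Rightarrow> nat \<Rightarrow> real" where
  "critical_p d lam n = (1 + lam * real n powr (-1/3)) / (real d - 1)"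

end

theory Submission
  imports Defs
begin

text \<open>
  Write \<open>s = n\<^bsup>1/3\<^esup>\<close>. A component is explored vertex by vertex, directly in the uniform random
  \<open>d\<close>-regular graph: after all edges at an explored vertex have been revealed, the rest is a uniform
  simple graph with the remaining degrees \<open>f\<close>. A switching argument bounds the probability that \<open>u\<close>
  and \<open>w\<close> are adjacent by \<open>f u * f w / (total - O(1))\<close>, which determines the drift of the number \<open>X\<close>
  of active half-edges up to \<open>O(1/n)\<close>; no comparison with the configuration model is needed.

  For the upper tail, \<open>X\<close> reaches \<open>s\<close> or survives \<open>s\<^sup>2 / 2\<close> steps with probability \<open>O(1 / s)\<close>. The
  vertices that have lost edges without being discovered give \<open>X\<close> a drift of order \<open>- t / n\<close> at
  time \<open>t\<close>, and an exponential supermartingale shows that survival up to time of order \<open>A * s\<^sup>2\<close> costs a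
  further factor \<open>exp (- c * A ^ 3)\<close>. Counting the vertices of large components concludes.

  For the lower tail, let \<open>h = \<delta>\<^bsup>1/4\<^esup> * s\<close>. Exploring components one after the other, \<open>X\<close> exceeds \<open>h\<close>
  within about \<open>s\<^sup>2\<close> steps except with probability \<open>O(h\<^sup>2 / s\<^sup>2)\<close>, and then stays positive for
  \<open>\<delta> * s\<^sup>2\<close> steps except with probability \<open>O(\<delta> * s\<^sup>2 / h\<^sup>2)\<close>. Both errors are of order \<open>\<delta>\<^bsup>1/2\<^esup>\<close>.
\<close>

section \<open>Graphs with prescribed degrees\<close>

text \<open>Every tail estimate is a backward induction on the number of steps left.
  \<open>law_step\<close> writes the law of the percolated graph as a mixture over one exploration
  step, so it suffices to find a function of \<open>f\<close>, \<open>B\<close> and the remaining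
  steps that dominates the probability at the end and whose mean after a step, with one step fewer
  left, is at most its present value. Filtrations, stopping times and optional stopping never
  appear; only first and second moments of the changes of \<open>active\<close> and
  \<open>deficit\<close> enter. The exponent \<open>A ^ 3\<close> comes from an exponential rate of
  order \<open>A / s\<close> over a horizon of order \<open>A * s\<^sup>2\<close>: the second-order
  cost of the exponential and the gain from the negative drift are then both of order
  \<open>A ^ 3\<close>, and a small constant in the rate lets the gain win. The factor
  \<open>1 / A\<close> is what remains when \<open>n = s ^ 3\<close> vertices, each with a bound of
  order \<open>1 / s\<close>, are divided by the threshold \<open>A * s\<^sup>2\<close>.\<close>

definition deg_graphs :: "nat \<Rightarrow> (nat \<Rightarrow> nat) \<Rightarrow> nat set set set" where
  "deg_graphs n f = {E \<in> simple_graphs n. \<forall>v<n. degree E v = f v}"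

definition nbrs :: "nat set set \<Rightarrow> nat \<Rightarrow> nat set" where
  "nbrs E u = {w. {u, w} \<in> E}"

definition star :: "nat \<Rightarrow> nat set \<Rightarrow> nat set set" where
  "star u A = (\<lambda>w. {u, w}) ` A"

text \<open>The degrees left after all edges between \<open>u\<close> and its neighbourhood \<open>A\<close> have been revealed and
  removed. Explored vertices have degree 0 from then on, so no separate record of them is kept.\<close>

definition residual :: "(nat \<Rightarrow> nat) \<Rightarrow> nat \<Rightarrow> nat set \<Rightarrow> nat \<Rightarrow> nat" where
  "residual f u A = (\<lambda>v. if v = u then 0 else if v \<in> A then f v - 1 else f v)"

lemma simple_graphs_edge:
  assumes "E \<in> simple_graphs n" "{x, y} \<in> E"
  shows "x < n" "y < n" "x \<noteq> y"
  using assms unfolding simple_graphs_def by auto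

lemma simple_graphs_edgeE:
  assumes "E \<in> simple_graphs n" "e \<in> E"
  obtains x y where "e = {x, y}" "x \<noteq> y" "x < n" "y < n"
proof -
  have "card e = 2" "e \<subseteq> {..<n}"
    using assms unfolding simple_graphs_def by auto
  then show thesis
    using that by (auto simp: card_2_iff)
qed

lemma finite_simple_graph: "E \<in> simple_graphs n \<Longrightarrow> finite E"
  unfolding simple_graphs_def by (auto intro: finite_subset [of _ "Pow {..<n}"])

lemma nbrs_bounded: "E \<in> simple_graphs n \<Longrightarrow> nbrs E u \<subseteq> {..<n}"
  using simple_graphs_edge by (auto simp: nbrs_def)

lemma finite_nbrs: "E \<in> simple_graphs n \<Longrightarrow> finite (nbrs E u)"
  by (rule finite_subset [OF nbrs_bounded]) simp_all

lemma not_self_nbr: "E \<in> simple_graphs n \<Longrightarrow> u \<notin> nbrs E u"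
  using simple_graphs_edge(3) [of E n u u] by (auto simp: nbrs_def)

lemma nbrs_sym: "w \<in> nbrs E u \<longleftrightarrow> u \<in> nbrs E w"
  by (simp add: nbrs_def insert_commute)

lemma degree_eq_card_nbrs:
  assumes "E \<in> simple_graphs n"
  shows "degree E v = card (nbrs E v)"
proof -
  have "bij_betw (\<lambda>w. {v, w}) (nbrs E v) {e \<in> E. v \<in> e}"
    unfolding bij_betw_def
  proof
    show "inj_on (\<lambda>w. {v, w}) (nbrs E v)"
      by (auto simp: inj_on_def doubleton_eq_iff)
    show "(\<lambda>w. {v, w}) ` nbrs E v = {e \<in> E. v \<in> e}"
    proof (intro subset_antisym subsetI)
      fix e assume "e \<in> {e \<in> E. v \<in> e}"
      then have e: "e \<in> E" "v \<in> e"
        by auto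
      from simple_graphs_edgeE [OF assms e(1)] obtain x y where "e = {x, y}" .
      then show "e \<in> (\<lambda>w. {v, w}) ` nbrs E v"
        using e by (auto simp: nbrs_def insert_commute)
    qed (auto simp: nbrs_def)
  qed
  then show ?thesis
    unfolding degree_def by (simp add: bij_betw_same_card)
qed

lemma deg_graphs_iff:
  "E \<in> deg_graphs n f \<longleftrightarrow> E \<in> simple_graphs n \<and> (\<forall>v<n. card (nbrs E v) = f v)"
  using degree_eq_card_nbrs by (auto simp: deg_graphs_def)

lemma finite_deg_graphs: "finite (deg_graphs n f)"
  unfolding deg_graphs_def using finite_simple_graphs by simp

lemma regular_graphs_eq: "regular_graphs n d = deg_graphs n (\<lambda>_. d)"
  unfolding regular_graphs_def deg_graphs_def ..

lemma star_edge_iff: "{x, y} \<in> star u A \<longleftrightarrow> (x = u \<and> y \<in> A) \<or> (y = u \<and> x \<in> A)"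
  by (auto simp: star_def doubleton_eq_iff)

lemma nbrs_star: "u \<notin> A \<Longrightarrow> nbrs (star u A) u = A"
  by (auto simp: nbrs_def star_edge_iff)

lemma nbrs_Un: "nbrs (E \<union> F) u = nbrs E u \<union> nbrs F u"
  by (auto simp: nbrs_def)

text \<open>Splitting off the star of \<open>u\<close> and gluing it back
  (\<open>deg_graphs_compose\<close>) are inverse to each other. Hence the graphs in which
  \<open>u\<close> has a given attainable neighbourhood are in bijection with the graphs with the
  residual degrees, which is why uniformity survives a step.\<close>

lemma deg_graphs_decompose:
  assumes E: "E \<in> deg_graphs n f" and u: "u < n"
  shows "E = star u (nbrs E u) \<union> {e \<in> E. u \<notin> e}"
    and "{e \<in> E. u \<notin> e} \<in> deg_graphs n (residual f u (nbrs E u))"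
proof -
  have S: "E \<in> simple_graphs n" and deg: "\<And>v. v < n \<Longrightarrow> card (nbrs E v) = f v"
    using E by (auto simp: deg_graphs_iff)
  show "E = star u (nbrs E u) \<union> {e \<in> E. u \<notin> e}"
  proof (intro subset_antisym subsetI)
    fix e assume e: "e \<in> E"
    from simple_graphs_edgeE [OF S e] obtain x y where "e = {x, y}" .
    then show "e \<in> star u (nbrs E u) \<union> {e \<in> E. u \<notin> e}"
      using e by (cases "u = x"; cases "u = y") (auto simp: nbrs_def star_def insert_commute)
  qed (auto simp: nbrs_def star_def)
  have S': "{e \<in> E. u \<notin> e} \<in> simple_graphs n"
    using S by (auto simp: simple_graphs_def)
  have "card (nbrs {e \<in> E. u \<notin> e} v) = residual f u (nbrs E u) v" if v: "v < n" for v
  proof (cases "v = u")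
    case True
    then show ?thesis
      by (simp add: nbrs_def residual_def)
  next
    case False
    have eq: "nbrs {e \<in> E. u \<notin> e} v = nbrs E v - {u}"
      using False by (auto simp: nbrs_def)
    have "v \<in> nbrs E u \<longleftrightarrow> u \<in> nbrs E v"
      by (rule nbrs_sym)
    then show ?thesis
      using False deg [OF v] finite_nbrs [OF S, of v] unfolding eq residual_def
      by (auto simp: card_Diff_singleton)
  qed
  with S' show "{e \<in> E. u \<notin> e} \<in> deg_graphs n (residual f u (nbrs E u))"
    using S' by (simp add: deg_graphs_iff)
qed

lemma deg_graphs_no_edge_if_zero:
  assumes "E \<in> deg_graphs n f" "f u = 0" "u < n"
  shows "nbrs E u = {}"
proof -
  have "card (nbrs E u) = 0" "E \<in> simple_graphs n"
    using assms by (auto simp: deg_graphs_iff)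
  then show ?thesis
    using finite_nbrs by auto
qed

lemma deg_graphs_compose:
  assumes E: "E \<in> deg_graphs n f" and u: "u < n"
    and F: "F \<in> deg_graphs n (residual f u (nbrs E u))"
  shows "star u (nbrs E u) \<union> F \<in> deg_graphs n f" "nbrs (star u (nbrs E u) \<union> F) u = nbrs E u"
    "star u (nbrs E u) \<inter> F = {}"
proof -
  have S: "E \<in> simple_graphs n" and deg: "\<And>v. v < n \<Longrightarrow> card (nbrs E v) = f v"
    using E by (auto simp: deg_graphs_iff)
  have SF: "F \<in> simple_graphs n"
    and degF: "\<And>v. v < n \<Longrightarrow> card (nbrs F v) = residual f u (nbrs E u) v"
    using F by (auto simp: deg_graphs_iff)
  have Fu: "nbrs F u = {}"
    using deg_graphs_no_edge_if_zero [OF F _ u] by (simp add: residual_def)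
  have unn: "u \<notin> nbrs E u"
    using not_self_nbr [OF S] .
  show nb: "nbrs (star u (nbrs E u) \<union> F) u = nbrs E u"
    using Fu unn by (simp add: nbrs_Un nbrs_star)
  show "star u (nbrs E u) \<inter> F = {}"
    using Fu by (auto simp: star_def nbrs_def)
  have "star u (nbrs E u) \<in> simple_graphs n"
    using nbrs_bounded [OF S, of u] unn u by (auto simp: star_def simple_graphs_def card_insert_if)
  then have S': "star u (nbrs E u) \<union> F \<in> simple_graphs n"
    using SF by (auto simp: simple_graphs_def)
  have "card (nbrs (star u (nbrs E u) \<union> F) v) = f v" if v: "v < n" for v
  proof (cases "v = u")
    case True
    then show ?thesis
      using nb deg u by simp
  next
    case False
    have eq: "nbrs (star u (nbrs E u) \<union> F) v = (if v \<in> nbrs E u then {u} else {}) \<union> nbrs F v"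
      using False by (auto simp: nbrs_def star_edge_iff)
    have uF: "u \<notin> nbrs F v"
      using Fu by (subst nbrs_sym) simp
    \<comment> \<open>A neighbour has positive degree, so the truncated \<open>f v - 1\<close> in
      \<open>residual\<close> is a true predecessor, and restoring the edge to \<open>u\<close>
      restores \<open>f v\<close>.\<close>
    have fv: "0 < f v" if "v \<in> nbrs E u"
    proof -
      have "u \<in> nbrs E v"
        using that by (subst nbrs_sym)
      then show ?thesis
        using deg [OF v] finite_nbrs [OF S, of v] card_gt_0_iff by fastforce
    qed
    show ?thesis
      using False degF [OF v] finite_nbrs [OF SF, of v] uF fv
      unfolding eq residual_def by auto
  qed
  then show "star u (nbrs E u) \<union> F \<in> deg_graphs n f"
    using S' by (simp add: deg_graphs_iff)
qed

subsection \<open>Switchings\<close>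

lemma card_ordered_edges:
  assumes "E \<in> deg_graphs n f"
  shows "card {(x, y). {x, y} \<in> E} = (\<Sum>v<n. f v)"
proof -
  have S: "E \<in> simple_graphs n" and deg: "\<And>v. v < n \<Longrightarrow> card (nbrs E v) = f v"
    using assms by (auto simp: deg_graphs_iff)
  have "{(x, y). {x, y} \<in> E} = (SIGMA x:{..<n}. nbrs E x)"
    using simple_graphs_edge [OF S] by (auto simp: nbrs_def)
  then show ?thesis
    using deg finite_nbrs [OF S] by (simp add: card_SigmaI)
qed

definition switch :: "nat \<Rightarrow> nat \<Rightarrow> nat set set \<Rightarrow> nat \<Rightarrow> nat \<Rightarrow> nat set set" where
  "switch u w E x y = (E - {{u, w}, {x, y}}) \<union> {{u, x}, {w, y}}"

text \<open>The hypotheses make \<open>u\<close>, \<open>w\<close>, \<open>x\<close>,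
  \<open>y\<close> four different vertices and both new edges absent, so each of the four trades one
  neighbour for a new one. The last equation shows that the switching can be undone once
  \<open>x\<close> and \<open>y\<close> are known.\<close>

lemma switch_in_deg_graphs:
  assumes E: "E \<in> deg_graphs n f" and uw: "{u, w} \<in> E" and xy: "{x, y} \<in> E"
    and x: "x \<noteq> u" "x \<notin> nbrs E u" and y: "y \<noteq> w" "y \<notin> nbrs E w"
  shows "switch u w E x y \<in> deg_graphs n f"
    and "{u, w} \<notin> switch u w E x y"
    and "x \<in> nbrs (switch u w E x y) u" and "y \<in> nbrs (switch u w E x y) w"
    and "E = (switch u w E x y - {{u, x}, {w, y}}) \<union> {{u, w}, {x, y}}"
proof -
  have S: "E \<in> simple_graphs n" and deg: "\<And>v. v < n \<Longrightarrow> card (nbrs E v) = f v"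
    using E by (auto simp: deg_graphs_iff)
  have ne: "u \<noteq> w" "x \<noteq> y" "u < n" "w < n" "x < n" "y < n"
    using simple_graphs_edge [OF S uw] simple_graphs_edge [OF S xy] by auto
  have ne2: "x \<noteq> w" "y \<noteq> u"
    using x y uw by (auto simp: nbrs_def insert_commute)
  have nin: "{u, x} \<notin> E" "{w, y} \<notin> E" "{x, u} \<notin> E" "{y, w} \<notin> E"
    using x y by (auto simp: nbrs_def insert_commute)
  have sym: "{w, u} \<in> E" "{y, x} \<in> E"
    using uw xy by (auto simp: insert_commute)
  note dis = ne ne2 x(1) y(1) nin uw xy sym
  show "{u, w} \<notin> switch u w E x y"
    and "x \<in> nbrs (switch u w E x y) u" and "y \<in> nbrs (switch u w E x y) w"
    using dis by (auto simp: switch_def nbrs_def doubleton_eq_iff)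
  show "E = (switch u w E x y - {{u, x}, {w, y}}) \<union> {{u, w}, {x, y}}"
    using dis by (auto simp: switch_def)
  have S': "switch u w E x y \<in> simple_graphs n"
    using S dis by (auto simp: switch_def simple_graphs_def card_insert_if)
  have nb: "nbrs (switch u w E x y) u = nbrs E u - {w} \<union> {x}"
    "nbrs (switch u w E x y) w = nbrs E w - {u} \<union> {y}"
    "nbrs (switch u w E x y) x = nbrs E x - {y} \<union> {u}"
    "nbrs (switch u w E x y) y = nbrs E y - {x} \<union> {w}"
    using dis by (auto simp: switch_def nbrs_def doubleton_eq_iff)
  have nb': "nbrs (switch u w E x y) v = nbrs E v" if "v \<notin> {u, w, x, y}" for v
    using that by (auto simp: switch_def nbrs_def doubleton_eq_iff)
  have sw: "card (nbrs E v - {b} \<union> {c}) = card (nbrs E v)" if "b \<in> nbrs E v" "c \<notin> nbrs E v" for v b c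
  proof -
    have "card (nbrs E v) > 0"
      using that finite_nbrs [OF S, of v] card_gt_0_iff by blast
    then show ?thesis
      using that finite_nbrs [OF S, of v] by (simp add: card_Diff_singleton)
  qed
  have "card (nbrs (switch u w E x y) v) = card (nbrs E v)" for v
  proof (cases "v \<in> {u, w, x, y}")
    case True
    then show ?thesis
      using nb sw dis by (auto simp: nbrs_def)
  next
    case False
    then show ?thesis
      using nb' by simp
  qed
  then show "switch u w E x y \<in> deg_graphs n f"
    using S' deg by (simp add: deg_graphs_iff)
qed

text \<open>An ordered edge is excluded only if \<open>x\<close> lies in the closed neighbourhood of
  \<open>u\<close> or \<open>y\<close> in that of \<open>w\<close>. Each of these has at most
  \<open>d + 1\<close> vertices with at most \<open>d\<close> edges apiece.\<close>

lemma card_switchable: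
  assumes E: "E \<in> deg_graphs n f" and le: "\<And>v. v < n \<Longrightarrow> f v \<le> d" and "u < n" "w < n"
  shows "(\<Sum>v<n. f v) \<le> card {(x, y). {x, y} \<in> E \<and> x \<noteq> u \<and> x \<notin> nbrs E u \<and> y \<noteq> w \<and> y \<notin> nbrs E w}
           + 2 * d * (d + 1)"
proof -
  have S: "E \<in> simple_graphs n" and deg: "\<And>v. v < n \<Longrightarrow> card (nbrs E v) = f v"
    using E by (auto simp: deg_graphs_iff)
  define G where "G = {(x, y). {x, y} \<in> E \<and> x \<noteq> u \<and> x \<notin> nbrs E u \<and> y \<noteq> w \<and> y \<notin> nbrs E w}"
  define I where "I v = insert v (nbrs E v)" for v
  have finI: "finite (I v)" and cardI: "v < n \<Longrightarrow> card (I v) \<le> d + 1" for v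
    using finite_nbrs [OF S, of v] deg [of v] le [of v] by (auto simp: I_def card_insert_if)
  have cardS: "card (SIGMA x:I v. nbrs E x) \<le> (d + 1) * d" "finite (SIGMA x:I v. nbrs E x)" if "v < n" for v
  proof -
    have "card (SIGMA x:I v. nbrs E x) = (\<Sum>x\<in>I v. card (nbrs E x))"
      using finI finite_nbrs [OF S] by (simp add: card_SigmaI)
    also have "\<dots> \<le> (\<Sum>x\<in>I v. d)"
      using that nbrs_bounded [OF S, of v] deg le by (intro sum_mono) (auto simp: I_def)
    also have "\<dots> \<le> (d + 1) * d"
      using mult_le_mono1 [OF cardI [OF that], of d] by simp
    finally show "card (SIGMA x:I v. nbrs E x) \<le> (d + 1) * d" .
    show "finite (SIGMA x:I v. nbrs E x)"
      using finI finite_nbrs [OF S] by auto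
  qed
  have finall: "finite {(x, y). {x, y} \<in> E}"
    using simple_graphs_edge [OF S] by (auto intro: finite_subset [of _ "{..<n} \<times> {..<n}"])
  have "{(x, y). {x, y} \<in> E} \<subseteq> G \<union> (SIGMA x:I u. nbrs E x) \<union> prod.swap ` (SIGMA x:I w. nbrs E x)"
    by (auto simp: G_def I_def nbrs_def insert_commute image_iff)
  moreover have "finite G"
    using finall by (rule finite_subset [rotated]) (auto simp: G_def)
  ultimately have "card {(x, y). {x, y} \<in> E}
      \<le> card (G \<union> (SIGMA x:I u. nbrs E x) \<union> prod.swap ` (SIGMA x:I w. nbrs E x))"
    using cardS(2) assms by (intro card_mono) auto
  also have "\<dots> \<le> card G + card (SIGMA x:I u. nbrs E x) + card (prod.swap ` (SIGMA x:I w. nbrs E x))"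
    by (meson card_Un_le add_mono le_trans order_refl)
  also have "card (prod.swap ` (SIGMA x:I w. nbrs E x)) \<le> card (SIGMA x:I w. nbrs E x)"
    using cardS(2) assms by (intro card_image_le) auto
  finally have "card {(x, y). {x, y} \<in> E} \<le> card G + (d + 1) * d + (d + 1) * d"
    using cardS(1) [of u] cardS(1) [of w] assms by linarith
  then show ?thesis
    using card_ordered_edges [OF E] unfolding G_def by (simp add: algebra_simps)
qed

text \<open>Double counting of switchings. A graph containing \<open>{u, w}\<close> admits at least
  the degree sum minus \<open>2 * d * (d + 1)\<close> of them; a resulting graph, in which
  \<open>x\<close> is a neighbour of \<open>u\<close> and \<open>y\<close> one of \<open>w\<close>,
  is reached in at most \<open>f u * f w\<close> ways. The subtraction is moved to the other side
  because the counts are natural numbers.\<close>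

lemma switching_count:
  assumes le: "\<And>v. v < n \<Longrightarrow> f v \<le> d" and uw: "u < n" "w < n"
  shows "card {E \<in> deg_graphs n f. w \<in> nbrs E u} * (\<Sum>v<n. f v)
           \<le> card {E \<in> deg_graphs n f. w \<in> nbrs E u} * (2 * d * (d + 1)) + card (deg_graphs n f) * (f u * f w)"
proof -
  define W where "W = {E \<in> deg_graphs n f. w \<in> nbrs E u}"
  define G where "G E = {(x, y). {x, y} \<in> E \<and> x \<noteq> u \<and> x \<notin> nbrs E u \<and> y \<noteq> w \<and> y \<notin> nbrs E w}" for E
  have finW: "finite W"
    using finite_deg_graphs by (simp add: W_def)
  have finG: "finite (G E)" if "E \<in> W" for E
  proof -
    have "E \<in> simple_graphs n"
      using that by (auto simp: W_def deg_graphs_iff)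
    then show ?thesis
      using simple_graphs_edge [of E n] by (auto simp: G_def intro: finite_subset [of _ "{..<n} \<times> {..<n}"])
  qed
  have "card W * (\<Sum>v<n. f v) = (\<Sum>E\<in>W. \<Sum>v<n. f v)"
    by simp
  also have "\<dots> \<le> (\<Sum>E\<in>W. card (G E) + 2 * d * (d + 1))"
    using card_switchable [OF _ le uw] by (intro sum_mono) (auto simp: W_def G_def)
  also have "\<dots> = card (SIGMA E:W. G E) + card W * (2 * d * (d + 1))"
    using finW finG by (simp add: sum.distrib card_SigmaI)
  also have "card (SIGMA E:W. G E) \<le> card (SIGMA E:deg_graphs n f. nbrs E u \<times> nbrs E w)"
  proof (rule card_inj_on_le [where f = "\<lambda>(E, x, y). (switch u w E x y, x, y)"])
    show "inj_on (\<lambda>(E, x, y). (switch u w E x y, x, y)) (SIGMA E:W. G E)"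
    proof (rule inj_onI, clarsimp)
      fix E E' x y
      assume E: "E \<in> W" "(x, y) \<in> G E" "E' \<in> W" "(x, y) \<in> G E'"
        and eq: "switch u w E x y = switch u w E' x y"
      have "E = (switch u w E x y - {{u, x}, {w, y}}) \<union> {{u, w}, {x, y}}"
        using E by (intro switch_in_deg_graphs(5)) (auto simp: W_def G_def nbrs_def)
      moreover have "E' = (switch u w E' x y - {{u, x}, {w, y}}) \<union> {{u, w}, {x, y}}"
        using E by (intro switch_in_deg_graphs(5)) (auto simp: W_def G_def nbrs_def)
      ultimately show "E = E'"
        using eq by simp
    qed
    show "(\<lambda>(E, x, y). (switch u w E x y, x, y)) ` (SIGMA E:W. G E)
            \<subseteq> (SIGMA E:deg_graphs n f. nbrs E u \<times> nbrs E w)"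
    proof clarsimp
      fix E x y
      assume E: "E \<in> W" "(x, y) \<in> G E"
      then have *: "E \<in> deg_graphs n f" "{u, w} \<in> E" "{x, y} \<in> E" "x \<noteq> u" "x \<notin> nbrs E u"
        "y \<noteq> w" "y \<notin> nbrs E w"
        by (auto simp: W_def G_def nbrs_def)
      show "switch u w E x y \<in> deg_graphs n f \<and> x \<in> nbrs (switch u w E x y) u \<and> y \<in> nbrs (switch u w E x y) w"
        using switch_in_deg_graphs [OF *] by blast
    qed
    show "finite (SIGMA E:deg_graphs n f. nbrs E u \<times> nbrs E w)"
      by (intro finite_SigmaI finite_deg_graphs finite_cartesian_product)
        (auto simp: deg_graphs_iff intro: finite_nbrs)
  qed
  also have "card (SIGMA E:deg_graphs n f. nbrs E u \<times> nbrs E w)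
      = (\<Sum>E\<in>deg_graphs n f. card (nbrs E u \<times> nbrs E w))"
    by (intro card_SigmaI finite_deg_graphs) (auto simp: deg_graphs_iff intro!: finite_cartesian_product intro: finite_nbrs)
  also have "\<dots> = (\<Sum>E\<in>deg_graphs n f. f u * f w)"
    using uw by (intro sum.cong) (auto simp: deg_graphs_iff card_cartesian_product)
  also have "\<dots> = card (deg_graphs n f) * (f u * f w)"
    by simp
  finally show ?thesis
    by (simp add: W_def)
qed

subsection \<open>Revealing the neighbourhood of a vertex\<close>

definition law :: "nat \<Rightarrow> (nat \<Rightarrow> nat) \<Rightarrow> real \<Rightarrow> nat set set pmf" where
  "law n f p = bind_pmf (pmf_of_set (deg_graphs n f)) (percolation p)"

text \<open>\<open>step\<close> returns the neighbourhood of \<open>u\<close> together with the set of neighbours whose edge to \<open>u\<close>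
  is retained.\<close>

definition step :: "nat \<Rightarrow> (nat \<Rightarrow> nat) \<Rightarrow> real \<Rightarrow> nat \<Rightarrow> (nat set \<times> nat set) pmf" where
  "step n f p u =
     bind_pmf (pmf_of_set (deg_graphs n f)) (\<lambda>G.
       map_pmf (\<lambda>Q. (nbrs G u, nbrs Q u)) (percolation p (star u (nbrs G u))))"

lemma measure_pmf_prob_bind:
  "measure_pmf.prob (bind_pmf M N) S = measure_pmf.expectation M (\<lambda>x. measure_pmf.prob (N x) S)"
proof -
  have "ennreal (measure_pmf.prob (bind_pmf M N) S) = (\<integral>\<^sup>+x. ennreal (measure_pmf.prob (N x) S) \<partial>M)"
    using emeasure_bind_pmf [of M N S] by (simp add: measure_pmf.emeasure_eq_measure)
  also have "\<dots> = ennreal (measure_pmf.expectation M (\<lambda>x. measure_pmf.prob (N x) S))"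
    by (intro nn_integral_eq_integral measure_pmf.integrable_const_bound [where B = 1]) auto
  finally show ?thesis
    by (simp add: integral_nonneg_AE)
qed

text \<open>A point can be redrawn from each member of its own fibre, with chance one over the size
  of the fibre, so its mass is unchanged. This replaces conditioning on the value of
  \<open>h\<close>.\<close>

lemma pmf_of_set_fibres:
  assumes "finite S" "S \<noteq> {}"
  shows "pmf_of_set S = bind_pmf (pmf_of_set S) (\<lambda>x. pmf_of_set {y \<in> S. h y = h x})"
proof (rule pmf_eqI)
  fix y
  have "pmf (bind_pmf (pmf_of_set S) (\<lambda>x. pmf_of_set {y \<in> S. h y = h x})) y
      = (\<Sum>x\<in>S. pmf (pmf_of_set {y \<in> S. h y = h x}) y) / card S"
    using assms by (simp add: pmf_bind integral_pmf_of_set)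
  also have "(\<Sum>x\<in>S. pmf (pmf_of_set {y \<in> S. h y = h x}) y)
      = (\<Sum>x\<in>S. if y \<in> S \<and> h y = h x then 1 / card {z \<in> S. h z = h y} else 0)"
  proof (rule sum.cong)
    fix x assume x: "x \<in> S"
    have "pmf (pmf_of_set {y \<in> S. h y = h x}) y = indicator {y \<in> S. h y = h x} y / card {y \<in> S. h y = h x}"
      using x assms by (intro pmf_of_set) auto
    then show "pmf (pmf_of_set {y \<in> S. h y = h x}) y
        = (if y \<in> S \<and> h y = h x then 1 / card {z \<in> S. h z = h y} else 0)"
      by (auto simp: indicator_def)
  qed simp
  also have "\<dots> = (\<Sum>x\<in>{x \<in> S. y \<in> S \<and> h y = h x}. 1 / card {z \<in> S. h z = h y})"
    using assms by (intro sum.mono_neutral_cong_right) auto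
  also have "\<dots> = indicator S y"
  proof (cases "y \<in> S")
    case True
    then have "card {z \<in> S. h z = h y} > 0"
      using assms by (auto simp: card_gt_0_iff)
    moreover have "{x \<in> S. y \<in> S \<and> h y = h x} = {z \<in> S. h z = h y}"
      using True by auto
    ultimately show ?thesis
      using True by simp
  qed auto
  finally show "pmf (pmf_of_set S) y = pmf (bind_pmf (pmf_of_set S) (\<lambda>x. pmf_of_set {y \<in> S. h y = h x})) y"
    using assms by simp
qed

lemma deg_graphs_fibre:
  assumes G: "G \<in> deg_graphs n f" and u: "u < n"
  shows "pmf_of_set {G' \<in> deg_graphs n f. nbrs G' u = nbrs G u}
       = map_pmf (\<lambda>F. star u (nbrs G u) \<union> F) (pmf_of_set (deg_graphs n (residual f u (nbrs G u))))"
proof -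
  let ?D = "deg_graphs n (residual f u (nbrs G u))"
  have "inj_on (\<lambda>F. star u (nbrs G u) \<union> F) ?D"
    using deg_graphs_compose(3) [OF G u] by (intro inj_onI) blast
  moreover have "?D \<noteq> {}"
    using deg_graphs_decompose(2) [OF G u] by auto
  moreover have "(\<lambda>F. star u (nbrs G u) \<union> F) ` ?D = {G' \<in> deg_graphs n f. nbrs G' u = nbrs G u}"
  proof (intro subset_antisym subsetI)
    fix G' assume "G' \<in> {G' \<in> deg_graphs n f. nbrs G' u = nbrs G u}"
    then have G': "G' \<in> deg_graphs n f" "nbrs G' u = nbrs G u"
      by auto
    show "G' \<in> (\<lambda>F. star u (nbrs G u) \<union> F) ` ?D"
      using deg_graphs_decompose [OF G'(1) u] unfolding G'(2) by blast
  next
    fix G' assume "G' \<in> (\<lambda>F. star u (nbrs G u) \<union> F) ` ?D"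
    then show "G' \<in> {G' \<in> deg_graphs n f. nbrs G' u = nbrs G u}"
      using deg_graphs_compose [OF G u] by auto
  qed
  ultimately show ?thesis
    using finite_deg_graphs by (simp add: map_pmf_of_set_inj)
qed

lemma percolation_Un:
  assumes "finite E" "finite F" "E \<inter> F = {}"
  shows "percolation p (E \<union> F)
       = bind_pmf (percolation p E) (\<lambda>Q. map_pmf (\<lambda>P. Q \<union> P) (percolation p F))"
proof -
  have "{e \<in> E \<union> F. if e \<in> E then k e else k' e} = {e \<in> E. k e} \<union> {e \<in> F. k' e}" for k k' :: "nat set \<Rightarrow> bool"
    using assms(3) by auto
  then show ?thesis
    using assms unfolding percolation_def
    by (simp add: Pi_pmf_union map_pmf_comp pair_pmf_def map_bind_pmf bind_map_pmf bind_return_pmf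
        map_pmf_def [symmetric] o_def case_prod_unfold)
qed

lemma set_pmf_percolation: "Q \<in> set_pmf (percolation p E) \<Longrightarrow> Q \<subseteq> E"
  by (auto simp: percolation_def)

lemma finite_star: "finite A \<Longrightarrow> finite (star u A)"
  by (simp add: star_def)

lemma star_subset_eq: "u \<notin> A \<Longrightarrow> Q \<subseteq> star u A \<Longrightarrow> Q = star u (nbrs Q u)"
  unfolding star_def nbrs_def by (auto simp: image_iff doubleton_eq_iff)

text \<open>The Markov property of the exploration. Given the neighbourhood of \<open>u\<close> the
  rest is uniform with the residual degrees, and percolation acts independently on the star and on
  the rest, so the unexplored part again has a distribution of the form \<open>law\<close>.\<close>

lemma law_step:
  assumes ne: "deg_graphs n f \<noteq> {}" and u: "u < n"
  shows "law n f p
    = bind_pmf (step n f p u) (\<lambda>(A, R). map_pmf (\<lambda>P. star u R \<union> P) (law n (residual f u A) p))"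
proof -
  let ?r = "\<lambda>G. residual f u (nbrs G u)"
  let ?D = "\<lambda>G. pmf_of_set (deg_graphs n (?r G))"
  have set: "set_pmf (pmf_of_set (deg_graphs n f)) = deg_graphs n f"
    using ne finite_deg_graphs by simp
  have S: "G \<in> simple_graphs n" if "G \<in> deg_graphs n f" for G f
    using that by (simp add: deg_graphs_iff)
  have ne': "deg_graphs n (?r G) \<noteq> {}" if "G \<in> deg_graphs n f" for G
    using deg_graphs_decompose(2) [OF that u] by auto
  have "law n f p = bind_pmf (bind_pmf (pmf_of_set (deg_graphs n f))
      (\<lambda>G. pmf_of_set {G' \<in> deg_graphs n f. nbrs G' u = nbrs G u})) (percolation p)"
    using pmf_of_set_fibres [OF finite_deg_graphs ne, of "\<lambda>G. nbrs G u"] by (simp add: law_def)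
  also have "\<dots> = bind_pmf (pmf_of_set (deg_graphs n f))
      (\<lambda>G. bind_pmf (map_pmf (\<lambda>F. star u (nbrs G u) \<union> F) (?D G)) (percolation p))"
    unfolding bind_assoc_pmf
    by (rule bind_pmf_cong [OF refl]) (simp add: set deg_graphs_fibre [OF _ u])
  also have "\<dots> = bind_pmf (pmf_of_set (deg_graphs n f))
      (\<lambda>G. bind_pmf (percolation p (star u (nbrs G u)))
         (\<lambda>Q. map_pmf (\<lambda>P. star u (nbrs Q u) \<union> P) (law n (?r G) p)))"
  proof (rule bind_pmf_cong [OF refl])
    fix G assume "G \<in> set_pmf (pmf_of_set (deg_graphs n f))"
    then have G: "G \<in> deg_graphs n f"
      by (simp add: set)
    have "bind_pmf (map_pmf (\<lambda>F. star u (nbrs G u) \<union> F) (?D G)) (percolation p)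
        = bind_pmf (?D G) (\<lambda>F. bind_pmf (percolation p (star u (nbrs G u)))
            (\<lambda>Q. map_pmf (\<lambda>P. Q \<union> P) (percolation p F)))"
      unfolding bind_map_pmf
    proof (rule bind_pmf_cong [OF refl])
      fix F assume "F \<in> set_pmf (?D G)"
      then have F: "F \<in> deg_graphs n (?r G)"
        using ne' [OF G] finite_deg_graphs by simp
      show "percolation p (star u (nbrs G u) \<union> F) = bind_pmf (percolation p (star u (nbrs G u)))
            (\<lambda>Q. map_pmf (\<lambda>P. Q \<union> P) (percolation p F))"
        using deg_graphs_compose(3) [OF G u F] finite_star [OF finite_nbrs [OF S [OF G]]]
          finite_simple_graph [OF S [OF F]] by (intro percolation_Un)
    qed
    \<comment> \<open>Percolation of the star does not involve \<open>F\<close>, so it may be drawn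
      before \<open>F\<close>.\<close>
    also have "\<dots> = bind_pmf (percolation p (star u (nbrs G u)))
         (\<lambda>Q. map_pmf (\<lambda>P. Q \<union> P) (law n (?r G) p))"
      unfolding law_def map_bind_pmf by (rule bind_commute_pmf)
    also have "\<dots> = bind_pmf (percolation p (star u (nbrs G u)))
         (\<lambda>Q. map_pmf (\<lambda>P. star u (nbrs Q u) \<union> P) (law n (?r G) p))"
      by (rule bind_pmf_cong [OF refl])
        (metis star_subset_eq [OF not_self_nbr [OF S [OF G]] set_pmf_percolation])
    finally show "bind_pmf (map_pmf (\<lambda>F. star u (nbrs G u) \<union> F) (?D G)) (percolation p)
        = bind_pmf (percolation p (star u (nbrs G u)))
         (\<lambda>Q. map_pmf (\<lambda>P. star u (nbrs Q u) \<union> P) (law n (?r G) p))" .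
  qed
  also have "\<dots> = bind_pmf (step n f p u) (\<lambda>(A, R). map_pmf (\<lambda>P. star u R \<union> P) (law n (residual f u A) p))"
    by (simp add: step_def bind_assoc_pmf bind_map_pmf)
  finally show ?thesis .
qed

lemma set_pmf_stepD:
  assumes ne: "deg_graphs n f \<noteq> {}" and u: "u < n" and AR: "(A, R) \<in> set_pmf (step n f p u)"
  shows "R \<subseteq> A" "A \<subseteq> {..<n}" "u \<notin> A" "card A = f u" "\<And>w. w \<in> A \<Longrightarrow> f w > 0"
    "deg_graphs n (residual f u A) \<noteq> {}"
proof -
  from AR obtain G Q where G: "G \<in> deg_graphs n f" and Q: "Q \<in> set_pmf (percolation p (star u (nbrs G u)))"
    and A: "A = nbrs G u" and R: "R = nbrs Q u"
    using ne finite_deg_graphs by (auto simp: step_def)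
  have S: "G \<in> simple_graphs n"
    using G by (simp add: deg_graphs_iff)
  show "A \<subseteq> {..<n}" and uA: "u \<notin> A" and "card A = f u"
    using A G u nbrs_bounded [OF S] not_self_nbr [OF S] by (auto simp: deg_graphs_iff)
  show "R \<subseteq> A"
    using set_pmf_percolation [OF Q] uA unfolding R A by (auto simp: nbrs_def star_edge_iff)
  show "deg_graphs n (residual f u A) \<noteq> {}"
    using deg_graphs_decompose(2) [OF G u] A by auto
  show "f w > 0" if "w \<in> A" for w
  proof (rule ccontr)
    assume "\<not> f w > 0"
    then have "nbrs G w = {}"
      using deg_graphs_no_edge_if_zero [OF G] \<open>A \<subseteq> {..<n}\<close> that by auto
    then show False
      using that unfolding A by (subst (asm) nbrs_sym) simp
  qed
qed

lemma finite_set_pmf_step: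
  assumes ne: "deg_graphs n f \<noteq> {}" and u: "u < n"
  shows "finite (set_pmf (step n f p u))"
proof (rule finite_subset)
  show "set_pmf (step n f p u) \<subseteq> Pow {..<n} \<times> Pow {..<n}"
    using set_pmf_stepD [OF ne u] by fastforce
qed simp

lemma prob_law_step_le:
  assumes ne: "deg_graphs n f \<noteq> {}" and u: "u < n"
    and le: "\<And>A R. (A, R) \<in> set_pmf (step n f p u) \<Longrightarrow>
      measure_pmf.prob (law n (residual f u A) p) {P. star u R \<union> P \<in> S} \<le> \<Phi> (A, R)"
  shows "measure_pmf.prob (law n f p) S \<le> measure_pmf.expectation (step n f p u) \<Phi>"
proof -
  have "measure_pmf.prob (law n f p) S = measure_pmf.expectation (step n f p u)
     (\<lambda>(A, R). measure_pmf.prob (law n (residual f u A) p) {P. star u R \<union> P \<in> S})"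
    by (subst law_step [OF ne u], subst measure_pmf_prob_bind)
      (simp add: case_prod_unfold vimage_def)
  also have "\<dots> \<le> measure_pmf.expectation (step n f p u) \<Phi>"
    using finite_set_pmf_step [OF ne u] le
    by (intro integral_mono_AE integrable_measure_pmf_finite) (auto simp: AE_measure_pmf_iff)
  finally show ?thesis .
qed

lemma prob_percolation_edge:
  assumes "finite E" "0 \<le> p" "p \<le> 1"
  shows "measure_pmf.prob (percolation p E) {Q. e \<in> Q} = (if e \<in> E then p else 0)"
proof (cases "e \<in> E")
  case True
  have "measure_pmf.prob (percolation p E) {Q. e \<in> Q}
      = measure_pmf.prob (map_pmf (\<lambda>k. k e) (Pi_pmf E False (\<lambda>_. bernoulli_pmf p))) {True}"
    using True by (simp add: percolation_def vimage_def)
  also have "\<dots> = p"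
    using True assms by (simp add: Pi_pmf_component measure_pmf_single)
  finally show ?thesis
    using True by simp
next
  case False
  then have "measure_pmf.prob (percolation p E) {Q. e \<in> Q} = measure_pmf.prob (percolation p E) {}"
    using set_pmf_percolation [of _ p E] by (intro measure_pmf.finite_measure_eq_AE) (auto simp: AE_measure_pmf_iff)
  then show ?thesis
    using False by simp
qed

lemma prob_percolation_empty:
  assumes "finite E" "0 \<le> p" "p \<le> 1"
  shows "measure_pmf.prob (percolation p E) {{}} \<ge> (1 - p) ^ card E"
proof -
  have "(1 - p) ^ card E = pmf (Pi_pmf E False (\<lambda>_. bernoulli_pmf p)) (\<lambda>_. False)"
    using assms by (simp add: pmf_Pi)
  also have "\<dots> = measure_pmf.prob (Pi_pmf E False (\<lambda>_. bernoulli_pmf p)) {\<lambda>_. False}"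
    by (simp add: measure_pmf_single)
  also have "\<dots> \<le> measure_pmf.prob (percolation p E) {{}}"
    unfolding percolation_def measure_map_pmf by (intro measure_pmf.finite_measure_mono) auto
  finally show ?thesis .
qed

lemma prob_step_neighbour:
  assumes ne: "deg_graphs n f \<noteq> {}"
  shows "measure_pmf.prob (step n f p u) {z. w \<in> fst z}
       = card {E \<in> deg_graphs n f. w \<in> nbrs E u} / card (deg_graphs n f)"
proof -
  have *: "measure_pmf.prob M {Q. w \<in> nbrs G u} = indicator {E. w \<in> nbrs E u} G"
    for M :: "nat set set pmf" and G
    by (cases "w \<in> nbrs G u") auto
  show ?thesis
    using ne finite_deg_graphs
    by (simp add: step_def measure_pmf_prob_bind vimage_def * measure_pmf_of_set Int_def del: Collect_const)
qed

lemma prob_step_retained: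
  assumes ne: "deg_graphs n f \<noteq> {}" and p: "0 \<le> p" "p \<le> 1" and u: "u < n"
  shows "measure_pmf.prob (step n f p u) {z. w \<in> snd z} = p * measure_pmf.prob (step n f p u) {z. w \<in> fst z}"
proof -
  have *: "measure_pmf.prob (percolation p (star u (nbrs G u))) {Q. w \<in> nbrs Q u} = p * indicator {E. w \<in> nbrs E u} G"
    if "G \<in> deg_graphs n f" for G
  proof -
    have S: "G \<in> simple_graphs n"
      using that by (simp add: deg_graphs_iff)
    have "measure_pmf.prob (percolation p (star u (nbrs G u))) {Q. w \<in> nbrs Q u}
        = (if {u, w} \<in> star u (nbrs G u) then p else 0)"
      unfolding nbrs_def [of _ u] mem_Collect_eq
      using prob_percolation_edge [OF finite_star [OF finite_nbrs [OF S]] p] by (simp add: nbrs_def)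
    then show ?thesis
      using not_self_nbr [OF S, of u] by (auto simp: star_edge_iff)
  qed
  have "measure_pmf.prob (step n f p u) {z. w \<in> snd z}
      = (\<Sum>G\<in>deg_graphs n f. p * indicator {E. w \<in> nbrs E u} G) / card (deg_graphs n f)"
    using ne finite_deg_graphs *
    by (simp add: step_def measure_pmf_prob_bind integral_pmf_of_set vimage_def)
  also have "(\<Sum>G\<in>deg_graphs n f. p * indicator {E. w \<in> nbrs E u} G)
      = p * real (card {E \<in> deg_graphs n f. w \<in> nbrs E u})"
    using finite_deg_graphs by (simp add: sum_distrib_left [symmetric] indicator_def sum.If_cases Int_def)
  finally show ?thesis
    using prob_step_neighbour [OF ne] by simp
qed

text \<open>Needed for the variance: without retained edges the number of active half-edges falls by
  at least \<open>f u\<close>, so this chance keeps the second moment of the increment away from 0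
  once \<open>p\<close> is bounded away from 1.\<close>

lemma prob_step_none_retained:
  assumes ne: "deg_graphs n f \<noteq> {}" and p: "0 \<le> p" "p \<le> 1" and u: "u < n" "f u \<le> d"
  shows "measure_pmf.prob (step n f p u) {z. snd z = {}} \<ge> (1 - p) ^ d"
proof -
  have *: "measure_pmf.prob (percolation p (star u (nbrs G u))) {Q. nbrs Q u = {}} \<ge> (1 - p) ^ d"
    if G: "G \<in> deg_graphs n f" for G
  proof -
    have S: "G \<in> simple_graphs n"
      using G by (simp add: deg_graphs_iff)
    have "card (star u (nbrs G u)) \<le> d"
      using card_image_le [OF finite_nbrs [OF S], of "\<lambda>w. {u, w}" u] G u
      by (auto simp: star_def deg_graphs_iff)
    then have "(1 - p) ^ d \<le> (1 - p) ^ card (star u (nbrs G u))"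
      using p by (intro power_decreasing) auto
    also have "\<dots> \<le> measure_pmf.prob (percolation p (star u (nbrs G u))) {{}}"
      using finite_star [OF finite_nbrs [OF S]] p by (intro prob_percolation_empty)
    also have "\<dots> \<le> measure_pmf.prob (percolation p (star u (nbrs G u))) {Q. nbrs Q u = {}}"
      by (intro measure_pmf.finite_measure_mono) (auto simp: nbrs_def)
    finally show ?thesis .
  qed
  have "(1 - p) ^ d = (\<Sum>G\<in>deg_graphs n f. (1 - p) ^ d) / card (deg_graphs n f)"
    using ne finite_deg_graphs by simp
  also have "\<dots> \<le> (\<Sum>G\<in>deg_graphs n f. measure_pmf.prob (percolation p (star u (nbrs G u))) {Q. nbrs Q u = {}})
      / card (deg_graphs n f)"
    using * by (intro divide_right_mono sum_mono) auto
  also have "\<dots> = measure_pmf.prob (step n f p u) {z. snd z = {}}"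
    using ne finite_deg_graphs
    by (simp add: step_def measure_pmf_prob_bind integral_pmf_of_set vimage_def)
  finally show ?thesis .
qed

section \<open>Exploring a component\<close>

definition reach :: "nat set set \<Rightarrow> nat set \<Rightarrow> nat set" where
  "reach P B = (\<Union>b\<in>B. component P b)"

lemma component_self: "v \<in> component P v"
  by (simp add: component_def)

lemma component_step: "w \<in> component P v \<Longrightarrow> {w, x} \<in> P \<Longrightarrow> x \<in> component P v"
  unfolding component_def by (auto intro: rtrancl_into_rtrancl)

lemma component_subset_closed:
  assumes "v \<in> S" and closed: "\<And>x y. x \<in> S \<Longrightarrow> {x, y} \<in> P \<Longrightarrow> y \<in> S"
  shows "component P v \<subseteq> S"
proof
  fix w assume "w \<in> component P v"
  then have "(v, w) \<in> {(x, y). {x, y} \<in> P}\<^sup>*"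
    by (simp add: component_def)
  then show "w \<in> S"
    using assms(1) by induction (auto intro: closed)
qed

lemma component_mono: "P \<subseteq> Q \<Longrightarrow> component P v \<subseteq> component Q v"
  by (rule component_subset_closed) (auto intro: component_self component_step)

lemma reach_superset: "B \<subseteq> reach P B"
  by (auto simp: reach_def intro: component_self)

lemma reach_step: "x \<in> reach P B \<Longrightarrow> {x, y} \<in> P \<Longrightarrow> y \<in> reach P B"
  by (auto simp: reach_def intro: component_step)

lemma reach_subset_closed:
  assumes "B \<subseteq> S" and "\<And>x y. x \<in> S \<Longrightarrow> {x, y} \<in> P \<Longrightarrow> y \<in> S"
  shows "reach P B \<subseteq> S"
  unfolding reach_def using assms by (intro UN_least component_subset_closed) auto

text \<open>The vertices in \<open>R\<close> are discovered through \<open>u\<close>, and once they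
  are in \<open>B\<close> the star edges have nothing more to contribute. Thus an event about the
  cluster can be restated for the unexplored part \<open>P\<close> alone.\<close>

lemma reach_explore:
  assumes "u \<in> B"
  shows "reach (star u R \<union> P) B = reach P (B \<union> R)"
proof (rule subset_antisym)
  show "reach (star u R \<union> P) B \<subseteq> reach P (B \<union> R)"
    using assms reach_superset [of "B \<union> R" P]
    by (intro reach_subset_closed) (auto simp: star_edge_iff dest: reach_step)
  have "R \<subseteq> reach (star u R \<union> P) B"
    using assms reach_superset [of B "star u R \<union> P"] by (auto simp: star_edge_iff intro: reach_step [of u])
  then show "reach P (B \<union> R) \<subseteq> reach (star u R \<union> P) B"
    using reach_superset [of B "star u R \<union> P"]
    by (intro reach_subset_closed) (auto intro: reach_step)
qed

lemma reach_isolated: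
  assumes "\<And>b. b \<in> B \<Longrightarrow> nbrs P b = {}"
  shows "reach P B = B"
  using assms by (intro subset_antisym reach_superset reach_subset_closed) (auto simp: nbrs_def)

text \<open>Square \<open>1 + z / 2 \<le> exp (z / 2)\<close>; for \<open>z \<ge> -2\<close> the
  left side is nonnegative. The quadratic term is what turns variance into growth of an exponential
  mean.\<close>

lemma exp_ge_quadratic: "1 + z + z\<^sup>2 / 4 \<le> exp z" if "z \<ge> -2" for z :: real
proof -
  have "(1 + z / 2)\<^sup>2 \<le> (exp (z / 2))\<^sup>2"
    using that exp_ge_add_one_self [of "z / 2"] by (intro power_mono) auto
  also have "\<dots> = exp z"
    by (simp add: power2_eq_square flip: exp_add)
  finally show ?thesis
    by (simp add: power2_eq_square algebra_simps)
qed

lemma exp_le_quadratic: "exp z \<le> 1 + z + z\<^sup>2" if "\<bar>z\<bar> \<le> 1" for z :: real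
proof (cases "z \<ge> 0")
  case True
  then show ?thesis
    using that exp_bound [of z] by auto
next
  case False
  define y where "y = - z"
  have y: "0 \<le> y" "y \<le> 1"
    using False that by (auto simp: y_def)
  have "1 \<le> 1 + y\<^sup>2 / 2 + y ^ 3 / 2 + y ^ 4 / 2"
    using y by simp
  \<comment> \<open>The product expands to exactly the polynomial just seen to be at least 1, so
    \<open>1 - y + y\<^sup>2\<close> is at least \<open>exp (- y)\<close>.\<close>
  also have "\<dots> = (1 + y + y\<^sup>2 / 2) * (1 - y + y\<^sup>2)"
    by (simp add: power2_eq_square power3_eq_cube power4_eq_xxxx field_simps)
  also have "\<dots> \<le> exp y * (1 - y + y\<^sup>2)"
    using y exp_lower_Taylor_quadratic [of y] by (intro mult_right_mono) auto
  finally have "exp (- y) * 1 \<le> exp (- y) * (exp y * (1 - y + y\<^sup>2))"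
    by (intro mult_left_mono) auto
  then show ?thesis
    by (simp add: y_def mult.assoc [symmetric] flip: exp_add)
qed

section \<open>State variables of the exploration\<close>

definition active :: "(nat \<Rightarrow> nat) \<Rightarrow> nat set \<Rightarrow> real" where
  "active f B = (\<Sum>w\<in>B. real (f w))"

text \<open>A vertex outside \<open>B\<close> that has lost \<open>d - f w\<close> edges contributes that much less when it is
  discovered; weighted by its remaining degree \<open>f w\<close> this loss produces the negative drift.\<close>

definition deficit :: "nat \<Rightarrow> nat \<Rightarrow> (nat \<Rightarrow> nat) \<Rightarrow> nat set \<Rightarrow> real" where
  "deficit n d f B = (\<Sum>w\<in>{..<n} - B. real (f w) * (real d - real (f w)))"

definition total :: "nat \<Rightarrow> (nat \<Rightarrow> nat) \<Rightarrow> real" where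
  "total n f = (\<Sum>w<n. real (f w))"

subsection \<open>Moments of one exploration step\<close>

locale exploration =
  fixes n d :: nat and f :: "nat \<Rightarrow> nat" and p :: real and u :: nat and B :: "nat set"
  assumes d: "d \<ge> 3" and f_le: "\<And>v. v < n \<Longrightarrow> f v \<le> d" and ne: "deg_graphs n f \<noteq> {}"
    and B: "B \<subseteq> {..<n}" and uB: "u \<in> B" and fu: "f u > 0" and p: "0 \<le> p" "p \<le> 1"
begin

abbreviation \<mu> :: "(nat set \<times> nat set) pmf" where
  "\<mu> \<equiv> step n f p u"

definition a :: "nat \<Rightarrow> real" where
  "a w = measure_pmf.prob \<mu> {z. w \<in> fst z}"

text \<open>The increment of \<open>active\<close>: the half-edges of \<open>u\<close> are used up,
  a neighbour already in \<open>B\<close> loses one, and a newly discovered vertex contributes all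
  its half-edges except the one just used.\<close>

definition incr :: "nat set \<times> nat set \<Rightarrow> real" where
  "incr z = - real (f u) - (\<Sum>w\<in>B. indicator (fst z) w)
      + (\<Sum>w\<in>{..<n} - B. indicator (snd z) w * (real (f w) - 1))"

text \<open>The increment of \<open>deficit\<close>: lowering \<open>f w\<close> by one changes
  \<open>f w * (d - f w)\<close> by \<open>2 * f w - d - 1\<close>, while a discovered vertex leaves
  the sum altogether.\<close>

definition dincr :: "nat set \<times> nat set \<Rightarrow> real" where
  "dincr z = (\<Sum>w\<in>{..<n} - B. indicator (fst z) w * (2 * real (f w) - real d - 1))
      - (\<Sum>w\<in>{..<n} - B. indicator (snd z) w
            * (2 * real (f w) - real d - 1 + real (f w) * (real d - real (f w))))"

lemma u: "u < n"
  using B uB by auto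

lemma fu_le: "f u \<le> d"
  using f_le u .

lemma finite_B: "finite B"
  using B finite_subset by blast

lemma finite_support: "finite (set_pmf \<mu>)"
  using finite_set_pmf_step [OF ne u] .

lemma integrable_step: "integrable (measure_pmf \<mu>) (g :: _ \<Rightarrow> real)"
  using finite_support by (rule integrable_measure_pmf_finite)

lemmas step_facts = set_pmf_stepD [OF ne u]

lemma expectation_neighbours:
  "measure_pmf.expectation \<mu> (\<lambda>z. \<Sum>w\<in>W. indicator (fst z) w * c w) = (\<Sum>w\<in>W. a w * c w)"
proof -
  have "indicator (fst z) w = (indicator {z. w \<in> fst z} z :: real)" for z :: "nat set \<times> nat set" and w
    by (simp add: indicator_def)
  then show ?thesis
    by (simp add: a_def Bochner_Integration.integral_sum integrable_step)
qed

lemma expectation_retained: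
  "measure_pmf.expectation \<mu> (\<lambda>z. \<Sum>w\<in>W. indicator (snd z) w * c w) = p * (\<Sum>w\<in>W. a w * c w)"
proof -
  have "indicator (snd z) w = (indicator {z. w \<in> snd z} z :: real)" for z :: "nat set \<times> nat set" and w
    by (simp add: indicator_def)
  then show ?thesis
    by (simp add: a_def prob_step_retained [OF ne p u] Bochner_Integration.integral_sum integrable_step
        sum_distrib_left mult.assoc)
qed

lemma a_nonneg: "a w \<ge> 0"
  by (simp add: a_def)

lemma sum_a: "(\<Sum>w<n. a w) = f u"
proof -
  have "(\<Sum>w<n. a w) = measure_pmf.expectation \<mu> (\<lambda>z. \<Sum>w<n. indicator (fst z) w)"
    using expectation_neighbours [where W = "{..<n}" and c = "\<lambda>_. 1"] by simp
  also have "\<dots> = measure_pmf.expectation \<mu> (\<lambda>z. real (f u))"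
  proof (intro integral_cong_AE)
    have "(\<Sum>w<n. indicator (fst z) w) = real (f u)" if "z \<in> set_pmf \<mu>" for z
    proof -
      have "fst z \<subseteq> {..<n}" "card (fst z) = f u"
        using step_facts [of "fst z" "snd z"] that by auto
      then show ?thesis
        by (simp add: indicator_def sum.If_cases Int_absorb1)
    qed
    then show "AE z in \<mu>. (\<Sum>w<n. indicator (fst z) w) = real (f u)"
      by (simp add: AE_measure_pmf_iff)
  qed auto
  finally show ?thesis
    by simp
qed

lemma a_le:
  assumes "total n f > 2 * real d * (real d + 1)" "w < n"
  shows "a w \<le> real (f u) * real (f w) / (total n f - 2 * real d * (real d + 1))"
proof -
  have pos: "card (deg_graphs n f) > 0"
    using ne finite_deg_graphs by (auto simp: card_gt_0_iff)
  have "real (card {E \<in> deg_graphs n f. w \<in> nbrs E u}) * (total n f - 2 * real d * (real d + 1))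
      \<le> real (card (deg_graphs n f)) * (real (f u) * real (f w))"
    using of_nat_mono [OF switching_count [OF f_le u \<open>w < n\<close>], where 'a = real]
    by (simp add: total_def algebra_simps)
  then have "real (card {E \<in> deg_graphs n f. w \<in> nbrs E u})
      \<le> real (card (deg_graphs n f)) * (real (f u) * real (f w)) / (total n f - 2 * real d * (real d + 1))"
    using assms by (simp add: pos_le_divide_eq)
  then show ?thesis
    unfolding a_def prob_step_neighbour [OF ne] using pos by (simp add: divide_le_eq mult_ac)
qed

lemma active_step:
  assumes "z \<in> set_pmf \<mu>"
  shows "active (residual f u (fst z)) (B \<union> snd z) = active f B + incr z"
proof -
  define A R where "A = fst z" and "R = snd z"
  have z: "R \<subseteq> A" "A \<subseteq> {..<n}" "u \<notin> A" "\<And>w. w \<in> A \<Longrightarrow> f w > 0"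
    using step_facts [of A R] assms by (auto simp: A_def R_def)
  have fin: "finite R"
    using z by (meson finite_lessThan finite_subset)
  have "active (residual f u A) (B \<union> R)
      = (\<Sum>w\<in>B. real (residual f u A w)) + (\<Sum>w\<in>R - B. real (residual f u A w))"
    unfolding active_def using finite_B fin
    by (subst sum.union_disjoint [symmetric]) (auto intro: sum.cong)
  also have "(\<Sum>w\<in>B. real (residual f u A w))
      = (\<Sum>w\<in>B. real (f w) - indicator A w - (if w = u then real (f u) else 0))"
    using z by (intro sum.cong) (auto simp: residual_def of_nat_diff Suc_leI)
  also have "\<dots> = active f B - (\<Sum>w\<in>B. indicator A w) - real (f u)"
    using uB finite_B by (simp add: sum_subtractf active_def)
  also have "(\<Sum>w\<in>R - B. real (residual f u A w)) = (\<Sum>w\<in>R - B. real (f w) - 1)"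
    using z by (intro sum.cong) (auto simp: residual_def of_nat_diff Suc_leI subset_eq)
  also have "\<dots> = (\<Sum>w\<in>{..<n} - B. indicator R w * (real (f w) - 1))"
    using z fin by (intro sum.mono_neutral_cong_left) (auto simp: indicator_def)
  finally show ?thesis
    by (simp add: incr_def A_def R_def)
qed

lemma deficit_step:
  assumes "z \<in> set_pmf \<mu>"
  shows "deficit n d (residual f u (fst z)) (B \<union> snd z) = deficit n d f B + dincr z"
proof -
  define A R where "A = fst z" and "R = snd z"
  have z: "R \<subseteq> A" "A \<subseteq> {..<n}" "u \<notin> A" "\<And>w. w \<in> A \<Longrightarrow> f w > 0"
    using step_facts [of A R] assms by (auto simp: A_def R_def)
  let ?g = "\<lambda>w. real (f w) * (real d - real (f w))" and ?c = "\<lambda>w. 2 * real (f w) - real d - 1"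
  have "deficit n d (residual f u A) (B \<union> R)
      = (\<Sum>w\<in>{..<n} - B. if w \<in> R then 0 else real (residual f u A w) * (real d - real (residual f u A w)))"
    unfolding deficit_def by (intro sum.mono_neutral_cong_left) auto
  also have "\<dots> = (\<Sum>w\<in>{..<n} - B. ?g w + (indicator A w * ?c w - indicator R w * (?c w + ?g w)))"
  proof (rule sum.cong)
    fix w assume w: "w \<in> {..<n} - B"
    then have "w \<noteq> u"
      using uB by auto
    then show "(if w \<in> R then 0 else real (residual f u A w) * (real d - real (residual f u A w)))
        = ?g w + (indicator A w * ?c w - indicator R w * (?c w + ?g w))"
      using z(1) z(4) [of w] by (auto simp: residual_def of_nat_diff Suc_leI algebra_simps)
  qed simp
  finally show ?thesis
    by (simp add: deficit_def dincr_def A_def R_def sum.distrib sum_subtractf)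
qed

lemma total_step:
  assumes "z \<in> set_pmf \<mu>"
  shows "total n (residual f u (fst z)) \<ge> total n f - 2 * real d"
proof -
  define A where "A = fst z"
  have z: "A \<subseteq> {..<n}" "card A = f u"
    using step_facts [of A "snd z"] assms by (auto simp: A_def)
  have "total n f - 2 * real d \<le> total n f - real (card A) - real (f u)"
    using z fu_le by simp
  also have "\<dots> = (\<Sum>w<n. real (f w) - indicator A w - (if w = u then real (f u) else 0))"
    using z u by (simp add: sum_subtractf total_def indicator_def sum.If_cases Int_absorb1)
  also have "\<dots> \<le> total n (residual f u A)"
    unfolding total_def by (intro sum_mono) (auto simp: residual_def indicator_def)
  finally show ?thesis
    by (simp add: A_def)
qed

lemma abs_sum_indicator_le:
  assumes "finite W" "finite S" "\<And>w. w \<in> W \<Longrightarrow> \<bar>c w\<bar> \<le> C" "C \<ge> 0"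
  shows "\<bar>\<Sum>w\<in>W. indicator S w * c w\<bar> \<le> real (card S) * (C :: real)"
proof -
  have "\<bar>\<Sum>w\<in>W. indicator S w * c w\<bar> \<le> (\<Sum>w\<in>W. \<bar>indicator S w * c w\<bar>)"
    by (rule sum_abs)
  also have "\<dots> \<le> (\<Sum>w\<in>W. indicator S w * C)"
    using assms by (intro sum_mono) (auto simp: indicator_def)
  also have "\<dots> = real (card (W \<inter> S)) * C"
    using assms by (simp add: sum_distrib_right [symmetric] indicator_def sum.If_cases)
  also have "\<dots> \<le> real (card S) * C"
    using assms by (intro mult_right_mono) (auto intro: card_mono)
  finally show ?thesis .
qed

lemma step_cards:
  assumes "z \<in> set_pmf \<mu>"
  shows "finite (fst z)" "finite (snd z)" "card (fst z) \<le> d" "card (snd z) \<le> d"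
proof -
  have z: "snd z \<subseteq> fst z" "fst z \<subseteq> {..<n}" "card (fst z) = f u"
    using step_facts [of "fst z" "snd z"] assms by auto
  then show "finite (fst z)" "finite (snd z)"
    by (meson finite_lessThan finite_subset)+
  then show "card (fst z) \<le> d" "card (snd z) \<le> d"
    using z fu_le card_mono [of "fst z" "snd z"] by auto
qed

lemma abs_incr_le:
  assumes "z \<in> set_pmf \<mu>"
  shows "\<bar>incr z\<bar> \<le> 2 * real d ^ 2"
proof -
  note c = step_cards [OF assms]
  have "\<bar>\<Sum>w\<in>B. indicator (fst z) w * 1\<bar> \<le> real (card (fst z)) * (1 :: real)"
    using c finite_B by (intro abs_sum_indicator_le) auto
  moreover have "\<bar>\<Sum>w\<in>{..<n} - B. indicator (snd z) w * (real (f w) - 1)\<bar> \<le> real (card (snd z)) * (real d - 1)"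
  proof (intro abs_sum_indicator_le)
    fix w assume "w \<in> {..<n} - B"
    then show "\<bar>real (f w) - 1\<bar> \<le> real d - 1"
      using d f_le [of w] by auto
  qed (use c d in auto)
  moreover have "real (card (snd z)) * (real d - 1) \<le> real d * (real d - 1)"
    using c d by (intro mult_right_mono) auto
  moreover have "real (card (fst z)) \<le> real d" "real (f u) \<le> real d"
    using c fu_le by auto
  ultimately have "\<bar>incr z\<bar> \<le> real d + real d + real d * (real d - 1)"
    unfolding incr_def by simp
  also have "\<dots> = real d ^ 2 + 1 * real d"
    by (simp add: power2_eq_square algebra_simps)
  also have "\<dots> \<le> real d ^ 2 + real d * real d"
    using d by (intro add_left_mono mult_right_mono) auto
  finally show ?thesis
    by (simp add: power2_eq_square)
qed

lemma abs_dincr_le: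
  assumes "z \<in> set_pmf \<mu>"
  shows "\<bar>dincr z\<bar> \<le> 3 * real d ^ 3"
proof -
  note c = step_cards [OF assms]
  let ?c = "\<lambda>w. 2 * real (f w) - real d - 1"
  have b: "\<bar>?c w\<bar> \<le> real d + 1" "\<bar>real (f w) * (real d - real (f w))\<bar> \<le> real d ^ 2"
    if "w \<in> {..<n} - B" for w
  proof -
    have "real (f w) \<le> real d"
      using that f_le [of w] by auto
    then show "\<bar>?c w\<bar> \<le> real d + 1"
      by (auto simp: abs_if)
    have "real (f w) * (real d - real (f w)) \<le> real d * real d"
      using \<open>real (f w) \<le> real d\<close> by (intro mult_mono) auto
    then show "\<bar>real (f w) * (real d - real (f w))\<bar> \<le> real d ^ 2"
      using \<open>real (f w) \<le> real d\<close> by (simp add: power2_eq_square abs_mult)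
  qed
  have "\<bar>\<Sum>w\<in>{..<n} - B. indicator (fst z) w * ?c w\<bar> \<le> real (card (fst z)) * (real d + 1)"
    using b c by (intro abs_sum_indicator_le) auto
  also have "\<dots> \<le> real d * (real d + 1)"
    using c by (intro mult_right_mono) auto
  finally have 1: "\<bar>\<Sum>w\<in>{..<n} - B. indicator (fst z) w * ?c w\<bar> \<le> real d * (real d + 1)" .
  have "\<bar>\<Sum>w\<in>{..<n} - B. indicator (snd z) w * (?c w + real (f w) * (real d - real (f w)))\<bar>
      \<le> real (card (snd z)) * (real d + 1 + real d ^ 2)"
  proof (intro abs_sum_indicator_le)
    fix w assume w: "w \<in> {..<n} - B"
    show "\<bar>?c w + real (f w) * (real d - real (f w))\<bar> \<le> real d + 1 + real d ^ 2"
      using b [OF w] by linarith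
  qed (use c in auto)
  also have "\<dots> \<le> real d * (real d + 1 + real d ^ 2)"
    using c by (intro mult_right_mono) auto
  finally have "\<bar>dincr z\<bar> \<le> real d * (real d + 1) + real d * (real d + 1 + real d ^ 2)"
    using 1 unfolding dincr_def by linarith
  also have "\<dots> = real d ^ 3 + real d * real d * 2 + real d * 2"
    by (simp add: power2_eq_square power3_eq_cube algebra_simps)
  also have "\<dots> \<le> real d ^ 3 + real d * real d * real d + real d * (real d * real d)"
  proof -
    have "real d * real d * 2 \<le> real d * real d * real d"
      using d by (intro mult_left_mono) auto
    moreover have "real d * 2 \<le> real d * (real d * real d)"
    proof (intro mult_left_mono)
      have "3 * 3 \<le> real d * real d"
        using d by (intro mult_mono) auto
      then show "2 \<le> real d * real d"
        by simp
    qed auto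
    ultimately show ?thesis
      by linarith
  qed
  finally show ?thesis
    by (simp add: power3_eq_cube)
qed

lemma expectation_incr:
  "measure_pmf.expectation \<mu> incr
     = - real (f u) - (\<Sum>w\<in>B. a w) + p * (\<Sum>w\<in>{..<n} - B. a w * (real (f w) - 1))"
proof -
  have "measure_pmf.expectation \<mu> incr
      = measure_pmf.expectation \<mu> (\<lambda>z. - real (f u) - (\<Sum>w\<in>B. indicator (fst z) w * 1))
        + measure_pmf.expectation \<mu> (\<lambda>z. \<Sum>w\<in>{..<n} - B. indicator (snd z) w * (real (f w) - 1))"
    unfolding incr_def [abs_def]
    by (subst Bochner_Integration.integral_add [OF integrable_step integrable_step, symmetric]) simp
  also have "measure_pmf.expectation \<mu> (\<lambda>z. - real (f u) - (\<Sum>w\<in>B. indicator (fst z) w * 1))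
      = - real (f u) - measure_pmf.expectation \<mu> (\<lambda>z. \<Sum>w\<in>B. indicator (fst z) w * 1)"
    by (subst Bochner_Integration.integral_diff [OF integrable_step integrable_step]) simp
  finally show ?thesis
    unfolding expectation_neighbours expectation_retained by simp
qed

lemma expectation_dincr:
  "measure_pmf.expectation \<mu> dincr
     = (\<Sum>w\<in>{..<n} - B. a w * (2 * real (f w) - real d - 1))
       - p * (\<Sum>w\<in>{..<n} - B. a w * (2 * real (f w) - real d - 1 + real (f w) * (real d - real (f w))))"
  unfolding dincr_def [abs_def]
  by (subst Bochner_Integration.integral_diff [OF integrable_step integrable_step])
    (simp only: expectation_neighbours expectation_retained)

lemma sum_a_split: "(\<Sum>w\<in>{..<n} - B. a w) = f u - (\<Sum>w\<in>B. a w)"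
  using sum_a sum.subset_diff [of B "{..<n}" a] B by simp

text \<open>Writing \<open>f w - 1\<close> as \<open>(d - 1) - (d - f w)\<close> separates the drift
  of a branching process with mean offspring \<open>p * (d - 1)\<close> from two losses, through
  edges back into \<open>B\<close> and through depleted vertices.\<close>

lemma expectation_incr':
  "measure_pmf.expectation \<mu> incr
     = real (f u) * (p * (real d - 1) - 1) - (1 + p * (real d - 1)) * (\<Sum>w\<in>B. a w)
       - p * (\<Sum>w\<in>{..<n} - B. a w * (real d - real (f w)))"
proof -
  have eq: "(\<Sum>w\<in>{..<n} - B. a w * (real (f w) - 1))
      = (real (f u) - (\<Sum>w\<in>B. a w)) * (real d - 1) - (\<Sum>w\<in>{..<n} - B. a w * (real d - real (f w)))"
  proof -
    have "(\<Sum>w\<in>{..<n} - B. a w * (real (f w) - 1))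
      = (\<Sum>w\<in>{..<n} - B. a w * (real d - 1) - a w * (real d - real (f w)))"
      by (intro sum.cong) (auto simp: algebra_simps)
    then show ?thesis
      by (simp add: sum_subtractf sum_distrib_right [symmetric] sum_a_split)
  qed
  show ?thesis
    unfolding expectation_incr eq by (simp add: algebra_simps)
qed

context
  fixes T :: real
  assumes T: "T = total n f - 2 * real d * (real d + 1)" and T_pos: "T > 0"
begin

lemma sum_a_le:
  assumes "W \<subseteq> {..<n}" "\<And>w. w \<in> W \<Longrightarrow> g w \<ge> 0"
  shows "(\<Sum>w\<in>W. a w * g w) \<le> real (f u) * (\<Sum>w\<in>W. real (f w) * g w) / T"
proof -
  have "(\<Sum>w\<in>W. a w * g w) \<le> (\<Sum>w\<in>W. real (f u) * real (f w) / T * g w)"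
    using assms a_le T T_pos by (intro sum_mono mult_right_mono) auto
  also have "\<dots> = real (f u) * (\<Sum>w\<in>W. real (f w) * g w) / T"
    by (simp add: sum_distrib_left sum_divide_distrib mult.assoc)
  finally show ?thesis .
qed

lemma sum_a_B_le: "(\<Sum>w\<in>B. a w) \<le> real (f u) * active f B / T"
  using sum_a_le [of B "\<lambda>_. 1"] B by (simp add: active_def)

lemma sum_a_deficit_le:
  "(\<Sum>w\<in>{..<n} - B. a w * (real d - real (f w))) \<le> real (f u) * deficit n d f B / T"
  using sum_a_le [of "{..<n} - B" "\<lambda>w. real d - real (f w)"] f_le by (simp add: deficit_def)

text \<open>Switching only bounds the connection probabilities from above; since they sum to
  \<open>f u\<close>, bounding the complementary sum gives the matching lower bound.\<close>

lemma sum_a_deficit_ge: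
  "(\<Sum>w\<in>{..<n} - B. a w * (real d - real (f w)))
     \<ge> real (f u) * (deficit n d f B - 2 * real d ^ 2 * (real d + 1)) / T"
proof -
  \<comment> \<open>The complementary weight: \<open>d - g w\<close> is \<open>d - f w\<close>
    outside \<open>B\<close> and 0 on \<open>B\<close>.\<close>
  define g where "g w = (if w \<in> B then real d else real (f w))" for w
  have "(\<Sum>w<n. a w * g w) \<le> real (f u) * (\<Sum>w<n. real (f w) * g w) / T"
    by (rule sum_a_le) (auto simp: g_def)
  moreover have "(\<Sum>w<n. a w * g w) = real d * real (f u) - (\<Sum>w\<in>{..<n} - B. a w * (real d - real (f w)))"
  proof -
    have "(\<Sum>w<n. a w * g w) = (\<Sum>w<n. real d * a w - (if w \<in> B then 0 else a w * (real d - real (f w))))"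
      by (intro sum.cong) (auto simp: g_def algebra_simps)
    also have "\<dots> = real d * (\<Sum>w<n. a w) - (\<Sum>w<n. if w \<in> B then 0 else a w * (real d - real (f w)))"
      by (simp add: sum_subtractf sum_distrib_left)
    also have "(\<Sum>w<n. if w \<in> B then 0 else a w * (real d - real (f w)))
        = (\<Sum>w\<in>{..<n} - B. a w * (real d - real (f w)))"
      by (intro sum.mono_neutral_cong_right) auto
    finally show ?thesis
      by (simp add: sum_a)
  qed
  moreover have "(\<Sum>w<n. real (f w) * g w) = real d * total n f - deficit n d f B"
  proof -
    have "(\<Sum>w<n. real (f w) * g w)
        = (\<Sum>w<n. real d * real (f w) - (if w \<in> B then 0 else real (f w) * (real d - real (f w))))"
      by (intro sum.cong) (auto simp: g_def algebra_simps)
    also have "\<dots> = real d * total n f - (\<Sum>w<n. if w \<in> B then 0 else real (f w) * (real d - real (f w)))"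
      by (simp add: sum_subtractf sum_distrib_left total_def)
    also have "(\<Sum>w<n. if w \<in> B then 0 else real (f w) * (real d - real (f w))) = deficit n d f B"
      unfolding deficit_def by (intro sum.mono_neutral_cong_right) auto
    finally show ?thesis .
  qed
  ultimately have "(\<Sum>w\<in>{..<n} - B. a w * (real d - real (f w)))
      \<ge> real d * real (f u) - real (f u) * (real d * total n f - deficit n d f B) / T"
    by simp
  moreover have "real d * real (f u) - real (f u) * (real d * total n f - deficit n d f B) / T
      = real (f u) * (deficit n d f B - 2 * real d ^ 2 * (real d + 1)) / T"
  proof -
    have "real d * total n f = real d * T + 2 * real d ^ 2 * (real d + 1)"
      by (simp add: T power2_eq_square algebra_simps)
    then show ?thesis
      using T_pos by (simp add: field_simps)
  qed
  ultimately show ?thesis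
    by simp
qed

lemma expectation_incr_le:
  "measure_pmf.expectation \<mu> incr
    \<le> real (f u) * (p * (real d - 1) - 1 + p * (2 * real d ^ 2 * (real d + 1)) / T - p * deficit n d f B / T)"
proof -
  have "0 \<le> (1 + p * (real d - 1)) * (\<Sum>w\<in>B. a w)"
    using p d a_nonneg by (intro mult_nonneg_nonneg sum_nonneg) auto
  moreover have "p * (real (f u) * (deficit n d f B - 2 * real d ^ 2 * (real d + 1)) / T)
      \<le> p * (\<Sum>w\<in>{..<n} - B. a w * (real d - real (f w)))"
    using sum_a_deficit_ge p by (intro mult_left_mono) auto
  ultimately have "measure_pmf.expectation \<mu> incr \<le> real (f u) * (p * (real d - 1) - 1)
      - p * (real (f u) * (deficit n d f B - 2 * real d ^ 2 * (real d + 1)) / T)"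
    unfolding expectation_incr' by linarith
  also have "\<dots> = real (f u) * (p * (real d - 1) - 1 + p * (2 * real d ^ 2 * (real d + 1)) / T
      - p * deficit n d f B / T)"
    using T_pos by (simp add: field_simps)
  finally show ?thesis .
qed

lemma expectation_incr_ge:
  "measure_pmf.expectation \<mu> incr
    \<ge> real (f u) * (p * (real d - 1) - 1 - (1 + p * (real d - 1)) * active f B / T - p * deficit n d f B / T)"
proof -
  have "(1 + p * (real d - 1)) * (\<Sum>w\<in>B. a w) \<le> (1 + p * (real d - 1)) * (real (f u) * active f B / T)"
    using sum_a_B_le p d by (intro mult_left_mono) auto
  moreover have "p * (\<Sum>w\<in>{..<n} - B. a w * (real d - real (f w))) \<le> p * (real (f u) * deficit n d f B / T)"
    using sum_a_deficit_le p by (intro mult_left_mono) auto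
  ultimately have "measure_pmf.expectation \<mu> incr \<ge> real (f u) * (p * (real d - 1) - 1)
      - (1 + p * (real d - 1)) * (real (f u) * active f B / T) - p * (real (f u) * deficit n d f B / T)"
    unfolding expectation_incr' by linarith
  moreover have "real (f u) * (p * (real d - 1) - 1)
      - (1 + p * (real d - 1)) * (real (f u) * active f B / T) - p * (real (f u) * deficit n d f B / T)
      = real (f u) * (p * (real d - 1) - 1 - (1 + p * (real d - 1)) * active f B / T - p * deficit n d f B / T)"
    using T_pos by (simp add: field_simps)
  ultimately show ?thesis
    by simp
qed

text \<open>A deleted edge to an untouched vertex outside \<open>B\<close> creates a deficit of
  \<open>d - 1\<close>. This is the leading term; the subtracted ones account for edges into
  \<open>B\<close> and for vertices already depleted.\<close>

lemma expectation_dincr_ge: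
  "measure_pmf.expectation \<mu> dincr
    \<ge> real (f u) * ((1 - p) * (real d - 1) * (1 - active f B / T) - real d * deficit n d f B / T)"
proof -
  have fd: "real (f w) \<le> real d" if "w \<in> {..<n} - B" for w
    using f_le [of w] that by auto
  have "measure_pmf.expectation \<mu> dincr
      = (\<Sum>w\<in>{..<n} - B. a w * ((1 - p) * (real d - 1)
          - (2 * (1 - p) + p * real (f w)) * (real d - real (f w))))"
    unfolding expectation_dincr sum_distrib_left sum_subtractf [symmetric]
    by (intro sum.cong) (auto simp: algebra_simps)
  also have "\<dots> \<ge> (\<Sum>w\<in>{..<n} - B. a w * ((1 - p) * (real d - 1) - real d * (real d - real (f w))))"
  proof (intro sum_mono mult_left_mono a_nonneg)
    fix w assume w: "w \<in> {..<n} - B"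
    have "2 * (1 - p) + p * real (f w) \<le> real d * (1 - p) + p * real d"
      using p d fd [OF w] by (intro add_mono mult_right_mono mult_left_mono) auto
    then have "2 * (1 - p) + p * real (f w) \<le> real d"
      by (simp add: algebra_simps)
    then have "(2 * (1 - p) + p * real (f w)) * (real d - real (f w)) \<le> real d * (real d - real (f w))"
      using fd [OF w] by (intro mult_right_mono) auto
    then show "(1 - p) * (real d - 1) - real d * (real d - real (f w))
        \<le> (1 - p) * (real d - 1) - (2 * (1 - p) + p * real (f w)) * (real d - real (f w))"
      by linarith
  qed
  also have "(\<Sum>w\<in>{..<n} - B. a w * ((1 - p) * (real d - 1) - real d * (real d - real (f w))))
      = (1 - p) * (real d - 1) * (\<Sum>w\<in>{..<n} - B. a w)
        - real d * (\<Sum>w\<in>{..<n} - B. a w * (real d - real (f w)))"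
    unfolding sum_distrib_left sum_subtractf [symmetric] by (intro sum.cong) (auto simp: algebra_simps)
  also have "\<dots> \<ge> (1 - p) * (real d - 1) * (real (f u) - real (f u) * active f B / T)
        - real d * (real (f u) * deficit n d f B / T)"
    unfolding sum_a_split using sum_a_B_le sum_a_deficit_le p d
    by (intro diff_mono mult_left_mono) auto
  also have "(1 - p) * (real d - 1) * (real (f u) - real (f u) * active f B / T)
        - real d * (real (f u) * deficit n d f B / T)
      = real (f u) * ((1 - p) * (real d - 1) * (1 - active f B / T) - real d * deficit n d f B / T)"
    using T_pos by (simp add: field_simps)
  finally show ?thesis .
qed

end

lemma expectation_incr_sq_ge: "measure_pmf.expectation \<mu> (\<lambda>z. (incr z)\<^sup>2) \<ge> (1 - p) ^ d"
proof -
  have "(1 - p) ^ d \<le> measure_pmf.prob \<mu> {z. snd z = {}}"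
    using prob_step_none_retained [OF ne p u fu_le] .
  also have "\<dots> = measure_pmf.expectation \<mu> (indicator {z. snd z = {}})"
    by simp
  also have "\<dots> \<le> measure_pmf.expectation \<mu> (\<lambda>z. (incr z)\<^sup>2)"
  proof (intro integral_mono integrable_step)
    fix z :: "nat set \<times> nat set"
    have "1 \<le> (incr z)\<^sup>2" if "snd z = {}"
    proof -
      have "incr z \<le> - 1"
        using fu that sum_nonneg [of B "indicator (fst z) :: nat \<Rightarrow> real"] by (simp add: incr_def)
      then have "1\<^sup>2 \<le> (- incr z)\<^sup>2"
        by (intro power_mono) auto
      then show ?thesis
        by simp
    qed
    then show "indicator {z. snd z = {}} z \<le> (incr z)\<^sup>2"
      by (auto simp: indicator_def)
  qed
  finally show ?thesis .
qed

lemma expectation_mono: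
  assumes "\<And>z. z \<in> set_pmf \<mu> \<Longrightarrow> g z \<le> (h z :: real)"
  shows "measure_pmf.expectation \<mu> g \<le> measure_pmf.expectation \<mu> h"
  using assms by (intro integral_mono_AE integrable_step) (auto simp: AE_measure_pmf_iff)

lemma expectation_exp_le:
  fixes Z :: "nat set \<times> nat set \<Rightarrow> real"
  assumes "\<And>z. z \<in> set_pmf \<mu> \<Longrightarrow> \<bar>Z z\<bar> \<le> c" "c \<le> 1"
  shows "measure_pmf.expectation \<mu> (\<lambda>z. exp (Z z)) \<le> exp (measure_pmf.expectation \<mu> Z + c\<^sup>2)"
proof -
  have "measure_pmf.expectation \<mu> (\<lambda>z. exp (Z z)) \<le> measure_pmf.expectation \<mu> (\<lambda>z. 1 + Z z + c\<^sup>2)"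
  proof (rule expectation_mono)
    fix z assume z: "z \<in> set_pmf \<mu>"
    have "(Z z)\<^sup>2 \<le> c\<^sup>2"
      using assms(1) [OF z] by (rule abs_le_square_iff [THEN iffD1, OF order_trans]) simp
    then show "exp (Z z) \<le> 1 + Z z + c\<^sup>2"
      using assms(1) [OF z] assms(2) exp_le_quadratic [of "Z z"] by linarith
  qed
  also have "\<dots> = 1 + (measure_pmf.expectation \<mu> Z + c\<^sup>2)"
    by (simp add: integrable_step)
  also have "\<dots> \<le> exp (measure_pmf.expectation \<mu> Z + c\<^sup>2)"
    by (rule exp_ge_add_one_self)
  finally show ?thesis .
qed

lemma expectation_exp_ge:
  fixes Z :: "nat set \<times> nat set \<Rightarrow> real"
  assumes "\<And>z. z \<in> set_pmf \<mu> \<Longrightarrow> \<bar>Z z\<bar> \<le> 2"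
  shows "measure_pmf.expectation \<mu> (\<lambda>z. exp (Z z))
    \<ge> 1 + measure_pmf.expectation \<mu> Z + measure_pmf.expectation \<mu> (\<lambda>z. (Z z)\<^sup>2) / 4"
proof -
  have "1 + measure_pmf.expectation \<mu> Z + measure_pmf.expectation \<mu> (\<lambda>z. (Z z)\<^sup>2) / 4
      = measure_pmf.expectation \<mu> (\<lambda>z. 1 + Z z + (Z z)\<^sup>2 / 4)"
    by (simp add: integrable_step)
  also have "\<dots> \<le> measure_pmf.expectation \<mu> (\<lambda>z. exp (Z z))"
  proof (rule expectation_mono)
    fix z assume z: "z \<in> set_pmf \<mu>"
    show "1 + Z z + (Z z)\<^sup>2 / 4 \<le> exp (Z z)"
      using assms [OF z] by (intro exp_ge_quadratic) auto
  qed
  finally show ?thesis .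
qed

end

subsection \<open>Drift in the critical window\<close>

text \<open>A set \<open>B\<close> without remaining half-edges is isolated in every graph of the
  support, so its cluster is \<open>B\<close> itself. This closes off exhausted
  explorations.\<close>

lemma prob_law_isolated:
  assumes "deg_graphs n f \<noteq> {}" "B \<subseteq> {..<n}" "\<And>b. b \<in> B \<Longrightarrow> f b = 0" "\<not> Q B"
  shows "measure_pmf.prob (law n f p) {P. Q (reach P B)} = 0"
proof -
  have "reach P B = B" if "P \<in> set_pmf (law n f p)" for P
  proof (rule reach_isolated)
    fix b assume b: "b \<in> B"
    from that assms(1) obtain G where G: "G \<in> deg_graphs n f" "P \<in> set_pmf (percolation p G)"
      by (auto simp: law_def finite_deg_graphs)
    have "P \<subseteq> G"
      using set_pmf_percolation [OF G(2)] .
    have "nbrs G b = {}"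
      using deg_graphs_no_edge_if_zero [OF G(1)] assms b by auto
    then show "nbrs P b = {}"
      using \<open>P \<subseteq> G\<close> by (auto simp: nbrs_def)
  qed
  then have "AE P in law n f p. P \<notin> {P. Q (reach P B)}"
    using assms(4) by (simp add: AE_measure_pmf_iff)
  then show ?thesis
    by (simp add: measure_pmf.prob_eq_0)
qed

lemma active_nonneg: "active f B \<ge> 0"
  by (simp add: active_def sum_nonneg)

lemma deficit_nonneg: "(\<And>v. v < n \<Longrightarrow> f v \<le> d) \<Longrightarrow> deficit n d f B \<ge> 0"
  by (auto simp: deficit_def intro!: sum_nonneg)

lemma total_le: "(\<And>v. v < n \<Longrightarrow> f v \<le> d) \<Longrightarrow> total n f \<le> real d * real n"
  using sum_bounded_above [of "{..<n}" "\<lambda>w. real (f w)" "real d"] by (simp add: total_def mult.commute)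

text \<open>\<open>s\<close> is the cube root of \<open>n\<close>, and \<open>L\<close> dominates
  the window parameter. \<open>s \<ge> 2 * L\<close> puts \<open>p * (d - 1)\<close> between 1/2 and
  3/2, which for \<open>d \<ge> 3\<close> keeps \<open>p\<close> away from 1;
  \<open>s \<ge> 8 * d\<^sup>2\<close> pushes the switching errors of order \<open>1 / n\<close>
  below \<open>1 / s\<close>. Smaller \<open>s\<close> are disposed of by trivial estimates at the
  end.\<close>

locale critical_window =
  fixes n d :: nat and p s L :: real
  assumes d: "d \<ge> 3" and n_eq: "real n = s ^ 3" and p: "0 \<le> p" "p \<le> 1" and L: "L \<ge> 1"
    and drift: "\<bar>p * (real d - 1) - 1\<bar> \<le> L / s" and s_ge: "s \<ge> 2 * L" "s \<ge> 8 * real d ^ 2"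
begin

lemma s_pos: "s > 0"
  using L s_ge by linarith

lemma n_pos: "real n > 0"
  using s_pos n_eq by simp

lemma L_s: "L / s \<le> 1 / 2"
  using s_ge s_pos by (simp add: field_simps)

lemma p_le: "p \<le> 3 / 4"
proof -
  have "p * 2 \<le> p * (real d - 1)"
    using d p by (intro mult_left_mono) auto
  then show ?thesis
    using drift L_s by linarith
qed

lemma p_ge: "p \<ge> 1 / (2 * real d)"
proof -
  have "p * (real d - 1) \<le> p * real d"
    using p by (intro mult_left_mono) auto
  then have "1 / 2 \<le> p * real d"
    using drift L_s by linarith
  then show ?thesis
    using d by (simp add: field_simps)
qed

text \<open>\<open>j\<close> is the number of exploration steps still allowed: the bounds leave room for the changes
  that \<open>j\<close> further steps can cause.\<close>

definition good :: "real \<Rightarrow> nat \<Rightarrow> (nat \<Rightarrow> nat) \<Rightarrow> nat set \<Rightarrow> bool" where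
  "good \<rho> j f B \<longleftrightarrow> (\<forall>v<n. f v \<le> d) \<and> deg_graphs n f \<noteq> {} \<and> B \<subseteq> {..<n}
     \<and> total n f \<ge> real d * real n / 2 + 2 * real d * real j + 2 * real d * (real d + 1)
     \<and> active f B \<le> \<rho> - 2 * real d ^ 2 * real j \<and> deficit n d f B \<le> \<rho> - 3 * real d ^ 3 * real j"

lemma good_exploration:
  "good \<rho> j f B \<Longrightarrow> u \<in> B \<Longrightarrow> f u > 0 \<Longrightarrow> exploration n d f p u B"
  using d p by unfold_locales (auto simp: good_def)

lemma good_finite: "good \<rho> j f B \<Longrightarrow> finite B"
  by (auto simp: good_def intro: finite_subset)

lemma good_step:
  assumes g: "good \<rho> (Suc j) f B" and uB': "u \<in> B" "f u > 0" and z: "z \<in> set_pmf (step n f p u)"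
  shows "good \<rho> j (residual f u (fst z)) (B \<union> snd z)"
proof -
  interpret exploration n d f p u B
    using good_exploration [OF g uB'] .
  have zz: "snd z \<subseteq> fst z" "fst z \<subseteq> {..<n}" "deg_graphs n (residual f u (fst z)) \<noteq> {}"
    using step_facts [of "fst z" "snd z"] z by auto
  have "residual f u (fst z) v \<le> d" if "v < n" for v
    using f_le [OF that] by (auto simp: residual_def)
  then show ?thesis
    using g zz B total_step [OF z] active_step [OF z] deficit_step [OF z] abs_incr_le [OF z] abs_dincr_le [OF z]
    unfolding good_def by (auto simp: algebra_simps)
qed

context
  fixes \<rho> j f B u
  assumes g: "good \<rho> j f B" and uB': "u \<in> B" "f u > 0" and \<rho>: "\<rho> \<le> real n / 16"
begin

interpretation exploration n d f p u B
  using good_exploration [OF g uB'] .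

lemma T_bounds:
  "total n f - 2 * real d * (real d + 1) \<ge> real d * real n / 2"
  "total n f - 2 * real d * (real d + 1) \<le> real d * real n"
  "total n f - 2 * real d * (real d + 1) > 0"
proof -
  show 1: "total n f - 2 * real d * (real d + 1) \<ge> real d * real n / 2"
  proof -
    have "0 \<le> 2 * real d * real j"
      by simp
    then show ?thesis
      using g unfolding good_def by linarith
  qed
  show "total n f - 2 * real d * (real d + 1) \<le> real d * real n"
  proof -
    have "0 \<le> 2 * real d * (real d + 1)"
      by simp
    then show ?thesis
      using total_le [of n f d, OF f_le] by linarith
  qed
  have "real d * real n / 2 > 0"
    using n_pos d by simp
  then show "total n f - 2 * real d * (real d + 1) > 0"
    using 1 by linarith
qed

lemma XY_bounds: "0 \<le> active f B" "active f B \<le> \<rho>" "0 \<le> deficit n d f B" "deficit n d f B \<le> \<rho>"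
proof -
  show "0 \<le> active f B" "0 \<le> deficit n d f B"
    using active_nonneg deficit_nonneg f_le by auto
  have "0 \<le> 2 * real d ^ 2 * real j" "0 \<le> 3 * real d ^ 3 * real j"
    by simp_all
  then show "active f B \<le> \<rho>" "deficit n d f B \<le> \<rho>"
    using g unfolding good_def by linarith+
qed

text \<open>The summand 1 in \<open>L + 1\<close> absorbs the switching error. The coefficient of
  the deficit comes from \<open>p \<ge> 1 / (2 * d)\<close> and the upper bound \<open>d * n\<close>
  for the denominator.\<close>

lemma mean_incr_le:
  "measure_pmf.expectation (step n f p u) (exploration.incr n f u B)
     \<le> real (f u) * ((L + 1) / s - deficit n d f B / (2 * real d ^ 2 * real n))"
proof -
  define T where "T = total n f - 2 * real d * (real d + 1)"
  note T = T_bounds [folded T_def]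
  have "p * (2 * real d ^ 2 * (real d + 1)) / T \<le> 1 * (2 * real d ^ 2 * (real d + 1)) / (real d * real n / 2)"
    using T p d n_pos by (intro frac_le mult_right_mono) auto
  also have "\<dots> = 4 * real d * (real d + 1) / real n"
    using d by (simp add: power2_eq_square)
  also have "\<dots> = 4 * real d * (real d + 1) / (s * s * s)"
    by (simp add: n_eq power3_eq_cube)
  also have "\<dots> \<le> s * s / (s * s * s)"
  proof (intro divide_right_mono)
    have "real d * (real d + 1) \<le> real d * (real d + real d)"
      using d by (intro mult_left_mono) auto
    then have "4 * real d * (real d + 1) \<le> 8 * real d ^ 2"
      by (simp add: power2_eq_square)
    also have "\<dots> \<le> s * 1"
      using s_ge by simp
    also have "\<dots> \<le> s * s"
      using s_ge L by (intro mult_left_mono) auto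
    finally show "4 * real d * (real d + 1) \<le> s * s" .
  qed (use s_pos in auto)
  also have "\<dots> = 1 / s"
    using s_pos by simp
  finally have 1: "p * (2 * real d ^ 2 * (real d + 1)) / T \<le> 1 / s" .
  have "deficit n d f B / (2 * real d ^ 2 * real n) = (1 / (2 * real d)) * deficit n d f B / (real d * real n)"
    by (simp add: power2_eq_square)
  also have "\<dots> \<le> p * deficit n d f B / T"
    using T p p_ge XY_bounds by (intro frac_le mult_right_mono mult_nonneg_nonneg) auto
  finally have 2: "deficit n d f B / (2 * real d ^ 2 * real n) \<le> p * deficit n d f B / T" .
  have "p * (real d - 1) - 1 + p * (2 * real d ^ 2 * (real d + 1)) / T - p * deficit n d f B / T
      \<le> (L + 1) / s - deficit n d f B / (2 * real d ^ 2 * real n)"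
    using 1 2 drift by (simp add: add_divide_distrib)
  then show ?thesis
    by (intro order_trans [OF expectation_incr_le [OF T_def T(3)] mult_left_mono]) auto
qed

text \<open>Here \<open>1 - p \<ge> 1/4\<close> and \<open>d - 1 \<ge> 2\<close>, while
  \<open>\<rho> \<le> n / 16\<close> limits the two corrections to 1/24 and 1/8;
  \<open>23/48 - 1/8\<close> still exceeds 1/4.\<close>

lemma mean_dincr_ge:
  "measure_pmf.expectation (step n f p u) (exploration.dincr n d f B) \<ge> real (f u) / 4"
proof -
  define T where "T = total n f - 2 * real d * (real d + 1)"
  note T = T_bounds [folded T_def]
  have dn: "3 * real n \<le> real d * real n"
    using d by (intro mult_right_mono) auto
  have "active f B / T \<le> (real n / 16) / (3 * real n / 2)"
  proof (intro frac_le)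
    show "3 * real n / 2 \<le> T"
      using T dn by linarith
  qed (use XY_bounds \<rho> n_pos in auto)
  also have "\<dots> = 1 / 24"
    using n_pos by simp
  finally have X: "active f B / T \<le> 1 / 24" .
  have "real d * deficit n d f B / T \<le> real d * (real n / 16) / (real d * real n / 2)"
    using XY_bounds \<rho> T n_pos d by (intro frac_le mult_left_mono) auto
  also have "\<dots> = 1 / 8"
    using n_pos d by simp
  finally have Y: "real d * deficit n d f B / T \<le> 1 / 8" .
  have "(1 / 4) * 2 * (23 / 24) \<le> (1 - p) * (real d - 1) * (1 - active f B / T)"
    using p_le d X by (intro mult_mono) auto
  then have "1 / 4 \<le> (1 - p) * (real d - 1) * (1 - active f B / T) - real d * deficit n d f B / T"
    using Y by linarith
  then have "real (f u) * (1 / 4)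
      \<le> real (f u) * ((1 - p) * (real d - 1) * (1 - active f B / T) - real d * deficit n d f B / T)"
    by (intro mult_left_mono) auto
  then show ?thesis
    using expectation_dincr_ge [OF T_def T(3)] by linarith
qed

lemma mean_incr_ge:
  "measure_pmf.expectation (step n f p u) (exploration.incr n f u B) \<ge> - real d * (L / s + 3 * \<rho> / real n)"
proof -
  define T where "T = total n f - 2 * real d * (real d + 1)"
  note T = T_bounds [folded T_def]
  have \<rho>0: "\<rho> \<ge> 0"
    using XY_bounds by linarith
  have "(1 + p * (real d - 1)) * active f B / T \<le> (5 / 2) * \<rho> / T"
  proof (intro divide_right_mono mult_mono)
    show "1 + p * (real d - 1) \<le> 5 / 2"
      using drift L_s by linarith
  qed (use XY_bounds T \<rho>0 in auto)
  moreover have "p * deficit n d f B / T \<le> (1 / 2) * \<rho> / T * 2"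
    using p XY_bounds T mult_mono [of p 1 "deficit n d f B" \<rho>] by (auto intro!: divide_right_mono)
  moreover have "(7 / 2) * \<rho> / T \<le> (7 / 2) * \<rho> / (3 * real n / 2)"
  proof -
    have "3 * real n \<le> real d * real n"
      using d by (intro mult_right_mono) auto
    then have "3 * real n / 2 \<le> T"
      using T by linarith
    then show ?thesis
      using T n_pos \<rho>0 by (intro divide_left_mono) auto
  qed
  moreover have "(7 / 2) * \<rho> / (3 * real n / 2) \<le> 3 * \<rho> / real n"
    using \<rho>0 n_pos by (simp add: field_simps)
  ultimately have "p * (real d - 1) - 1 - (1 + p * (real d - 1)) * active f B / T - p * deficit n d f B / T
      \<ge> - (L / s + 3 * \<rho> / real n)"
    using drift by (simp add: field_simps)
  then have "real (f u) * (p * (real d - 1) - 1 - (1 + p * (real d - 1)) * active f B / T - p * deficit n d f B / T)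
      \<ge> real (f u) * - (L / s + 3 * \<rho> / real n)"
    by (intro mult_left_mono) auto
  moreover have "real (f u) * (L / s + 3 * \<rho> / real n) \<le> real d * (L / s + 3 * \<rho> / real n)"
    using fu_le \<rho>0 n_pos L s_pos by (intro mult_right_mono) auto
  ultimately show ?thesis
    using expectation_incr_ge [OF T_def T(3)] unfolding mult_minus_right mult_minus_left by linarith
qed

lemma mean_incr_sq_ge:
  "measure_pmf.expectation (step n f p u) (\<lambda>z. (exploration.incr n f u B z)\<^sup>2) \<ge> (1 / 4) ^ d"
proof -
  have "(1 / 4) ^ d \<le> (1 - p) ^ d"
    using p_le by (intro power_mono) auto
  then show ?thesis
    using expectation_incr_sq_ge by linarith
qed

lemma mean_incr_le': "measure_pmf.expectation (step n f p u) (exploration.incr n f u B) \<le> real d * (L + 1) / s"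
proof -
  have "real (f u) * ((L + 1) / s - deficit n d f B / (2 * real d ^ 2 * real n)) \<le> real (f u) * ((L + 1) / s)"
    using XY_bounds n_pos by (intro mult_left_mono) auto
  also have "\<dots> \<le> real d * ((L + 1) / s)"
    using fu_le L s_pos by (intro mult_right_mono) auto
  finally show ?thesis
    using mean_incr_le by simp
qed

end

lemma explore_one_step:
  assumes g: "good \<rho> (Suc j) f B" and uB': "u \<in> B" "f u > 0"
    and le: "\<And>z. z \<in> set_pmf (step n f p u) \<Longrightarrow>
      measure_pmf.prob (law n (residual f u (fst z)) p) {P. Q (reach P (B \<union> snd z))} \<le> \<Phi> z"
  shows "measure_pmf.prob (law n f p) {P. Q (reach P B)} \<le> measure_pmf.expectation (step n f p u) \<Phi>"
proof -
  interpret exploration n d f p u B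
    using good_exploration [OF g uB'] .
  show ?thesis
    using le by (intro prob_law_step_le ne u) (auto simp: reach_explore [OF uB])
qed

end

section \<open>Upper tail\<close>

context critical_window
begin

definition kap :: "real \<Rightarrow> nat \<Rightarrow> real" where
  "kap \<alpha> j = \<alpha> * real j / (2 * real d ^ 2 * real n)"

text \<open>Accumulated over \<open>j\<close> steps: the mean drift, the second-order error of the
  exponential and, with negative sign, a quarter of \<open>kap\<close>, which is the least mean
  growth of the deficit in a step weighted by \<open>kap\<close>.\<close>

definition log_weight :: "real \<Rightarrow> nat \<Rightarrow> real" where
  "log_weight \<alpha> j = real j * (\<alpha> * real d * (L + 1) / s + (4 * \<alpha> * real d ^ 2)\<^sup>2) - (\<Sum>i<j. kap \<alpha> i) / 4"

text \<open>The weight \<open>kap \<alpha> j\<close> of the deficit anticipates the drift that the deficit causes in the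
  remaining \<open>j\<close> steps; its own growth then yields the term of order \<open>j\<^sup>2 / n\<close> in \<open>log_weight\<close>
  without any concentration estimate for the deficit.\<close>

lemma survival_exp_bound:
  assumes \<alpha>: "0 < \<alpha>" "4 * \<alpha> * real d ^ 2 \<le> 1"
  shows "good (real n / 16) j f B \<Longrightarrow> j \<le> n \<Longrightarrow> card B + d * j < k \<Longrightarrow>
    measure_pmf.prob (law n f p) {P. k \<le> card (reach P B)}
      \<le> exp (\<alpha> * active f B - kap \<alpha> j * deficit n d f B + log_weight \<alpha> j)"
proof (induction j arbitrary: f B)
  case 0
  have "measure_pmf.prob (law n f p) {P. k \<le> card (reach P B)} \<le> 1"
    by simp
  also have "1 \<le> exp (\<alpha> * active f B)"
    using \<alpha> active_nonneg by simp
  finally show ?case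
    by (simp add: kap_def log_weight_def)
next
  case (Suc j)
  note g = Suc.prems(1)
  show ?case
  proof (cases "\<exists>u\<in>B. f u > 0")
    case False
    \<comment> \<open>The cluster is then \<open>B\<close>. Since a step adds at most
      \<open>d\<close> vertices, the margin of \<open>d\<close> per remaining step keeps
      \<open>B\<close> smaller than \<open>k\<close> throughout.\<close>
    then have "measure_pmf.prob (law n f p) {P. k \<le> card (reach P B)} = 0"
      using g Suc.prems(3) by (intro prob_law_isolated) (auto simp: good_def)
    then show ?thesis
      by simp
  next
    case True
    then obtain v where v: "v \<in> B" "f v > 0"
      by blast
    interpret exploration n d f p v B
      using good_exploration [OF g v] .
    define Z where "Z z = \<alpha> * incr z - kap \<alpha> j * dincr z" for z
    let ?c = "4 * \<alpha> * real d ^ 2"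
    let ?e = "\<alpha> * active f B - kap \<alpha> j * deficit n d f B + log_weight \<alpha> j"
    have kap0: "kap \<alpha> j \<ge> 0"
      using \<alpha> by (simp add: kap_def)
    have "measure_pmf.prob (law n f p) {P. k \<le> card (reach P B)}
        \<le> measure_pmf.expectation \<mu> (\<lambda>z. exp ?e * exp (Z z))"
    proof (rule explore_one_step [OF g v])
      fix z assume z: "z \<in> set_pmf \<mu>"
      have "card (B \<union> snd z) \<le> card B + d"
        using card_Un_le [of B "snd z"] step_cards [OF z] by linarith
      then have "measure_pmf.prob (law n (residual f v (fst z)) p) {P. k \<le> card (reach P (B \<union> snd z))}
          \<le> exp (\<alpha> * active (residual f v (fst z)) (B \<union> snd z)
              - kap \<alpha> j * deficit n d (residual f v (fst z)) (B \<union> snd z) + log_weight \<alpha> j)"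
        using Suc.prems by (intro Suc.IH good_step [OF g v z]) auto
      also have "\<dots> = exp ?e * exp (Z z)"
        unfolding active_step [OF z] deficit_step [OF z] exp_add [symmetric] Z_def
        by (simp add: algebra_simps)
      finally show "measure_pmf.prob (law n (residual f v (fst z)) p) {P. k \<le> card (reach P (B \<union> snd z))}
          \<le> exp ?e * exp (Z z)" .
    qed
    also have "\<dots> = exp ?e * measure_pmf.expectation \<mu> (\<lambda>z. exp (Z z))"
      by simp
    also have "\<dots> \<le> exp ?e * exp (measure_pmf.expectation \<mu> Z + ?c\<^sup>2)"
    proof (intro mult_left_mono expectation_exp_le \<alpha>(2))
      fix z assume z: "z \<in> set_pmf \<mu>"
      have "\<bar>Z z\<bar> \<le> \<alpha> * \<bar>incr z\<bar> + kap \<alpha> j * \<bar>dincr z\<bar>"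
        unfolding Z_def using \<alpha> kap0 abs_triangle_ineq4 [of "\<alpha> * incr z" "kap \<alpha> j * dincr z"]
        by (simp add: abs_mult)
      also have "\<dots> \<le> \<alpha> * (2 * real d ^ 2) + kap \<alpha> j * (3 * real d ^ 3)"
        using \<alpha> kap0 abs_incr_le [OF z] abs_dincr_le [OF z] by (intro add_mono mult_left_mono) auto
      also have "kap \<alpha> j * (3 * real d ^ 3) \<le> \<alpha> / (2 * real d ^ 2) * (3 * real d ^ 3)"
      proof (intro mult_right_mono)
        have "kap \<alpha> j = \<alpha> / (2 * real d ^ 2) * (real j / real n)"
          by (simp add: kap_def)
        also have "\<dots> \<le> \<alpha> / (2 * real d ^ 2) * 1"
          using Suc.prems(2) \<alpha> n_pos by (intro mult_left_mono) auto
        finally show "kap \<alpha> j \<le> \<alpha> / (2 * real d ^ 2)"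
          by simp
      qed auto
      also have "\<alpha> / (2 * real d ^ 2) * (3 * real d ^ 3) = \<alpha> * (3 / 2 * real d)"
        using d by (simp add: power2_eq_square power3_eq_cube)
      also have "\<dots> \<le> \<alpha> * (2 * real d ^ 2)"
      proof (intro mult_left_mono)
        have "3 / 2 * real d \<le> (2 * real d) * real d"
          using d by (intro mult_right_mono) auto
        then show "3 / 2 * real d \<le> 2 * real d ^ 2"
          by (simp add: power2_eq_square)
      qed (use \<alpha> in auto)
      finally show "\<bar>Z z\<bar> \<le> ?c"
        by simp
    qed auto
    also have "\<dots> = exp (?e + measure_pmf.expectation \<mu> Z + ?c\<^sup>2)"
      by (simp add: exp_add)
    also have "\<dots> \<le> exp (\<alpha> * active f B - kap \<alpha> (Suc j) * deficit n d f B + log_weight \<alpha> (Suc j))"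
    proof -
      define q where "q = deficit n d f B / (2 * real d ^ 2 * real n)"
      have q: "q \<ge> 0"
        using deficit_nonneg f_le by (simp add: q_def)
      have "measure_pmf.expectation \<mu> Z
          = \<alpha> * measure_pmf.expectation \<mu> incr - kap \<alpha> j * measure_pmf.expectation \<mu> dincr"
        unfolding Z_def by (simp add: integrable_step)
      also have "\<dots> \<le> \<alpha> * (real (f v) * ((L + 1) / s - q)) - kap \<alpha> j * (real (f v) / 4)"
        using \<alpha> kap0 mean_incr_le [OF g v] mean_dincr_ge [OF g v] unfolding q_def
        by (intro diff_mono mult_left_mono) auto
      also have "\<dots> = \<alpha> * (L + 1) / s * real (f v) - (\<alpha> * q + kap \<alpha> j / 4) * real (f v)"
        by (simp add: algebra_simps)
      \<comment> \<open>\<open>f v\<close> lies between 1 and \<open>d\<close>; the cost takes the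
        upper end and the gains the lower one.\<close>
      also have "\<dots> \<le> \<alpha> * (L + 1) / s * real d - (\<alpha> * q + kap \<alpha> j / 4) * 1"
        using fu fu_le \<alpha> L s_pos q kap0 by (intro diff_mono mult_left_mono) auto
      finally have "measure_pmf.expectation \<mu> Z \<le> \<alpha> * real d * (L + 1) / s - \<alpha> * q - kap \<alpha> j / 4"
        by (simp add: mult_ac)
      \<comment> \<open>The drift loss \<open>\<alpha> * q\<close> of this step is precisely what
        raises the weight of the deficit from \<open>kap \<alpha> j\<close> to
        \<open>kap \<alpha> (Suc j)\<close>.\<close>
      moreover have "kap \<alpha> (Suc j) * deficit n d f B = kap \<alpha> j * deficit n d f B + \<alpha> * q"
        by (simp add: kap_def q_def ring_distribs add_divide_distrib)
      moreover have "log_weight \<alpha> (Suc j) = log_weight \<alpha> j + \<alpha> * real d * (L + 1) / s + ?c\<^sup>2 - kap \<alpha> j / 4"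
        by (simp add: log_weight_def ring_distribs add_divide_distrib)
      ultimately show ?thesis
        by simp
    qed
    finally show ?thesis .
  qed
qed

text \<open>The number that makes the variance term
  \<open>(decay / s)\<^sup>2 * (1 / 4) ^ d / 4\<close> exceed the drift term
  \<open>decay / s * (d * (L + 1) / s)\<close> by \<open>decay / s\<^sup>2\<close>.\<close>

definition decay :: real where
  "decay = 4 * 4 ^ d * (real d * (L + 1) + 1)"

lemma decay_ge_1: "decay \<ge> 1"
proof -
  have "1 \<le> (4 * 4 ^ d :: real)"
    using one_le_power [of "4::real" d] by linarith
  then have "1 * 1 \<le> (4 * 4 ^ d :: real) * (real d * (L + 1) + 1)"
    using L by (intro mult_mono) auto
  then show ?thesis
    by (simp add: decay_def)
qed

text \<open>Although the drift of \<open>X\<close> may be positive, the variance makes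
  \<open>exp (- decay * X / s)\<close> grow in mean at rate \<open>1 / s\<^sup>2\<close>. The
  condition on \<open>s\<close> keeps the exponent of one increment within [-2, 2], where the
  quadratic lower bound for \<open>exp\<close> holds.\<close>

lemma mean_exp_decay:
  assumes g: "good \<rho> j f B" and v: "v \<in> B" "f v > 0" and \<rho>: "\<rho> \<le> real n / 16" and s: "s \<ge> decay * real d ^ 2"
  shows "measure_pmf.expectation (step n f p v) (\<lambda>z. exp (- (decay / s) * exploration.incr n f v B z)) \<ge> 1 + 1 / s\<^sup>2"
proof -
  interpret exploration n d f p v B
    using good_exploration [OF g v] .
  let ?b = "decay / s"
  have b: "?b > 0"
    using decay_ge_1 s_pos by simp
  have "\<bar>- ?b * incr z\<bar> \<le> 2" if "z \<in> set_pmf \<mu>" for z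
  proof -
    have "\<bar>- ?b * incr z\<bar> = ?b * \<bar>incr z\<bar>"
      using decay_ge_1 s_pos by (simp add: abs_mult)
    also have "\<dots> \<le> ?b * (2 * real d ^ 2)"
      using b abs_incr_le [OF that] by (intro mult_left_mono) auto
    also have "\<dots> = 2 * (decay * real d ^ 2) / s"
      by simp
    also have "\<dots> \<le> 2 * s / s"
      using s s_pos by (intro divide_right_mono) auto
    finally show ?thesis
      using s_pos by simp
  qed
  then have "1 + measure_pmf.expectation \<mu> (\<lambda>z. - ?b * incr z) + measure_pmf.expectation \<mu> (\<lambda>z. (- ?b * incr z)\<^sup>2) / 4
      \<le> measure_pmf.expectation \<mu> (\<lambda>z. exp (- ?b * incr z))"
    by (intro expectation_exp_ge) auto
  moreover have "measure_pmf.expectation \<mu> (\<lambda>z. - ?b * incr z) = - ?b * measure_pmf.expectation \<mu> incr"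
    by simp
  moreover have "?b * measure_pmf.expectation \<mu> incr \<le> ?b * (real d * (L + 1) / s)"
    using mean_incr_le' [OF g v \<rho>] b by (intro mult_left_mono) auto
  moreover have "measure_pmf.expectation \<mu> (\<lambda>z. (- ?b * incr z)\<^sup>2)
      = ?b\<^sup>2 * measure_pmf.expectation \<mu> (\<lambda>z. (incr z)\<^sup>2)"
    by (simp add: power_mult_distrib power_divide)
  moreover have "?b\<^sup>2 * measure_pmf.expectation \<mu> (\<lambda>z. (incr z)\<^sup>2) \<ge> ?b\<^sup>2 * (1 / 4) ^ d"
    using mean_incr_sq_ge [OF g v \<rho>] by (intro mult_left_mono) auto
  moreover have "?b\<^sup>2 * (1 / 4) ^ d / 4 - ?b * (real d * (L + 1) / s) = decay / s\<^sup>2"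
  proof -
    have "decay * (1 / 4) ^ d / 4 = real d * (L + 1) + 1"
      by (simp add: decay_def power_divide)
    moreover have "?b\<^sup>2 * (1 / 4) ^ d / 4 = decay * (decay * (1 / 4) ^ d / 4) / s\<^sup>2"
      by (simp add: power2_eq_square)
    ultimately have "?b\<^sup>2 * (1 / 4) ^ d / 4 = decay * (real d * (L + 1) + 1) / s\<^sup>2"
      by (simp only:)
    moreover have "?b * (real d * (L + 1) / s) = decay * (real d * (L + 1)) / s\<^sup>2"
      by (simp add: power2_eq_square)
    ultimately show ?thesis
      by (simp only: diff_divide_distrib [symmetric] right_diff_distrib [symmetric]) simp
  qed
  moreover have "1 / s\<^sup>2 \<le> decay / s\<^sup>2"
    using decay_ge_1 by (intro divide_right_mono) auto
  ultimately show ?thesis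
    by simp
qed

text \<open>During the first \<open>m\<close> steps the exploration either reaches the height \<open>s = n\<^bsup>1/3\<^esup>\<close> or
  survives for \<open>m \<ge> s\<^sup>2 / 2\<close> steps; the concave potential \<open>1 - exp (- decay * X / s)\<close> shows that this
  has probability of order \<open>1 / s\<close>.\<close>

lemma survival_two_phase_bound:
  assumes \<alpha>: "0 < \<alpha>" "4 * \<alpha> * real d ^ 2 \<le> 1" and s: "s \<ge> decay * real d ^ 2"
    and m: "real m \<ge> s\<^sup>2 / 2" "J + m \<le> n"
    and S: "\<And>j. J \<le> j \<Longrightarrow> j \<le> J + m \<Longrightarrow> exp (\<alpha> * (s + 2 * real d ^ 2) + log_weight \<alpha> j) \<le> S"
  shows "i \<le> m \<Longrightarrow> good (real n / 16) (J + i) f B \<Longrightarrow> card B + d * (J + i) < k \<Longrightarrow>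
    active f B \<le> s + 2 * real d ^ 2 \<Longrightarrow>
    measure_pmf.prob (law n f p) {P. k \<le> card (reach P B)}
      \<le> S * (2 * exp decay * (1 - exp (- (decay / s) * active f B)) + 1 - real i / real m)"
proof -
  have mpos: "real m > 0"
    using m(1) zero_less_power [OF s_pos, of 2] by linarith
  have S0: "S \<ge> 0"
    by (rule order_trans [OF exp_ge_zero S [of J]]) auto
  have b: "decay / s > 0"
    using decay_ge_1 s_pos by simp
  have concave_nonneg: "0 \<le> 2 * exp decay * (1 - exp (- (decay / s) * x))" if "x \<ge> 0" for x
  proof -
    have "0 \<le> decay / s * x"
      using that b by (intro mult_nonneg_nonneg) auto
    then have "exp (- (decay / s) * x) \<le> 1"
      by (simp only: mult_minus_left exp_le_one_iff neg_le_0_iff_le)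
    then show ?thesis
      by (intro mult_nonneg_nonneg) simp_all
  qed
  \<comment> \<open>Whatever happened before, from a height of at most
    \<open>s + 2 * d\<^sup>2\<close> at least \<open>J\<close> steps are still to be survived, which
    costs the factor \<open>S\<close>.\<close>
  have late: "measure_pmf.prob (law n f p) {P. k \<le> card (reach P B)} \<le> S"
    if "i \<le> m" "good (real n / 16) (J + i) f B" "card B + d * (J + i) < k" "active f B \<le> s + 2 * real d ^ 2"
    for i f B
  proof -
    have "measure_pmf.prob (law n f p) {P. k \<le> card (reach P B)}
        \<le> exp (\<alpha> * active f B - kap \<alpha> (J + i) * deficit n d f B + log_weight \<alpha> (J + i))"
      using that m by (intro survival_exp_bound \<alpha>) auto
    also have "\<dots> \<le> exp (\<alpha> * (s + 2 * real d ^ 2) + log_weight \<alpha> (J + i))"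
    proof -
      have "\<alpha> * active f B \<le> \<alpha> * (s + 2 * real d ^ 2)"
        using that \<alpha> by (intro mult_left_mono) auto
      moreover have "0 \<le> kap \<alpha> (J + i) * deficit n d f B"
        using that \<alpha> by (intro mult_nonneg_nonneg deficit_nonneg) (auto simp: kap_def good_def)
      ultimately show ?thesis
        by simp
    qed
    also have "\<dots> \<le> S"
      using that by (intro S) auto
    finally show ?thesis .
  qed
  show "i \<le> m \<Longrightarrow> good (real n / 16) (J + i) f B \<Longrightarrow> card B + d * (J + i) < k \<Longrightarrow>
    active f B \<le> s + 2 * real d ^ 2 \<Longrightarrow>
    measure_pmf.prob (law n f p) {P. k \<le> card (reach P B)}
      \<le> S * (2 * exp decay * (1 - exp (- (decay / s) * active f B)) + 1 - real i / real m)"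
  proof (induction i arbitrary: f B)
    case 0
    have "1 \<le> 2 * exp decay * (1 - exp (- (decay / s) * active f B)) + 1 - real 0 / real m"
      using concave_nonneg [OF active_nonneg [of f B]] by simp
    then have "S * 1 \<le> S * (2 * exp decay * (1 - exp (- (decay / s) * active f B)) + 1 - real 0 / real m)"
      using S0 by (intro mult_left_mono)
    then show ?case
      using late [of 0 f B] 0 by simp
  next
    case (Suc i)
    let ?V = "\<lambda>i x. 2 * exp decay * (1 - exp (- (decay / s) * x)) + 1 - real i / real m"
    note g = Suc.prems(2)
    have frac: "real (Suc i) / real m \<le> 1"
      using Suc.prems(1) mpos by (simp add: divide_le_eq)
    show ?case
    proof (cases "\<exists>u\<in>B. f u > 0")
      case False
      then have "measure_pmf.prob (law n f p) {P. k \<le> card (reach P B)} = 0"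
        using g Suc.prems(3) by (intro prob_law_isolated) (auto simp: good_def)
      moreover have "0 \<le> 2 * exp decay * (1 - exp (- (decay / s) * active f B))"
        by (rule concave_nonneg [OF active_nonneg])
      ultimately show ?thesis
        using S0 frac by simp
    next
      case True
      then obtain v where v: "v \<in> B" "f v > 0"
        by blast
      show ?thesis
      proof (cases "active f B \<ge> s")
        case True
        have "decay \<le> decay / s * active f B"
          using True decay_ge_1 s_pos by (simp add: le_divide_eq mult_left_mono)
        then have "exp (- (decay / s) * active f B) \<le> exp (- decay)"
          by simp
        then have "2 * exp decay * (1 - exp (- decay)) \<le> 2 * exp decay * (1 - exp (- (decay / s) * active f B))"
          by (intro mult_left_mono) auto
        \<comment> \<open>The factor \<open>2 * exp decay\<close> normalises the potential: at
          height \<open>s\<close> it is at least 1 without help from the clock term.\<close>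
        moreover have "2 * exp decay * (1 - exp (- decay)) \<ge> 1"
        proof -
          have "exp decay \<ge> 2"
            using exp_ge_add_one_self [of decay] decay_ge_1 by linarith
          moreover have "exp decay * exp (- decay) = 1"
            by (simp add: exp_minus)
          ultimately show ?thesis
            by (simp add: right_diff_distrib mult.assoc)
        qed
        ultimately have "S * 1 \<le> S * ?V (Suc i) (active f B)"
          using frac S0 by (intro mult_left_mono) linarith+
        then show ?thesis
          using late [OF Suc.prems] by linarith
      next
        case False
        have g': "good (real n / 16) (Suc (J + i)) f B"
          using g by simp
        interpret exploration n d f p v B
          using good_exploration [OF g v] .
        let ?x = "active f B"
        have "measure_pmf.prob (law n f p) {P. k \<le> card (reach P B)}
            \<le> measure_pmf.expectation \<mu> (\<lambda>z. S * ?V i (?x + incr z))"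
        proof (rule explore_one_step [OF g' v])
          fix z assume z: "z \<in> set_pmf \<mu>"
          have "card (B \<union> snd z) \<le> card B + d"
            using card_Un_le [of B "snd z"] step_cards [OF z] by linarith
          \<comment> \<open>A jump from below \<open>s\<close> overshoots by at most
            \<open>2 * d\<^sup>2\<close>, hence the slack in the height hypothesis.\<close>
          then show "measure_pmf.prob (law n (residual f v (fst z)) p) {P. k \<le> card (reach P (B \<union> snd z))}
              \<le> S * ?V i (?x + incr z)"
            unfolding active_step [OF z, symmetric]
            using Suc.prems False abs_incr_le [OF z] active_step [OF z]
            by (intro Suc.IH good_step [OF g' v z]) auto
        qed
        also have "\<dots> = S * (2 * exp decay * (1 - exp (- (decay / s) * ?x)
            * measure_pmf.expectation \<mu> (\<lambda>z. exp (- (decay / s) * incr z))) + 1 - real i / real m)"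
          unfolding distrib_left [of "- (decay / s)"] exp_add by (simp add: integrable_step)
        also have "\<dots> \<le> S * ?V (Suc i) ?x"
        proof (intro mult_left_mono S0)
          \<comment> \<open>Below \<open>s\<close> the potential loses at least
            \<open>2 / s\<^sup>2\<close> in mean, which pays for one tick \<open>1 / m\<close> of
            the clock because \<open>m \<ge> s\<^sup>2 / 2\<close>.\<close>
          have "exp (- (decay / s) * ?x) * (1 + 1 / s\<^sup>2)
              \<le> exp (- (decay / s) * ?x) * measure_pmf.expectation \<mu> (\<lambda>z. exp (- (decay / s) * incr z))"
            using mean_exp_decay [OF g v _ s] by (intro mult_left_mono) auto
          moreover have "exp (- decay) \<le> exp (- (decay / s) * ?x)"
          proof -
            have "decay / s * ?x \<le> decay / s * s"
              using False b by (intro mult_left_mono) auto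
            then show ?thesis
              using s_pos by simp
          qed
          then have "exp (- decay) * (1 / s\<^sup>2) \<le> exp (- (decay / s) * ?x) * (1 / s\<^sup>2)"
            by (intro mult_right_mono) auto
          ultimately have "1 - exp (- (decay / s) * ?x) * measure_pmf.expectation \<mu> (\<lambda>z. exp (- (decay / s) * incr z))
              \<le> 1 - exp (- (decay / s) * ?x) - exp (- decay) * (1 / s\<^sup>2)"
            by (simp add: ring_distribs)
          then have "2 * exp decay * (1 - exp (- (decay / s) * ?x) * measure_pmf.expectation \<mu> (\<lambda>z. exp (- (decay / s) * incr z)))
              \<le> 2 * exp decay * (1 - exp (- (decay / s) * ?x) - exp (- decay) * (1 / s\<^sup>2))"
            by (intro mult_left_mono) auto
          also have "\<dots> = 2 * exp decay * (1 - exp (- (decay / s) * ?x)) - 2 / s\<^sup>2"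
            by (simp add: right_diff_distrib exp_minus)
          finally have "2 * exp decay * (1 - exp (- (decay / s) * ?x) * measure_pmf.expectation \<mu> (\<lambda>z. exp (- (decay / s) * incr z)))
              \<le> 2 * exp decay * (1 - exp (- (decay / s) * ?x)) - 2 / s\<^sup>2" .
          moreover have "1 / real m \<le> 2 / s\<^sup>2"
            using m(1) mpos s_pos by (simp add: field_simps)
          moreover have "real (Suc i) / real m = real i / real m + 1 / real m"
            by (simp add: add_divide_distrib)
          ultimately show "2 * exp decay * (1 - exp (- (decay / s) * ?x)
              * measure_pmf.expectation \<mu> (\<lambda>z. exp (- (decay / s) * incr z))) + 1 - real i / real m \<le> ?V (Suc i) ?x"
            by linarith
        qed
        finally show ?thesis .
      qed
    qed
  qed
qed

end

section \<open>Choice of parameters for the cluster of a single vertex\<close>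

context critical_window
begin

lemma s_ge_72: "s \<ge> 72"
proof -
  have "3 ^ 2 \<le> real d ^ 2"
    using d by (intro power_mono) auto
  then show ?thesis
    using s_ge by simp
qed

lemma good_initial:
  assumes "v < n" "deg_graphs n (\<lambda>_. d) \<noteq> {}" "real d + 2 * real d ^ 2 * real j \<le> \<rho>"
    "3 * real d ^ 3 * real j \<le> \<rho>" "2 * real j + 2 * (real d + 1) \<le> real n / 2"
  shows "good \<rho> j (\<lambda>_. d) {v}"
proof -
  have "real d * (2 * real j + 2 * (real d + 1)) \<le> real d * (real n / 2)"
    using assms by (intro mult_left_mono) auto
  then show ?thesis
    using assms by (auto simp: good_def active_def deficit_def total_def algebra_simps)
qed

text \<open>With \<open>j \<ge> r / 2\<close> and \<open>r \<ge> 4\<close> the sum of all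
  \<open>i < j\<close> is at least \<open>r\<^sup>2 / 16\<close>, so the gain is quadratic in the
  horizon while the costs are linear.\<close>

lemma log_weight_le:
  assumes \<alpha>: "0 < \<alpha>" and r: "2 \<le> r / 2" "r / 2 \<le> real j" "real j \<le> r"
  shows "log_weight \<alpha> j
    \<le> r * (\<alpha> * real d * (L + 1) / s + (4 * \<alpha> * real d ^ 2)\<^sup>2) - \<alpha> * r\<^sup>2 / (128 * real d ^ 2 * real n)"
proof -
  have sum: "(\<Sum>i<j. real i) = real j * (real j - 1) / 2" for j
    by (induction j) (auto simp: field_simps)
  have "(\<Sum>i<j. kap \<alpha> i) = \<alpha> * (real j * (real j - 1) / 2) / (2 * real d ^ 2 * real n)"
    by (simp only: kap_def sum_divide_distrib [symmetric] sum_distrib_left [symmetric] sum)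
  also have "\<dots> \<ge> \<alpha> * ((r / 2) * (r / 4) / 2) / (2 * real d ^ 2 * real n)"
    using r \<alpha> by (intro divide_right_mono mult_left_mono mult_mono) auto
  also have "\<alpha> * ((r / 2) * (r / 4) / 2) / (2 * real d ^ 2 * real n) / 4 = \<alpha> * r\<^sup>2 / (128 * real d ^ 2 * real n)"
    by (simp add: power2_eq_square)
  moreover have "real j * (\<alpha> * real d * (L + 1) / s + (4 * \<alpha> * real d ^ 2)\<^sup>2)
      \<le> r * (\<alpha> * real d * (L + 1) / s + (4 * \<alpha> * real d ^ 2)\<^sup>2)"
    using r \<alpha> L s_pos by (intro mult_right_mono) auto
  ultimately show ?thesis
    unfolding log_weight_def by simp
qed

text \<open>The horizon is \<open>r = \<epsilon> * A * s\<^sup>2\<close> and the exponential rate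
  \<open>\<alpha> = \<eta> * A / s\<close>. The second-order cost is then
  \<open>2 * c * A ^ 3\<close> and the gain from the deficit \<open>4 * c * A ^ 3\<close>; \<eta> is
  chosen for this ratio. Half of the surplus absorbs the terms of order \<open>A\<^sup>2\<close>, by
  the third condition on \<open>A\<close>. The size of \<epsilon> keeps \<open>r\<close> steps
  within \<open>good\<close> for \<open>\<rho> = n / 16\<close> and the number of discovered
  vertices below \<open>A * s\<^sup>2\<close>.\<close>

lemma large_cluster_bound:
  fixes A \<epsilon> \<eta> c :: real
  assumes v: "v < n" and ne: "deg_graphs n (\<lambda>_. d) \<noteq> {}" and s: "s \<ge> decay * real d ^ 2"
    and \<epsilon>: "\<epsilon> = 1 / (96 * real d ^ 3)" and \<eta>: "\<eta> = \<epsilon> / (4096 * real d ^ 6)"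
    and c: "c = \<eta> * \<epsilon>\<^sup>2 / (512 * real d ^ 2)"
    and A: "1 \<le> A" "8 \<le> \<epsilon> * A" "2 * \<eta> + \<epsilon> * \<eta> * real d * (L + 1) \<le> c * A" "A \<le> s"
  shows "measure_pmf.prob (law n (\<lambda>_. d) p) {P. A * s\<^sup>2 \<le> real (card (component P v))}
    \<le> 2 * exp decay * decay * real d / s * exp (- c * A ^ 3)"
proof -
  have d0: "real d > 0" "real d \<ge> 3"
    using d by auto
  have d3: "real d ^ 3 \<ge> 1" "real d ^ 6 \<ge> real d ^ 2" "real d ^ 2 \<ge> 1" "real d ^ 3 \<ge> real d"
    using d power_increasing [of 2 6 "real d"] power_increasing [of 1 3 "real d"] by auto
  have \<epsilon>0: "\<epsilon> > 0" and \<epsilon>1: "\<epsilon> \<le> 1 / 96"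
    using d0 d3 by (auto simp: \<epsilon> field_simps)
  have \<eta>0: "\<eta> > 0"
    using \<epsilon>0 d0 by (simp add: \<eta>)
  define r where "r = \<epsilon> * A * s\<^sup>2"
  define k where "k = nat \<lfloor>r\<rfloor>"
  \<comment> \<open>The first \<open>m\<close> steps belong to the climb towards height
    \<open>s\<close>; at least \<open>r / 2\<close> steps remain afterwards for the exponential
    bound.\<close>
  define m where "m = nat \<lceil>s\<^sup>2 / 2\<rceil>"
  define \<alpha> where "\<alpha> = \<eta> * A / s"
  have s2: "s\<^sup>2 \<ge> 1"
    using s_ge_72 by (simp add: one_le_power)
  have r8: "r \<ge> 8 * s\<^sup>2"
    unfolding r_def using A by (intro mult_right_mono) auto
  have rn: "r \<le> \<epsilon> * real n"
  proof -
    have "\<epsilon> * A * s\<^sup>2 \<le> \<epsilon> * s * s\<^sup>2"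
      using A \<epsilon>0 by (intro mult_right_mono mult_left_mono) auto
    then show ?thesis
      by (simp add: r_def n_eq power2_eq_square power3_eq_cube)
  qed
  have k: "real k \<le> r" "r - 1 \<le> real k"
    using r8 s2 unfolding k_def by linarith+
  have m: "s\<^sup>2 / 2 \<le> real m" "real m \<le> s\<^sup>2 / 2 + 1"
    using zero_le_power2 [of s] unfolding m_def by linarith+
  have mk: "m \<le> k" and J: "r / 2 \<le> real (k - m)"
  proof -
    have "real m \<le> real k"
      using m k r8 s2 by linarith
    then show "m \<le> k"
      by simp
    then show "r / 2 \<le> real (k - m)"
      using m k r8 s2 by (simp add: of_nat_diff)
  qed
  have dk: "real d ^ 3 * real k \<le> real n / 96"
  proof -
    have "real d ^ 3 * real k \<le> real d ^ 3 * (\<epsilon> * real n)"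
      using k rn by (intro mult_left_mono) auto
    then show ?thesis
      using d0 by (simp add: \<epsilon>)
  qed
  have k_le: "real k \<le> real n / 96"
    using dk mult_right_mono [OF d3(1), of "real k"] by simp
  have dn: "2 * (real d + 1) \<le> real n / 96"
  proof -
    have "real d \<le> real d ^ 2"
      using d0 by (simp add: power2_eq_square)
    then have "real d + 1 \<le> s"
      using s_ge d3 by linarith
    have sq: "72\<^sup>2 * s \<le> s\<^sup>2 * s"
      using s_ge_72 by (intro mult_right_mono power_mono) auto
    have "5184 * s \<le> s ^ 3"
      using sq by (simp add: power2_eq_square power3_eq_cube del: mult_le_cancel_right)
    then have "(5184 * s) / 96 \<le> s ^ 3 / 96"
      by (intro divide_right_mono) auto
    moreover have "2 * (real d + 1) \<le> (5184 * s) / 96"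
      using \<open>real d + 1 \<le> s\<close> s_pos by simp
    ultimately show ?thesis
      unfolding n_eq by (rule order_trans [rotated])
  qed
  have g: "good (real n / 16) k (\<lambda>_. d) {v}"
  proof (rule good_initial [OF v ne])
    have "real d ^ 2 * real k \<le> real d ^ 3 * real k"
      using d by (intro mult_right_mono power_increasing) auto
    then show "real d + 2 * real d ^ 2 * real k \<le> real n / 16"
      using dk dn n_pos by argo
    show "3 * real d ^ 3 * real k \<le> real n / 16"
      using dk n_pos by linarith
    show "2 * real k + 2 * (real d + 1) \<le> real n / 2"
      using k_le dn n_pos by argo
  qed
  have \<alpha>0: "0 < \<alpha>"
    using \<eta>0 A s_pos by (simp add: \<alpha>_def)
  have \<alpha>1: "4 * \<alpha> * real d ^ 2 \<le> 1"
  proof -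
    have "\<alpha> \<le> \<eta>"
      using A \<eta>0 s_pos by (simp add: \<alpha>_def divide_le_eq)
    then have "4 * \<alpha> * real d ^ 2 \<le> 4 * \<eta> * real d ^ 6"
      using d3 \<alpha>0 by (intro mult_mono) auto
    also have "\<dots> = \<epsilon> / 1024"
      using d0 by (simp add: \<eta>)
    finally show ?thesis
      using \<epsilon>1 by linarith
  qed
  have S: "exp (\<alpha> * (s + 2 * real d ^ 2) + log_weight \<alpha> j) \<le> exp (- c * A ^ 3)"
    if "k - m \<le> j" "j \<le> k - m + m" for j
  proof -
    have "log_weight \<alpha> j
        \<le> r * (\<alpha> * real d * (L + 1) / s + (4 * \<alpha> * real d ^ 2)\<^sup>2) - \<alpha> * r\<^sup>2 / (128 * real d ^ 2 * real n)"
    proof (rule log_weight_le [OF \<alpha>0])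
      show "2 \<le> r / 2"
        using r8 s2 by linarith
      have "real (k - m) \<le> real j" "real j \<le> real k"
        using that mk by simp_all
      then show "r / 2 \<le> real j" "real j \<le> r"
        using J k by linarith+
    qed
    also have "\<dots> = \<epsilon> * \<eta> * real d * (L + 1) * A\<^sup>2 - 2 * c * A ^ 3"
    proof -
      have 1: "r * (\<alpha> * real d * (L + 1) / s) = \<epsilon> * \<eta> * real d * (L + 1) * A\<^sup>2"
        using s_pos by (simp add: r_def \<alpha>_def power2_eq_square)
      have "r * (4 * \<alpha> * real d ^ 2)\<^sup>2 = 16 * \<epsilon> * \<eta>\<^sup>2 * real d ^ 4 * A ^ 3"
        using s_pos by (simp add: r_def \<alpha>_def power2_eq_square power3_eq_cube power4_eq_xxxx)
      also have "\<dots> = 16 * \<epsilon> * \<eta> * (\<epsilon> / (4096 * real d ^ 6)) * real d ^ 4 * A ^ 3"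
        by (simp add: power2_eq_square \<eta>)
      also have "\<dots> = 2 * c * A ^ 3"
      proof -
        have "real d ^ 6 = real d ^ 4 * real d ^ 2"
          by (simp flip: power_add)
        then show ?thesis
          using d0 by (simp add: c power2_eq_square)
      qed
      finally have 2: "r * (4 * \<alpha> * real d ^ 2)\<^sup>2 = 2 * c * A ^ 3" .
      have 3: "\<alpha> * r\<^sup>2 / (128 * real d ^ 2 * real n) = 4 * c * A ^ 3"
        using s_pos d0 by (simp add: r_def \<alpha>_def c n_eq power2_eq_square power3_eq_cube)
      show ?thesis
        using 1 2 3 by (simp add: ring_distribs)
    qed
    finally have "log_weight \<alpha> j \<le> \<epsilon> * \<eta> * real d * (L + 1) * A\<^sup>2 - 2 * c * A ^ 3" .
    moreover have "\<alpha> * (s + 2 * real d ^ 2) \<le> 2 * \<eta> * A\<^sup>2"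
    proof -
      have "\<alpha> * (s + 2 * real d ^ 2) \<le> \<alpha> * (2 * s)"
      proof (intro mult_left_mono)
        have "0 \<le> real d ^ 2"
          by simp
        then show "s + 2 * real d ^ 2 \<le> 2 * s"
          using s_ge by linarith
      qed (use \<alpha>0 in auto)
      also have "\<dots> = 2 * \<eta> * (A * 1)"
        using s_pos by (simp add: \<alpha>_def)
      also have "\<dots> \<le> 2 * \<eta> * (A * A)"
        using A \<eta>0 by (intro mult_left_mono) auto
      finally show ?thesis
        by (simp add: power2_eq_square)
    qed
    moreover have "(2 * \<eta> + \<epsilon> * \<eta> * real d * (L + 1)) * A\<^sup>2 \<le> c * A * A\<^sup>2"
      using A by (intro mult_right_mono) auto
    ultimately have "\<alpha> * (s + 2 * real d ^ 2) + log_weight \<alpha> j \<le> - c * A ^ 3"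
      by (simp add: ring_distribs power2_eq_square power3_eq_cube)
    then show ?thesis
      by simp
  qed
  have "measure_pmf.prob (law n (\<lambda>_. d) p) {P. nat \<lceil>A * s\<^sup>2\<rceil> \<le> card (reach P {v})}
      \<le> exp (- c * A ^ 3) * (2 * exp decay * (1 - exp (- (decay / s) * active (\<lambda>_. d) {v})) + 1 - real m / real m)"
  proof (rule survival_two_phase_bound [OF \<alpha>0 \<alpha>1 s m(1) _ S])
    show "k - m + m \<le> n"
      using mk k_le n_pos by simp
    show "good (real n / 16) (k - m + m) (\<lambda>_. d) {v}"
      using g mk by simp
    have "real d * real k \<le> real d * r"
      using k by (intro mult_left_mono) auto
    also have "\<dots> = (real d / real d ^ 3) * (A * s\<^sup>2) / 96"
      by (simp add: r_def \<epsilon>)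
    also have "\<dots> \<le> 1 * (A * s\<^sup>2) / 96"
      using d3 d0 A by (intro divide_right_mono mult_right_mono) auto
    finally have "real d * real k \<le> A * s\<^sup>2 / 96"
      by simp
    moreover have "2 \<le> A * s\<^sup>2"
    proof -
      have "72 * 72 \<le> s * s"
        using s_ge_72 by (intro mult_mono) auto
      then have "1 * 2 \<le> A * s\<^sup>2"
        using A by (intro mult_mono) (auto simp: power2_eq_square)
      then show ?thesis
        by simp
    qed
    ultimately have "1 + real d * real k < A * s\<^sup>2"
      by linarith
    then have "real (1 + d * k) < A * s\<^sup>2"
      by simp
    then have "1 + d * k < nat \<lceil>A * s\<^sup>2\<rceil>"
      by linarith
    then show "card {v} + d * (k - m + m) < nat \<lceil>A * s\<^sup>2\<rceil>"
      using mk by simp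
    show "active (\<lambda>_. d) {v} \<le> s + 2 * real d ^ 2"
      using d0 s_pos by (simp add: active_def power2_eq_square add_increasing)
  qed auto
  \<comment> \<open>With all \<open>m\<close> ticks left the clock cancels the constant 1, and only
    the potential at the starting height \<open>d\<close> remains, which is of order
    \<open>d / s\<close>.\<close>
  also have "real m / real m = 1"
    using m s2 by auto
  also have "exp (- c * A ^ 3) * (2 * exp decay * (1 - exp (- (decay / s) * active (\<lambda>_. d) {v})) + 1 - 1)
      \<le> exp (- c * A ^ 3) * (2 * exp decay * (decay / s * real d))"
  proof -
    have "1 - exp (- (decay / s) * active (\<lambda>_. d) {v}) \<le> decay / s * real d"
      using exp_ge_add_one_self [of "- (decay / s) * real d"] by (simp add: active_def)
    then have "2 * exp decay * (1 - exp (- (decay / s) * active (\<lambda>_. d) {v}))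
        \<le> 2 * exp decay * (decay / s * real d)"
      by (rule mult_left_mono) auto
    then have "2 * exp decay * (1 - exp (- (decay / s) * active (\<lambda>_. d) {v})) + 1 - 1
        \<le> 2 * exp decay * (decay / s * real d)"
      by linarith
    then show ?thesis
      by (intro mult_left_mono) auto
  qed
  also have "{P. nat \<lceil>A * s\<^sup>2\<rceil> \<le> card (reach P {v})} = {P. A * s\<^sup>2 \<le> real (card (component P v))}"
    by (auto simp: reach_def nat_le_iff ceiling_le_iff)
  finally show ?thesis
    by (simp add: mult_ac)
qed

end

section \<open>Lower tail\<close>

lemma reach_bounded:
  assumes "P \<in> simple_graphs n" "B \<subseteq> {..<n}"
  shows "reach P B \<subseteq> {..<n}"
  using assms simple_graphs_edge by (intro reach_subset_closed) blast+

lemma set_pmf_law_simple: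
  assumes "deg_graphs n f \<noteq> {}" "P \<in> set_pmf (law n f p)"
  shows "P \<in> simple_graphs n"
proof -
  from assms obtain G where G: "G \<in> deg_graphs n f" "P \<in> set_pmf (percolation p G)"
    by (auto simp: law_def finite_deg_graphs)
  then show ?thesis
    using set_pmf_percolation [OF G(2)] by (auto simp: deg_graphs_def simple_graphs_def)
qed

text \<open>\<open>P\<close> is only the unexplored part, so the component under exploration is seen
  through \<open>reach P B\<close>; the last clause is kept for restarts. Membership in
  \<open>simple_graphs\<close> guarantees finiteness: an infinite set would have \<open>card\<close>
  0 and count as small.\<close>

definition small_clusters :: "nat \<Rightarrow> nat \<Rightarrow> nat set \<Rightarrow> nat set set \<Rightarrow> bool" where
  "small_clusters n k B P \<longleftrightarrow>
     P \<in> simple_graphs n \<and> card (reach P B) < k \<and> (\<forall>v<n. card (component P v) < k)"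

text \<open>Dropping the star edges only shrinks components, so smallness is inherited by the
  unexplored part.\<close>

lemma small_clusters_explore:
  assumes "u \<in> B" "small_clusters n k B (star u R \<union> P)"
  shows "small_clusters n k (B \<union> R) P"
proof -
  have S: "star u R \<union> P \<in> simple_graphs n"
    using assms by (simp add: small_clusters_def)
  have "card (component P v) \<le> card (component (star u R \<union> P) v)" if "v < n" for v
  proof (intro card_mono component_mono)
    have "component (star u R \<union> P) v \<subseteq> {..<n}"
      using reach_bounded [OF S, of "{v}"] that by (simp add: reach_def)
    then show "finite (component (star u R \<union> P) v)"
      by (rule finite_subset) simp
  qed auto
  then have "\<forall>v<n. card (component P v) < k"
    using assms by (meson le_less_trans small_clusters_def)
  moreover have "P \<in> simple_graphs n"
    using S by (simp add: simple_graphs_def)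
  ultimately show ?thesis
    using assms unfolding small_clusters_def reach_explore [OF assms(1)] by simp
qed

lemma small_clusters_restart:
  "small_clusters n k B P \<Longrightarrow> v < n \<Longrightarrow> small_clusters n k {v} P"
  by (auto simp: small_clusters_def reach_def)

text \<open>As \<open>a \<le> max 0 a\<close>, the positive part of \<open>a - x\<close> is at most
  \<open>\<bar>max 0 a - x\<bar>\<close>. With \<open>a = h - X\<close> this bounds the squared
  shortfall below \<open>h\<close> after a step by a quadratic polynomial in the increment.\<close>

lemma max_zero_sq_le: "(max 0 (a - x))\<^sup>2 \<le> (max 0 a)\<^sup>2 - 2 * max 0 a * x + x\<^sup>2" for a x :: real
proof -
  have "(max 0 (a - x))\<^sup>2 \<le> (max 0 a - x)\<^sup>2"
    by (rule abs_le_square_iff [THEN iffD1]) auto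
  then show ?thesis
    by (simp add: power2_diff algebra_simps)
qed

context critical_window
begin

text \<open>\<open>spread / s\<close> bounds the drift in both directions:
  \<open>36 * d ^ 3 / s\<close> is \<open>3 * \<rho> / n\<close> for
  \<open>\<rho> = 12 * d ^ 3 * s\<^sup>2\<close>.\<close>

definition spread :: real where
  "spread = real d * (L + 36 * real d ^ 3)"

context
  fixes \<rho> :: real
  assumes \<rho>: "\<rho> = 12 * real d ^ 3 * s\<^sup>2" and \<rho>_le: "\<rho> \<le> real n / 16"
begin

lemma abs_mean_incr_le:
  assumes "good \<rho> j f B" "v \<in> B" "f v > 0"
  shows "\<bar>measure_pmf.expectation (step n f p v) (exploration.incr n f v B)\<bar> \<le> spread / s"
proof -
  have "3 * \<rho> / real n = 36 * real d ^ 3 / s"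
    using s_pos by (simp add: \<rho> n_eq power2_eq_square power3_eq_cube)
  then have "- (spread / s) \<le> measure_pmf.expectation (step n f p v) (exploration.incr n f v B)"
    using mean_incr_ge [OF assms \<rho>_le] by (simp add: spread_def add_divide_distrib ring_distribs)
  moreover have "real d * (L + 1) / s \<le> spread / s"
  proof -
    have "1 \<le> real d ^ 3"
      using d by (simp add: one_le_power)
    then show ?thesis
      unfolding spread_def using s_pos by (intro divide_right_mono mult_left_mono) auto
  qed
  ultimately show ?thesis
    using mean_incr_le' [OF assms \<rho>_le] by linarith
qed

text \<open>The squared shortfall of \<open>active\<close> below \<open>h\<close> grows in mean by a
  bounded amount per step and equals \<open>h\<^sup>2\<close> when the exploration dies, so dying
  early has a Markov-type bound. Every explored vertex has degree 0 and each step adds one, so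
  surviving the remaining \<open>j\<close> steps yields \<open>k\<close> vertices.\<close>

lemma persistence_bound:
  assumes h: "0 < h" "h \<le> s"
  shows "good \<rho> j f B \<Longrightarrow> k \<le> card {w \<in> B. f w = 0} + j \<Longrightarrow>
    measure_pmf.prob (law n f p) {P. P \<in> simple_graphs n \<and> card (reach P B) < k}
      \<le> ((max 0 (h - active f B))\<^sup>2 + (2 * spread + 4 * real d ^ 4) * real j) / h\<^sup>2"
proof (induction j arbitrary: f B)
  case 0
  have B: "B \<subseteq> {..<n}" "finite B"
    using 0(1) good_finite [OF 0(1)] by (simp_all add: good_def)
  have "k \<le> card (reach P B)" if "P \<in> simple_graphs n" for P
  proof -
    have "k \<le> card B"
      using 0(2) B card_mono [of B "{w \<in> B. f w = 0}"] by auto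
    also have "\<dots> \<le> card (reach P B)"
      using reach_bounded [OF that B(1)] by (intro card_mono reach_superset) (auto intro: finite_subset)
    finally show ?thesis .
  qed
  then have empty: "{P. P \<in> simple_graphs n \<and> card (reach P B) < k} = {}"
    by (auto simp: not_less)
  show ?case
    unfolding empty by simp
next
  case (Suc j)
  note g = Suc.prems(1)
  let ?c = "2 * spread + 4 * real d ^ 4"
  have spread0: "spread \<ge> 0"
    using L by (simp add: spread_def)
  show ?case
  proof (cases "\<exists>u\<in>B. f u > 0")
    case False
    then have "active f B = 0"
      by (auto simp: active_def intro!: sum.neutral)
    then have "1 \<le> ((max 0 (h - active f B))\<^sup>2 + ?c * real (Suc j)) / h\<^sup>2"
      using h spread0 by (simp add: field_simps)
    then show ?thesis
      using measure_pmf.prob_le_1 order_trans by blast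
  next
    case True
    then obtain v where v: "v \<in> B" "f v > 0"
      by blast
    interpret exploration n d f p v B
      using good_exploration [OF g v] .
    let ?m = "max 0 (h - active f B)"
    let ?\<Phi> = "\<lambda>z. (?m\<^sup>2 - 2 * ?m * incr z + (incr z)\<^sup>2 + ?c * real j) / h\<^sup>2"
    have "measure_pmf.prob (law n f p) {P. P \<in> simple_graphs n \<and> card (reach P B) < k}
        \<le> measure_pmf.expectation \<mu> ?\<Phi>"
    proof (rule prob_law_step_le [OF ne u])
      fix A R assume z: "(A, R) \<in> set_pmf \<mu>"
      have "measure_pmf.prob (law n (residual f v A) p) {P. star v R \<union> P \<in> {P. P \<in> simple_graphs n \<and> card (reach P B) < k}}
          \<le> measure_pmf.prob (law n (residual f v A) p) {P. P \<in> simple_graphs n \<and> card (reach P (B \<union> R)) < k}"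
        by (intro measure_pmf.finite_measure_mono) (auto simp: reach_explore [OF uB] simple_graphs_def)
      also have "\<dots> \<le> ((max 0 (h - active (residual f v A) (B \<union> R)))\<^sup>2 + ?c * real j) / h\<^sup>2"
      proof (rule Suc.IH)
        show "good \<rho> j (residual f v A) (B \<union> R)"
          using good_step [OF g v z] by simp
        have "Suc (card {w \<in> B. f w = 0}) = card (insert v {w \<in> B. f w = 0})"
          using v finite_B by simp
        also have "\<dots> \<le> card {w \<in> B \<union> R. residual f v A w = 0}"
          using v finite_B step_cards [OF z] by (intro card_mono) (auto simp: residual_def)
        finally show "k \<le> card {w \<in> B \<union> R. residual f v A w = 0} + j"
          using Suc.prems(2) by linarith
      qed
      also have "\<dots> \<le> ?\<Phi> (A, R)"
        using active_step [OF z] max_zero_sq_le [of "h - active f B" "incr (A, R)"]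
        by (intro divide_right_mono add_right_mono) (simp_all add: algebra_simps)
      finally show "measure_pmf.prob (law n (residual f v A) p) {P. star v R \<union> P \<in> {P. P \<in> simple_graphs n \<and> card (reach P B) < k}}
          \<le> ?\<Phi> (A, R)" .
    qed
    also have "\<dots> = (?m\<^sup>2 - 2 * ?m * measure_pmf.expectation \<mu> incr + measure_pmf.expectation \<mu> (\<lambda>z. (incr z)\<^sup>2)
        + ?c * real j) / h\<^sup>2"
      by (simp add: integrable_step)
    also have "\<dots> \<le> (?m\<^sup>2 + ?c * real (Suc j)) / h\<^sup>2"
    proof (intro divide_right_mono)
      \<comment> \<open>The shortfall is at most \<open>h \<le> s\<close>, which compensates the
        factor \<open>1 / s\<close> in the drift.\<close>
      have "- 2 * ?m * measure_pmf.expectation \<mu> incr \<le> 2 * spread"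
      proof -
        have "?m * - measure_pmf.expectation \<mu> incr \<le> s * (spread / s)"
          using abs_mean_incr_le [OF g v] h active_nonneg [of f B] spread0 s_pos
          by (intro order_trans [OF mult_left_mono mult_right_mono, of _ "spread / s"]) auto
        then show ?thesis
          using s_pos by simp
      qed
      moreover have "measure_pmf.expectation \<mu> (\<lambda>z. (incr z)\<^sup>2) \<le> measure_pmf.expectation \<mu> (\<lambda>z. 4 * real d ^ 4)"
      proof (rule expectation_mono)
        fix z assume z: "z \<in> set_pmf \<mu>"
        have "(incr z)\<^sup>2 \<le> (2 * real d ^ 2)\<^sup>2"
          using abs_incr_le [OF z] by (intro abs_le_square_iff [THEN iffD1]) auto
        then show "(incr z)\<^sup>2 \<le> 4 * real d ^ 4"
          by (simp add: power_mult_distrib flip: power_mult)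
      qed
      ultimately show "?m\<^sup>2 - 2 * ?m * measure_pmf.expectation \<mu> incr + measure_pmf.expectation \<mu> (\<lambda>z. (incr z)\<^sup>2) + ?c * real j
          \<le> ?m\<^sup>2 + ?c * real (Suc j)"
        by (simp add: algebra_simps)
    qed auto
    finally show ?thesis .
  qed
qed

lemma good_mono:
  assumes "good \<rho> j f B" "i \<le> j"
  shows "good \<rho> i f B"
proof -
  have "2 * real d * real i \<le> 2 * real d * real j" "2 * real d ^ 2 * real i \<le> 2 * real d ^ 2 * real j"
    "3 * real d ^ 3 * real i \<le> 3 * real d ^ 3 * real j"
    using assms(2) by (auto intro!: mult_left_mono)
  then show ?thesis
    using assms(1) unfolding good_def by auto
qed

text \<open>Exhausted vertices have degree 0 and carry no weight, so exchanging \<open>B\<close> for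
  a fresh vertex does not raise the deficit. The lower bound on \<open>total\<close> leaves some
  vertex with half-edges.\<close>

lemma good_restart:
  assumes g: "good \<rho> j f B" and B: "\<And>b. b \<in> B \<Longrightarrow> f b = 0" and \<rho>d: "real d + 2 * real d ^ 2 * real j \<le> \<rho>"
  obtains v where "v < n" "f v > 0" "good \<rho> j f {v}"
proof -
  have "real d * real n / 2 > 0" "2 * real d * (real d + 1) > 0" "2 * real d * real j \<ge> 0"
    using d n_pos by simp_all
  then have "total n f > 0"
    using g unfolding good_def by linarith
  then obtain v where v: "v < n" "f v > 0"
    unfolding total_def by (metis (no_types, lifting) gr_zeroI lessThan_iff less_irrefl of_nat_0 sum.neutral)
  have f_le: "\<And>w. w < n \<Longrightarrow> f w \<le> d"
    using g by (simp add: good_def)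
  have "deficit n d f {v} \<le> deficit n d f B"
  proof -
    have "deficit n d f {v} \<le> (\<Sum>w<n. real (f w) * (real d - real (f w)))"
      unfolding deficit_def using f_le by (intro sum_mono2) auto
    also have "\<dots> = deficit n d f B"
      unfolding deficit_def using B by (intro sum.mono_neutral_right) auto
    finally show ?thesis .
  qed
  then have "good \<rho> j f {v}"
    using g v f_le [OF v(1)] \<rho>d by (auto simp: good_def active_def)
  with v show thesis
    by (rule that)
qed

text \<open>The exploration goes through one component after the other. Until it reaches height \<open>h\<close> the
  square of the number of active half-edges has positive drift, so \<open>h\<close> is reached within \<open>N\<close> steps;
  from there the current component survives for \<open>k\<close> further steps.\<close>

lemma climbing_bound:
  assumes h: "0 < h" "h \<le> s" "4 * h * spread \<le> (1 / 4) ^ d * s" and N: "N > 0"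
    and \<rho>d: "real d + 2 * real d ^ 2 * real (N + k) \<le> \<rho>"
  shows "i \<le> N \<Longrightarrow> good \<rho> (i + k) f B \<Longrightarrow> active f B \<le> h + 2 * real d ^ 2 \<Longrightarrow>
    measure_pmf.prob (law n f p) {P. small_clusters n k B P}
      \<le> ((h + 2 * real d ^ 2)\<^sup>2 - (active f B)\<^sup>2) * 2 / ((1 / 4) ^ d * real N) + 1 - real i / real N
        + (2 * spread + 4 * real d ^ 4) * real k / h\<^sup>2"
proof -
  \<comment> \<open>Below \<open>h\<close>, \<open>X\<^sup>2\<close> gains at least
    \<open>(1 / 4) ^ d / 2\<close> per step in mean, and the scaling turns this into one tick
    \<open>1 / N\<close>. The reference value exceeds \<open>h\<^sup>2\<close> because the last jump
    may overshoot by \<open>2 * d\<^sup>2\<close>.\<close>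
  define V where "V i x = ((h + 2 * real d ^ 2)\<^sup>2 - x\<^sup>2) * 2 / ((1 / 4) ^ d * real N) + 1 - real i / real N" for i x
  define c where "c = (2 * spread + 4 * real d ^ 4) * real k / h\<^sup>2"
  have c0: "c \<ge> 0"
    using L by (simp add: c_def spread_def)
  have V0: "V i x \<ge> 1 - real i / real N" if "0 \<le> x" "x \<le> h + 2 * real d ^ 2" for i x
  proof -
    have "x\<^sup>2 \<le> (h + 2 * real d ^ 2)\<^sup>2"
      using that by (intro power_mono)
    then show ?thesis
      by (simp add: V_def)
  qed
  have "measure_pmf.prob (law n f p) {P. small_clusters n k B P} \<le> V i (active f B) + c"
    if "i \<le> N" "good \<rho> (i + k) f B" "active f B \<le> h + 2 * real d ^ 2" for i f B
    using that
  proof (induction i arbitrary: f B)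
    case 0
    have "1 \<le> V 0 (active f B)"
      using V0 [OF active_nonneg 0(3), of 0] by simp
    then show ?case
      using c0 measure_pmf.prob_le_1 [of "law n f p" "{P. small_clusters n k B P}"] by linarith
  next
    case (Suc i)
    \<comment> \<open>Stated for every \<open>B\<close> with a half-edge left, since it is applied
      both to the current set and, after a restart, to a single vertex; a restart consumes no
      step.\<close>
    have moving: "measure_pmf.prob (law n f p) {P. small_clusters n k B P} \<le> V (Suc i) (active f B) + c"
      if g: "good \<rho> (Suc i + k) f B" and le: "active f B \<le> h + 2 * real d ^ 2" and v: "v \<in> B" "f v > 0" for B v
    proof (cases "active f B \<ge> h")
      case True
      have "measure_pmf.prob (law n f p) {P. small_clusters n k B P}
          \<le> measure_pmf.prob (law n f p) {P. P \<in> simple_graphs n \<and> card (reach P B) < k}"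
        by (intro measure_pmf.finite_measure_mono) (auto simp: small_clusters_def)
      \<comment> \<open>From height \<open>h\<close> on the shortfall starts at 0, and only the
        error of the next \<open>k\<close> steps is left.\<close>
      also have "\<dots> \<le> ((max 0 (h - active f B))\<^sup>2 + (2 * spread + 4 * real d ^ 4) * real k) / h\<^sup>2"
        using good_mono [OF g] by (intro persistence_bound h) auto
      also have "\<dots> = c"
        using True by (simp add: c_def max_def)
      finally have "measure_pmf.prob (law n f p) {P. small_clusters n k B P} \<le> c" .
      moreover have "real (Suc i) / real N \<le> 1"
        using Suc.prems(1) N by (simp add: divide_le_eq)
      ultimately show ?thesis
        using V0 [OF active_nonneg le, of "Suc i"] by linarith
    next
      case False
      have g': "good \<rho> (Suc (i + k)) f B"
        using g by simp
      interpret exploration n d f p v B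
        using good_exploration [OF g v] .
      let ?x = "active f B"
      have "measure_pmf.prob (law n f p) {P. small_clusters n k B P}
          \<le> measure_pmf.expectation \<mu> (\<lambda>z. V i (?x + incr z) + c)"
      proof (rule prob_law_step_le [OF ne u])
        fix A R assume z: "(A, R) \<in> set_pmf \<mu>"
        have "measure_pmf.prob (law n (residual f v A) p) {P. star v R \<union> P \<in> {P. small_clusters n k B P}}
            \<le> measure_pmf.prob (law n (residual f v A) p) {P. small_clusters n k (B \<union> R) P}"
          by (intro measure_pmf.finite_measure_mono) (auto intro: small_clusters_explore [OF uB])
        also have "\<dots> \<le> V i (active (residual f v A) (B \<union> R)) + c"
        proof (rule Suc.IH)
          show "good \<rho> (i + k) (residual f v A) (B \<union> R)"
            using good_step [OF g' v z] by simp
          show "active (residual f v A) (B \<union> R) \<le> h + 2 * real d ^ 2"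
            using active_step [OF z] abs_incr_le [OF z] False by simp
        qed (use Suc.prems in auto)
        finally show "measure_pmf.prob (law n (residual f v A) p) {P. star v R \<union> P \<in> {P. small_clusters n k B P}}
            \<le> V i (?x + incr (A, R)) + c"
          using active_step [OF z] by simp
      qed
      also have "\<dots> = ((h + 2 * real d ^ 2)\<^sup>2 - (?x\<^sup>2 + 2 * ?x * measure_pmf.expectation \<mu> incr
          + measure_pmf.expectation \<mu> (\<lambda>z. (incr z)\<^sup>2))) * 2 / ((1 / 4) ^ d * real N) + 1 - real i / real N + c"
        by (simp add: V_def integrable_step power2_sum mult_ac)
      also have "\<dots> \<le> ((h + 2 * real d ^ 2)\<^sup>2 - (?x\<^sup>2 + (1 / 4) ^ d / 2)) * 2 / ((1 / 4) ^ d * real N) + 1 - real i / real N + c"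
      proof (intro add_right_mono diff_right_mono divide_right_mono mult_right_mono diff_left_mono)
        \<comment> \<open>The third assumption on \<open>h\<close> lets the drift cancel at most
          half of the variance.\<close>
        have "- (2 * ?x * measure_pmf.expectation \<mu> incr) \<le> 2 * (h * (spread / s))"
        proof -
          have "?x * - measure_pmf.expectation \<mu> incr \<le> h * (spread / s)"
            using abs_mean_incr_le [OF g v] False active_nonneg [of f B] L s_pos
            by (intro order_trans [OF mult_left_mono mult_right_mono, of _ "spread / s"]) (auto simp: spread_def)
          then show ?thesis
            by simp
        qed
        also have "\<dots> \<le> (1 / 4) ^ d / 2"
          using h(3) s_pos by (simp add: field_simps)
        finally show "?x\<^sup>2 + (1 / 4) ^ d / 2 \<le> ?x\<^sup>2 + 2 * ?x * measure_pmf.expectation \<mu> incr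
          + measure_pmf.expectation \<mu> (\<lambda>z. (incr z)\<^sup>2)"
          using mean_incr_sq_ge [OF g v \<rho>_le] by linarith
      qed auto
      also have "\<dots> = V (Suc i) ?x + c"
        using N by (simp add: V_def field_simps)
      finally show ?thesis .
    qed
    show ?case
    proof (cases "\<exists>u\<in>B. f u > 0")
      case True
      then show ?thesis
        using moving Suc.prems by blast
    next
      case False
      have "real d + 2 * real d ^ 2 * real (Suc i + k) \<le> real d + 2 * real d ^ 2 * real (N + k)"
        using Suc.prems(1) by (intro add_left_mono mult_left_mono) auto
      then have "real d + 2 * real d ^ 2 * real (Suc i + k) \<le> \<rho>"
        using \<rho>d by linarith
      then obtain v where v: "v < n" "f v > 0" "good \<rho> (Suc i + k) f {v}"
        using good_restart [OF Suc.prems(2)] False by auto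
      have "f v \<le> d"
        using v by (simp add: good_def)
      have "measure_pmf.prob (law n f p) {P. small_clusters n k B P}
          \<le> measure_pmf.prob (law n f p) {P. small_clusters n k {v} P}"
        using v by (intro measure_pmf.finite_measure_mono) (auto intro: small_clusters_restart)
      also have "\<dots> \<le> V (Suc i) (active f {v}) + c"
      proof (rule moving [OF v(3) _ _ v(2)])
        have "real d * 1 \<le> real d * real d"
          using d by (intro mult_left_mono) auto
        then show "active f {v} \<le> h + 2 * real d ^ 2"
          using \<open>f v \<le> d\<close> h(1) by (simp add: active_def power2_eq_square)
      qed simp
      \<comment> \<open>\<open>V\<close> is largest at height 0, where the exhausted
        \<open>B\<close> stands, so restarting higher cannot increase it.\<close>
      also have "V (Suc i) (active f {v}) \<le> V (Suc i) (active f B)"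
      proof -
        have "active f B = 0"
          using False by (auto simp: active_def intro!: sum.neutral)
        then show ?thesis
          by (simp add: V_def divide_right_mono)
      qed
      finally show ?thesis
        by simp
    qed
  qed
  then show "i \<le> N \<Longrightarrow> good \<rho> (i + k) f B \<Longrightarrow> active f B \<le> h + 2 * real d ^ 2 \<Longrightarrow>
    measure_pmf.prob (law n f p) {P. small_clusters n k B P}
      \<le> ((h + 2 * real d ^ 2)\<^sup>2 - (active f B)\<^sup>2) * 2 / ((1 / 4) ^ d * real N) + 1 - real i / real N
        + (2 * spread + 4 * real d ^ 4) * real k / h\<^sup>2"
    unfolding V_def c_def .
qed

end

end

section \<open>The largest component\<close>

lemma component_bounded: "P \<in> simple_graphs n \<Longrightarrow> v < n \<Longrightarrow> component P v \<subseteq> {..<n}"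
  using reach_bounded [of P n "{v}"] by (simp add: reach_def)

lemma finite_component: "P \<in> simple_graphs n \<Longrightarrow> v < n \<Longrightarrow> finite (component P v)"
  by (rule finite_subset [OF component_bounded]) simp_all

lemma component_sym:
  assumes "w \<in> component P v"
  shows "v \<in> component P w"
proof -
  have "sym {(x, y). {x, y} \<in> P}"
    by (auto simp: sym_def insert_commute)
  then show ?thesis
    using assms sym_rtrancl [of "{(x, y). {x, y} \<in> P}"] by (auto simp: component_def dest: symD)
qed

lemma largest_component_size_ge:
  assumes "P \<in> simple_graphs n" "v < n"
  shows "card (component P v) \<le> largest_component_size n P"
  using assms by (auto simp: largest_component_size_def components_def intro!: Max_ge)

lemma largest_component_size_attained:
  assumes "n > 0"
  obtains v where "v < n" "largest_component_size n P = card (component P v)"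
proof -
  have "Max (card ` components n P) \<in> card ` components n P"
    using assms by (intro Max_in) (auto simp: components_def)
  then show thesis
    using that by (auto simp: largest_component_size_def components_def)
qed

text \<open>Every vertex of a component of size at least \<open>x\<close> is counted on the right-hand side.\<close>

lemma largest_component_markov:
  assumes ne: "deg_graphs n f \<noteq> {}" and n: "n > 0"
  shows "x * measure_pmf.prob (law n f p) {P. x \<le> real (largest_component_size n P)}
    \<le> (\<Sum>v<n. measure_pmf.prob (law n f p) {P. x \<le> real (card (component P v))})"
proof -
  let ?M = "law n f p"
  have fin: "finite (set_pmf ?M)"
    by (rule finite_subset [OF _ finite_simple_graphs [of n]]) (auto intro: set_pmf_law_simple [OF ne])
  note int = integrable_measure_pmf_finite [OF fin]
  have "x * measure_pmf.prob ?M {P. x \<le> real (largest_component_size n P)}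
      = measure_pmf.expectation ?M (\<lambda>P. x * indicator {P. x \<le> real (largest_component_size n P)} P)"
    by simp
  also have "\<dots> \<le> measure_pmf.expectation ?M (\<lambda>P. \<Sum>v<n. indicator {P. x \<le> real (card (component P v))} P)"
  proof (intro integral_mono_AE int)
    have "x * indicator {P. x \<le> real (largest_component_size n P)} P
        \<le> (\<Sum>v<n. indicator {P. x \<le> real (card (component P v))} P)" if "P \<in> set_pmf ?M" for P
    proof (cases "x \<le> real (largest_component_size n P)")
      case True
      have S: "P \<in> simple_graphs n"
        using set_pmf_law_simple [OF ne that] .
      obtain v where v: "v < n" "largest_component_size n P = card (component P v)"
        using largest_component_size_attained [OF n] .
      have sub: "component P v \<subseteq> {w. w < n \<and> x \<le> real (card (component P w))}"
      proof
        fix w assume w: "w \<in> component P v"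
        then have wn: "w < n"
          using component_bounded [OF S v(1)] by auto
        have "component P v \<subseteq> component P w"
          using component_sym [OF w] by (intro component_subset_closed) (auto intro: component_step)
        then have "card (component P v) \<le> card (component P w)"
          using finite_component [OF S wn] by (intro card_mono)
        then show "w \<in> {w. w < n \<and> x \<le> real (card (component P w))}"
          using True v wn by auto
      qed
      have "x \<le> real (card (component P v))"
        using True v by simp
      also have "\<dots> \<le> real (card {w. w < n \<and> x \<le> real (card (component P w))})"
        using sub by (intro of_nat_mono card_mono) auto
      also have "\<dots> = (\<Sum>w<n. indicator {P. x \<le> real (card (component P w))} P)"
        by (simp add: indicator_def sum.If_cases Int_def)
      finally show ?thesis
        using True by simp
    next
      case False
      then show ?thesis
        by (simp add: sum_nonneg)
    qed
    then show "AE P in ?M. x * indicator {P. x \<le> real (largest_component_size n P)} P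
        \<le> (\<Sum>v<n. indicator {P. x \<le> real (card (component P v))} P)"
      by (simp add: AE_measure_pmf_iff)
  qed
  also have "\<dots> = (\<Sum>v<n. measure_pmf.prob ?M {P. x \<le> real (card (component P v))})"
    by (simp add: Bochner_Integration.integral_sum int)
  finally show ?thesis .
qed

lemma prob_law_eq_0:
  assumes "deg_graphs n f \<noteq> {}" "\<And>P. P \<in> simple_graphs n \<Longrightarrow> \<not> Q P"
  shows "measure_pmf.prob (law n f p) {P. Q P} = 0"
proof -
  have "AE P in law n f p. P \<notin> {P. Q P}"
    using assms set_pmf_law_simple by (auto simp: AE_measure_pmf_iff)
  then show ?thesis
    by (simp add: measure_pmf.prob_eq_0)
qed

lemma (in critical_window) small_clusters_prob_le:
  assumes ne: "deg_graphs n (\<lambda>_. d) \<noteq> {}" and s: "s \<ge> 192 * real d ^ 3" "s \<ge> 4 * real d ^ 4"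
    and \<delta>: "0 < \<delta>" "\<delta> \<le> 1" "\<delta> * s\<^sup>2 > 1" "4 * spread * \<delta> powr (1/4) \<le> (1 / 4) ^ d"
  shows "measure_pmf.prob (law n (\<lambda>_. d) p) {P. small_clusters n (nat \<lceil>\<delta> * s\<^sup>2\<rceil>) {0} P}
    \<le> (8 * 4 ^ d + 4 * spread + 8 * real d ^ 4) * \<delta> powr (1/2)"
proof -
  define h where "h = \<delta> powr (1/4) * s"
  define k where "k = nat \<lceil>\<delta> * s\<^sup>2\<rceil>"
  define N where "N = nat \<lceil>s\<^sup>2\<rceil>"
  \<comment> \<open>At most \<open>4 * s\<^sup>2\<close> steps are made in all, each changing the
    deficit by at most \<open>3 * d ^ 3\<close>.\<close>
  define \<rho> where "\<rho> = 12 * real d ^ 3 * s\<^sup>2"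
  define q where "q = \<delta> powr (1/2)"
  have d0: "real d \<ge> 3"
    using d by simp
  have q: "q > 0" "q * q = \<delta>" and h2: "h\<^sup>2 = q * s\<^sup>2"
    using \<delta> by (auto simp: q_def h_def power_mult_distrib powr_add [symmetric] power2_eq_square)
  have s2: "s\<^sup>2 \<ge> 1"
    using s_ge_72 by (simp add: one_le_power)
  have h0: "0 < h" "h \<le> s"
    using \<delta> s_pos powr_mono2 [of "1/4" \<delta> 1] by (auto simp: h_def mult_le_cancel_right1)
  \<comment> \<open>Rounding up at most doubles, because
    \<open>\<delta> * s\<^sup>2 > 1\<close>.\<close>
  have k: "real k \<le> 2 * (\<delta> * s\<^sup>2)"
    using \<delta>(3) unfolding k_def by linarith
  have \<delta>s: "\<delta> * s\<^sup>2 \<le> s\<^sup>2"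
    using \<delta> by (intro mult_left_le_one_le) auto
  have N: "s\<^sup>2 \<le> real N" "real N \<le> 2 * s\<^sup>2"
    using s2 unfolding N_def by linarith+
  have Nk: "real (N + k) \<le> 4 * s\<^sup>2"
    using k N \<delta>s by simp
  have d3: "real d ^ 2 \<le> real d ^ 3" "real d \<le> real d ^ 3" "1 \<le> real d ^ 3"
    using d power_increasing [of 1 3 "real d"] by (auto intro: power_increasing)
  have \<rho>1: "real d + 2 * real d ^ 2 * real (N + k) \<le> \<rho>"
  proof -
    have "real d * 1 \<le> real d ^ 3 * s\<^sup>2"
      using s2 d3 by (intro mult_mono) auto
    moreover have "real d ^ 2 * real (N + k) \<le> real d ^ 3 * (4 * s\<^sup>2)"
      using Nk d3 by (intro mult_mono) auto
    moreover have "0 \<le> real d ^ 3 * s\<^sup>2"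
      by simp
    ultimately show ?thesis
      unfolding \<rho>_def by argo
  qed
  have \<rho>2: "3 * real d ^ 3 * real (N + k) \<le> \<rho>"
    using mult_left_mono [OF Nk, of "3 * real d ^ 3"] by (simp add: \<rho>_def)
  have \<rho>3: "\<rho> \<le> real n / 16"
  proof -
    have "192 * real d ^ 3 * s\<^sup>2 \<le> s * s\<^sup>2"
      using s by (intro mult_right_mono) auto
    then show ?thesis
      by (simp add: \<rho>_def n_eq power2_eq_square power3_eq_cube)
  qed
  have n0: "0 < n"
    using n_pos by simp
  have "good \<rho> (N + k) (\<lambda>_. d) {0}"
  proof (rule good_initial [OF n0 ne \<rho>1 \<rho>2])
    have "real d ^ 3 * real (N + k) \<le> \<rho> / 3"
      using \<rho>2 by simp
    then have "real (N + k) \<le> \<rho> / 3"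
      using mult_right_mono [OF d3(3), of "real (N + k)"] by simp
    moreover have "0 \<le> 2 * real d ^ 2 * real (N + k)"
      by simp
    then have "real d \<le> \<rho>"
      using \<rho>1 by linarith
    ultimately have "2 * real (N + k) + 2 * (real d + 1) \<le> \<rho> + 2 * \<rho> + \<rho>"
      using d0 by argo
    also have "\<dots> \<le> real n / 2"
      using \<rho>3 by simp
    finally show "2 * real (N + k) + 2 * (real d + 1) \<le> real n / 2" .
  qed
  then have "measure_pmf.prob (law n (\<lambda>_. d) p) {P. small_clusters n k {0} P}
      \<le> ((h + 2 * real d ^ 2)\<^sup>2 - (active (\<lambda>_. d) {0})\<^sup>2) * 2 / ((1 / 4) ^ d * real N) + 1 - real N / real N
        + (2 * spread + 4 * real d ^ 4) * real k / h\<^sup>2"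
  proof (intro climbing_bound [OF \<rho>_def \<rho>3 h0 _ _ \<rho>1])
    have "4 * spread * \<delta> powr (1/4) * s \<le> (1 / 4) ^ d * s"
      using \<delta> s_pos by (intro mult_right_mono) auto
    then show "4 * h * spread \<le> (1 / 4) ^ d * s"
      by (simp add: h_def mult_ac)
    show "N > 0"
      using N s2 by (intro gr0I) auto
    have "real d * 1 \<le> real d * real d"
      using d0 by (intro mult_left_mono) auto
    then show "active (\<lambda>_. d) {0} \<le> h + 2 * real d ^ 2"
      using h0 by (simp add: active_def power2_eq_square)
  qed auto
  also have "((h + 2 * real d ^ 2)\<^sup>2 - (active (\<lambda>_. d) {0})\<^sup>2) * 2 / ((1 / 4) ^ d * real N) + 1 - real N / real N
      \<le> 8 * 4 ^ d * q"
  proof -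
    \<comment> \<open>From \<open>\<delta> * s\<^sup>2 > 1\<close> follows
      \<open>q * s \<ge> 1\<close>, so
      \<open>h\<^sup>2 = q * s\<^sup>2 \<ge> s \<ge> 4 * d ^ 4\<close>: the overshoot is no larger
      than \<open>h\<close>.\<close>
    have "2 * real d ^ 2 \<le> h"
    proof (rule power2_le_imp_le)
      have "1\<^sup>2 \<le> (q * s)\<^sup>2"
        using \<delta>(3) by (simp add: power_mult_distrib power2_eq_square [of q] q)
      then have "1 \<le> q * s"
        by (rule power2_le_imp_le) (use q(1) s_pos in simp)
      then have "1 * s \<le> q * s * s"
        using s_pos by (intro mult_right_mono) auto
      then show "(2 * real d ^ 2)\<^sup>2 \<le> h\<^sup>2"
        using s(2) unfolding h2 by (simp add: power_mult_distrib power2_eq_square power4_eq_xxxx mult.assoc)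
    qed (use h0 in auto)
    then have "(h + 2 * real d ^ 2)\<^sup>2 \<le> (2 * h)\<^sup>2"
      using h0 by (intro power_mono) auto
    also have "\<dots> = 4 * q * s\<^sup>2"
      by (simp add: power_mult_distrib h2)
    finally have "(h + 2 * real d ^ 2)\<^sup>2 - (active (\<lambda>_. d) {0})\<^sup>2 \<le> 4 * q * s\<^sup>2"
      using zero_le_power2 [of "active (\<lambda>_. d) {0}"] by linarith
    then have "((h + 2 * real d ^ 2)\<^sup>2 - (active (\<lambda>_. d) {0})\<^sup>2) * 2 / ((1 / 4) ^ d * real N)
        \<le> (4 * q * s\<^sup>2) * 2 / ((1 / 4) ^ d * s\<^sup>2)"
      using N q(1) s_pos by (intro frac_le mult_right_mono mult_left_mono) auto
    also have "\<dots> = 8 * 4 ^ d * q"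
      using s_pos by (simp add: power_divide)
    finally show ?thesis
      using N s2 by simp
  qed
  also have "(2 * spread + 4 * real d ^ 4) * real k / h\<^sup>2 \<le> (2 * spread + 4 * real d ^ 4) * (2 * q)"
  proof -
    have "real k / h\<^sup>2 \<le> 2 * (\<delta> * s\<^sup>2) / h\<^sup>2"
      using k by (intro divide_right_mono) auto
    also have "\<dots> = 2 * q"
      using q s_pos by (simp add: h2 flip: q(2))
    finally have "(2 * spread + 4 * real d ^ 4) * (real k / h\<^sup>2) \<le> (2 * spread + 4 * real d ^ 4) * (2 * q)"
      using L by (intro mult_left_mono) (auto simp: spread_def)
    then show ?thesis
      by simp
  qed
  finally show ?thesis
    by (simp add: k_def q_def algebra_simps)
qed

section \<open>Both tails of the largest component\<close>

lemma Gndp_eq_law: "Gndp n d p = law n (\<lambda>_. d) p"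
  by (simp add: Gndp_def law_def regular_graphs_eq)

lemma cube_root_powers:
  assumes "n > 0"
  shows "(real n powr (1/3)) ^ 3 = real n" "(real n powr (1/3))\<^sup>2 = real n powr (2/3)"
    "real n powr (1/3) > 0"
  using assms by (simp_all add: powr_power powr_realpow [symmetric] powr_powr)

lemma critical_window_Gndp:
  assumes d: "d \<ge> 3" and def: "Gndp_defined n d (critical_p d lam n)"
    and s: "s = real n powr (1/3)" "s \<ge> 2 * (\<bar>lam\<bar> + 1)" "s \<ge> 8 * real d ^ 2"
  shows "critical_window n d (critical_p d lam n) s (\<bar>lam\<bar> + 1)"
proof
  have n: "n > 0" and p: "0 < critical_p d lam n" "critical_p d lam n < 1"
    using def by (auto simp: Gndp_defined_def)
  show "real n = s ^ 3"
    using cube_root_powers [OF n] s(1) by simp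
  have "critical_p d lam n * (real d - 1) - 1 = lam / s"
    using d by (simp add: critical_p_def s(1) powr_minus_divide)
  then show "\<bar>critical_p d lam n * (real d - 1) - 1\<bar> \<le> (\<bar>lam\<bar> + 1) / s"
    using cube_root_powers(3) [OF n] s(1) by (simp add: divide_right_mono)
qed (use assms in \<open>auto simp: Gndp_defined_def\<close>)

lemma largest_component_upper_tail:
  fixes d :: nat and lam :: real
  assumes d: "d \<ge> 3"
  shows "\<exists>c::real>0. \<exists>C::real. \<forall>A::real>0. \<forall>n. Gndp_defined n d (critical_p d lam n) \<longrightarrow>
            measure_pmf.prob (Gndp n d (critical_p d lam n))
              {G. real (largest_component_size n G) \<ge> A * real n powr (2/3)}
            \<le> C * exp (- c * A ^ 3) / A"
proof -
  define L where "L = \<bar>lam\<bar> + 1"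
  define D where "D = 4 * 4 ^ d * (real d * (L + 1) + 1)"
  define \<epsilon> where "\<epsilon> = 1 / (96 * real d ^ 3)"
  define \<eta> where "\<eta> = \<epsilon> / (4096 * real d ^ 6)"
  define c where "c = \<eta> * \<epsilon>\<^sup>2 / (512 * real d ^ 2)"
  \<comment> \<open>The main case has \<open>A\<^sub>0 < A \<le> s\<close>, so this one maximum
    supplies the conditions on \<open>A\<close> and also the lower bounds required of
    \<open>s\<close>.\<close>
  define A\<^sub>0 where "A\<^sub>0 = Max {1, 8 / \<epsilon>, (2 * \<eta> + \<epsilon> * \<eta> * real d * (L + 1)) / c, 2 * L, 8 * real d ^ 2, D * real d ^ 2}"
  define C\<^sub>1 where "C\<^sub>1 = 2 * exp D * D * real d"
  \<comment> \<open>The second entry makes the claimed bound at least 1 for all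
    \<open>A \<le> A\<^sub>0\<close>.\<close>
  define C where "C = max C\<^sub>1 (A\<^sub>0 * exp (c * A\<^sub>0 ^ 3))"
  have pos: "\<epsilon> > 0" "\<eta> > 0" "c > 0"
    using d by (auto simp: \<epsilon>_def \<eta>_def c_def)
  have A0: "1 \<le> A\<^sub>0" "8 / \<epsilon> \<le> A\<^sub>0" "(2 * \<eta> + \<epsilon> * \<eta> * real d * (L + 1)) / c \<le> A\<^sub>0"
    "2 * L \<le> A\<^sub>0" "8 * real d ^ 2 \<le> A\<^sub>0" "D * real d ^ 2 \<le> A\<^sub>0"
    unfolding A\<^sub>0_def by (auto intro!: Max_ge)
  have C0: "C \<ge> 0"
    using A0(1) by (simp add: C_def le_max_iff_disj)
  have "measure_pmf.prob (Gndp n d (critical_p d lam n)) {G. real (largest_component_size n G) \<ge> A * real n powr (2/3)}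
      \<le> C * exp (- c * A ^ 3) / A"
    if A: "A > 0" and def: "Gndp_defined n d (critical_p d lam n)" for A n
  proof -
    let ?p = "critical_p d lam n"
    define s where "s = real n powr (1/3)"
    have n: "n > 0" and ne: "deg_graphs n (\<lambda>_. d) \<noteq> {}"
      using def by (auto simp: Gndp_defined_def regular_graphs_eq)
    note s = cube_root_powers [OF n, folded s_def]
    consider "A \<le> A\<^sub>0" | "A > s" | "A\<^sub>0 < A" "A \<le> s"
      by linarith
    then show ?thesis
    proof cases
      case 1
      have "A * 1 \<le> A\<^sub>0 * exp (c * A\<^sub>0 ^ 3 - c * A ^ 3)"
        using 1 A pos A0 by (intro mult_mono) (auto simp: power_mono)
      also have "\<dots> = A\<^sub>0 * exp (c * A\<^sub>0 ^ 3) * exp (- c * A ^ 3)"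
        by (simp add: exp_diff exp_minus divide_inverse)
      also have "\<dots> \<le> C * exp (- c * A ^ 3)"
        by (intro mult_right_mono) (auto simp: C_def)
      finally have "1 \<le> C * exp (- c * A ^ 3) / A"
        using A by (simp add: le_divide_eq)
      then show ?thesis
        using measure_pmf.prob_le_1 order_trans by blast
    next
      case 2
      \<comment> \<open>Here \<open>A * s\<^sup>2\<close> exceeds \<open>s ^ 3 = n\<close>, the
        number of all vertices.\<close>
      have "\<not> real (largest_component_size n P) \<ge> A * real n powr (2/3)" if "P \<in> simple_graphs n" for P
      proof -
        obtain v where v: "v < n" "largest_component_size n P = card (component P v)"
          using largest_component_size_attained [OF n] .
        have "card (component P v) \<le> n"
          using card_mono [OF _ component_bounded [OF that v(1)]] by simp
        then have "real (largest_component_size n P) \<le> s * s\<^sup>2"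
          using s(1) v by (simp add: power2_eq_square power3_eq_cube)
        also have "\<dots> < A * s\<^sup>2"
          using 2 s(3) by (intro mult_strict_right_mono) auto
        finally show ?thesis
          by (simp add: s(2))
      qed
      then show ?thesis
        unfolding Gndp_eq_law using C0 A by (subst prob_law_eq_0 [OF ne]) auto
    next
      case 3
      interpret critical_window n d ?p s L
        unfolding L_def using 3 A0 by (intro critical_window_Gndp [OF d def s_def]) (auto simp: L_def)
      have decay: "decay = D"
        by (simp add: decay_def D_def)
      have "A * s\<^sup>2 * measure_pmf.prob (law n (\<lambda>_. d) ?p) {P. A * s\<^sup>2 \<le> real (largest_component_size n P)}
          \<le> (\<Sum>v<n. measure_pmf.prob (law n (\<lambda>_. d) ?p) {P. A * s\<^sup>2 \<le> real (card (component P v))})"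
        by (rule largest_component_markov [OF ne n])
      also have "\<dots> \<le> (\<Sum>v<n. C\<^sub>1 / s * exp (- c * A ^ 3))"
      proof (rule sum_mono)
        fix v assume "v \<in> {..<n}"
        then have v: "v < n"
          by simp
        show "measure_pmf.prob (law n (\<lambda>_. d) ?p) {P. A * s\<^sup>2 \<le> real (card (component P v))} \<le> C\<^sub>1 / s * exp (- c * A ^ 3)"
          unfolding C\<^sub>1_def decay [symmetric]
        proof (rule large_cluster_bound [OF v ne _ \<epsilon>_def \<eta>_def c_def])
          show "decay * real d ^ 2 \<le> s" "1 \<le> A" "A \<le> s"
            using 3 A0 decay by auto
          have "8 / \<epsilon> \<le> A" "(2 * \<eta> + \<epsilon> * \<eta> * real d * (L + 1)) / c \<le> A"
            using 3 A0 by linarith+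
          then show "8 \<le> \<epsilon> * A" "2 * \<eta> + \<epsilon> * \<eta> * real d * (L + 1) \<le> c * A"
            using pos by (simp_all add: divide_le_eq mult.commute)
        qed
      qed
      \<comment> \<open>There are \<open>n = s ^ 3\<close> summands of order \<open>1 / s\<close>;
        the resulting \<open>s\<^sup>2\<close> cancels against the threshold
        \<open>A * s\<^sup>2\<close>.\<close>
      also have "\<dots> = s\<^sup>2 * (C\<^sub>1 * exp (- c * A ^ 3))"
        using s by (simp add: s(1) [symmetric] power2_eq_square power3_eq_cube)
      also have "\<dots> \<le> s\<^sup>2 * (C * exp (- c * A ^ 3))"
        by (intro mult_left_mono mult_right_mono) (auto simp: C_def)
      finally have "A * measure_pmf.prob (law n (\<lambda>_. d) ?p) {P. A * s\<^sup>2 \<le> real (largest_component_size n P)}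
          \<le> C * exp (- c * A ^ 3)"
        using s(3) by (simp add: mult.left_commute mult.assoc)
      then show ?thesis
        using A by (simp add: Gndp_eq_law s(2) le_divide_eq mult.commute)
    qed
  qed
  then show ?thesis
    using pos(3) by blast
qed

lemma largest_component_lower_tail:
  fixes d :: nat and lam :: real
  assumes d: "d \<ge> 3"
  shows "\<exists>D::real. \<exists>\<delta>\<^sub>0::real>0. \<forall>\<delta>::real. 0 < \<delta> \<and> \<delta> < \<delta>\<^sub>0 \<longrightarrow>
            (\<forall>n. Gndp_defined n d (critical_p d lam n) \<longrightarrow>
              measure_pmf.prob (Gndp n d (critical_p d lam n))
                {G. int (largest_component_size n G) < \<lceil>\<delta> * real n powr (2/3)\<rceil>}
              \<le> D * \<delta> powr (1/2))"
proof -
  define L where "L = \<bar>lam\<bar> + 1"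
  define W where "W = real d * (L + 36 * real d ^ 3)"
  define D where "D = 8 * 4 ^ d + 4 * W + 8 * real d ^ 4"
  define t where "t = (1 / 4) ^ d / (4 * W)"
  define s\<^sub>0 where "s\<^sub>0 = Max {1, 2 * L, 8 * real d ^ 2, 192 * real d ^ 3, 4 * real d ^ 4}"
  \<comment> \<open>\<open>t powr 4\<close> gives \<open>\<delta> powr (1/4) \<le> t\<close>, the
    smallness of \<open>h\<close> needed for climbing; \<open>1 / s\<^sub>0\<^sup>2\<close> ensures
    that \<open>\<delta> * s\<^sup>2 > 1\<close> forces \<open>s \<ge> s\<^sub>0\<close>.\<close>
  define \<delta>\<^sub>0 where "\<delta>\<^sub>0 = Min {1, t powr 4, 1 / s\<^sub>0\<^sup>2}"
  have W: "W > 0"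
    unfolding W_def L_def using d by (intro mult_pos_pos add_pos_nonneg add_nonneg_pos) auto
  then have t: "t > 0"
    by (simp add: t_def)
  have s0: "1 \<le> s\<^sub>0" "2 * L \<le> s\<^sub>0" "8 * real d ^ 2 \<le> s\<^sub>0" "192 * real d ^ 3 \<le> s\<^sub>0" "4 * real d ^ 4 \<le> s\<^sub>0"
    unfolding s\<^sub>0_def by (auto intro!: Max_ge)
  have \<delta>0: "\<delta>\<^sub>0 > 0" "\<delta>\<^sub>0 \<le> 1" "\<delta>\<^sub>0 \<le> t powr 4" "\<delta>\<^sub>0 \<le> 1 / s\<^sub>0\<^sup>2"
    using t s0(1) by (auto simp: \<delta>\<^sub>0_def)
  have D0: "D \<ge> 0"
    using W by (simp add: D_def)
  have "measure_pmf.prob (Gndp n d (critical_p d lam n)) {G. int (largest_component_size n G) < \<lceil>\<delta> * real n powr (2/3)\<rceil>}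
      \<le> D * \<delta> powr (1/2)"
    if \<delta>: "0 < \<delta>" "\<delta> < \<delta>\<^sub>0" and def: "Gndp_defined n d (critical_p d lam n)" for \<delta> n
  proof -
    let ?p = "critical_p d lam n"
    define s where "s = real n powr (1/3)"
    have n: "n > 0" and ne: "deg_graphs n (\<lambda>_. d) \<noteq> {}"
      using def by (auto simp: Gndp_defined_def regular_graphs_eq)
    note s = cube_root_powers [OF n, folded s_def]
    show ?thesis
    proof (cases "\<delta> * s\<^sup>2 \<le> 1")
      case True
      \<comment> \<open>The rounded threshold is at most 1 here, and a component always contains a
        vertex.\<close>
      have "\<not> int (largest_component_size n P) < \<lceil>\<delta> * real n powr (2/3)\<rceil>" if "P \<in> simple_graphs n" for P
      proof -
        have "0 < card (component P 0)"
          using finite_component [OF that n] component_self [of 0 P] by (auto simp: card_gt_0_iff)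
        then have "1 \<le> int (largest_component_size n P)"
          using largest_component_size_ge [OF that n] by simp
        moreover have "\<lceil>\<delta> * real n powr (2/3)\<rceil> \<le> 1"
          using True by (simp add: ceiling_le_iff s(2))
        ultimately show ?thesis
          by linarith
      qed
      then show ?thesis
        unfolding Gndp_eq_law using D0 by (subst prob_law_eq_0 [OF ne]) auto
    next
      case False
      have "s\<^sub>0\<^sup>2 \<le> s\<^sup>2"
      proof -
        have "s\<^sub>0\<^sup>2 * \<delta> \<le> s\<^sub>0\<^sup>2 * (1 / s\<^sub>0\<^sup>2)"
          using \<delta> \<delta>0(4) by (intro mult_left_mono) auto
        then have "s\<^sub>0\<^sup>2 * \<delta> \<le> 1"
          using s0(1) by simp
        then have "\<delta> * s\<^sub>0\<^sup>2 \<le> \<delta> * s\<^sup>2"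
          using False by (simp add: mult.commute)
        then show ?thesis
          using \<delta> by simp
      qed
      then have s0s: "s\<^sub>0 \<le> s"
        by (rule power2_le_imp_le) (use s(3) in simp)
      interpret critical_window n d ?p s L
        unfolding L_def using s0 s0s by (intro critical_window_Gndp [OF d def s_def]) (auto simp: L_def)
      have spread: "spread = W"
        by (simp add: spread_def W_def)
      have "measure_pmf.prob (law n (\<lambda>_. d) ?p) {G. int (largest_component_size n G) < \<lceil>\<delta> * s\<^sup>2\<rceil>}
          \<le> measure_pmf.prob (law n (\<lambda>_. d) ?p) {P. small_clusters n (nat \<lceil>\<delta> * s\<^sup>2\<rceil>) {0} P}"
      proof (rule measure_pmf.finite_measure_mono_AE)
        have "small_clusters n (nat \<lceil>\<delta> * s\<^sup>2\<rceil>) {0} P"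
          if P: "P \<in> simple_graphs n" and "int (largest_component_size n P) < \<lceil>\<delta> * s\<^sup>2\<rceil>" for P
        proof -
          have "card (component P v) < nat \<lceil>\<delta> * s\<^sup>2\<rceil>" if "v < n" for v
            using largest_component_size_ge [OF P that] \<open>int (largest_component_size n P) < \<lceil>\<delta> * s\<^sup>2\<rceil>\<close> by linarith
          then show ?thesis
            using P n by (simp add: small_clusters_def reach_def)
        qed
        then show "AE P in law n (\<lambda>_. d) ?p. P \<in> {G. int (largest_component_size n G) < \<lceil>\<delta> * s\<^sup>2\<rceil>}
            \<longrightarrow> P \<in> {P. small_clusters n (nat \<lceil>\<delta> * s\<^sup>2\<rceil>) {0} P}"
          using set_pmf_law_simple [OF ne] by (auto simp: AE_measure_pmf_iff)
      qed simp
      also have "\<dots> \<le> D * \<delta> powr (1/2)"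
        unfolding D_def spread [symmetric]
      proof (rule small_clusters_prob_le [OF ne _ _ \<delta>(1)])
        have "\<delta> powr (1/4) \<le> (t powr 4) powr (1/4)"
          using \<delta> \<delta>0 by (intro powr_mono2) auto
        also have "\<dots> = t"
          unfolding powr_powr using t by simp
        finally have "4 * W * \<delta> powr (1/4) \<le> 4 * W * t"
          using W by (intro mult_left_mono) auto
        then show "4 * spread * \<delta> powr (1/4) \<le> (1 / 4) ^ d"
          using W by (simp add: spread t_def)
      qed (use s0 s0s \<delta> \<delta>0 False in auto)
      finally show ?thesis
        by (simp add: Gndp_eq_law s(2))
    qed
  qed
  then show ?thesis
    using \<delta>0(1) by blast
qed

theorem theorem2:
  fixes d :: nat and lam :: real
  assumes "d \<ge> 3"
  shows "(\<exists>c::real>0. \<exists>C::real. \<forall>A::real>0. \<forall>n. Gndp_defined n d (critical_p d lam n) \<longrightarrow>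
            measure_pmf.prob (Gndp n d (critical_p d lam n))
              {G. real (largest_component_size n G) \<ge> A * real n powr (2/3)}
            \<le> C * exp (- c * A ^ 3) / A) \<and>
         (\<exists>D::real. \<exists>\<delta>\<^sub>0::real>0. \<forall>\<delta>::real. 0 < \<delta> \<and> \<delta> < \<delta>\<^sub>0 \<longrightarrow>
            (\<forall>n. Gndp_defined n d (critical_p d lam n) \<longrightarrow>
              measure_pmf.prob (Gndp n d (critical_p d lam n))
                {G. int (largest_component_size n G) < \<lceil>\<delta> * real n powr (2/3)\<rceil>}
              \<le> D * \<delta> powr (1/2)))"
  using largest_component_upper_tail [OF assms] largest_component_lower_tail [OF assms] by (rule conjI)

end
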